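(* Let $A$ be a finite-dimensional commutative unital algebra, let $(\mathbb{A},M,A,q)$ be an algebra bundle with bundle atlas $(\varphi_i,U_i)_{i\in I}$, let $n:=\dim A_{\mathrm{ss}}$, and let $p:\widehat{M}\to M$ be the associated $n$-fold covering and $\Omega_I:\Gamma\mathbb{A}_{\mathrm{ss}}\to C^\infty(\widehat M)$ the associated algebra isomorphism described in the context. Then the map $$\Xi_I:\widehat{M}\to\Gamma_{\Gamma\mathbb{A}},\quad \Xi_I(\widehat{m})(s):=\delta_{\widehat{m}}(\Omega_I(\overline{s}))=\Omega_I(\overline{s})(\widehat{m}),$$ is a homeomorphism, where $\overline{s}\in\Gamma\mathbb{A}_{\mathrm{ss}}$ is the image of $s\in\Gamma\mathbb{A}$. In particular, the spectrum $\Gamma_{\Gamma\mathbb{A}}$ is an $n$-fold covering of $M$ (via $p\circ\Xi_I^{-1}$).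
   Context: Manifolds (such as $M$) are finite-dimensional, paracompact, second countable and smooth. All algebras are complex. For an algebra $B$, $\Gamma_B$ is the set of nonzero algebra homomorphisms $B\to\mathbb{C}$ with the topology of pointwise convergence. An algebra bundle $(\mathbb{A},M,A,q)$ with fibre $A$ is a smooth map $q:\mathbb{A}\to M$ whose fibres are algebras, such that $M$ is covered by open sets $U$ with diffeomorphisms (bundle charts) $\varphi_U:U\times A\to q^{-1}(U)$ over $U$ that are fibrewise algebra isomorphisms. $\Gamma\mathbb{A}$ is the algebra of smooth sections with pointwise operations. Let $A_{\mathrm n}$ be the Jacobson radical of $A$ and $A_{\mathrm{ss}}:=A/A_{\mathrm n}$; every $\phi\in\operatorname{Aut}(A)$ induces $\pi_{\mathrm{ss}}(\phi)\in\operatorname{Aut}(A_{\mathrm{ss}})$. Fix an isomorphism $A_{\mathrm{ss}}\cong\mathbb{C}^n$. Let $U_{ij}=U_i\cap U_j$, let $g_{ij}\in C^\infty(U_{ij},\operatorname{Aut}(A))$ be the transition functions, $(\varphi_i^{-1}\circ\varphi_j)(x,a)=(x,g_{ij}(x).a)$, and $g_{ij}^{\mathrm{ss}}:=\pi_{\mathrm{ss}}\circ g_{ij}$. The quotient bundle $\mathbb{A}_{\mathrm{ss}}$ over $M$ has fibres $\mathbb{A}_m/\mathrm{rad}(\mathbb{A}_m)$ and bundle charts $\varphi_i^{\mathrm{ss}}:U_i\times A_{\mathrm{ss}}\to(\mathbb{A}_{\mathrm{ss}})_{U_i}$ induced by $\varphi_i$, with transition functions $g^{\mathrm{ss}}_{ij}$;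 for $s\in\Gamma\mathbb{A}$, $\overline{s}(m):=s(m)+\mathrm{rad}(\mathbb{A}_m)$. Let $I_n:=\{1,\ldots,n\}$, $S_n$ the symmetric group, and $\iota:S_n\to\operatorname{Aut}(\mathbb{C}^n)$ the group isomorphism $\iota(\tau)(z_1,\ldots,z_n)=(z_{\tau^{-1}(1)},\ldots,z_{\tau^{-1}(n)})$. Put $h_{ij}:=\iota^{-1}\circ g_{ij}^{\mathrm{ss}}:U_{ij}\to S_n$ (smooth, i.e. locally constant). Then $p:\widehat M\to M$ is the $n$-fold covering (fibre bundle with fibre $I_n$) having bundle charts $\psi_i:U_i\times I_n\to p^{-1}(U_i)$ with $(\psi_i^{-1}\circ\psi_j)(x,k)=(x,h_{ij}(x)(k))$. For $\overline{s}\in\Gamma\mathbb{A}_{\mathrm{ss}}$ let $\overline{s}_i:=\mathrm{pr}\circ(\varphi_i^{\mathrm{ss}})^{-1}\circ\overline{s}|_{U_i}:U_i\to A_{\mathrm{ss}}\cong\mathbb{C}^n$. The algebra isomorphism $\Omega_I:\Gamma\mathbb{A}_{\mathrm{ss}}\to C^\infty(\widehat M)$ is given by $\Omega_I(\overline{s})(\psi_i(x,k)):=$ the $k$-th coordinate of $\overline{s}_i(x)$, for $x\in U_i$, $k\in I_n$. *)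

theory Defs
  imports
    "HOL-Analysis.Derivative"
    "HOL-Analysis.Function_Topology"
    "HOL-Analysis.Abstract_Topological_Spaces"
    "HOL-Algebra.QuotRing"
    "HOL-Algebra.Module"
    "HOL-Combinatorics.Permutations"
begin

section \<open>Smooth manifolds\<close>

text \<open>
  The model space of a manifold is a type of class \<open>real_normed_vector\<close> that is required to be
  finite-dimensional (see \<open>smooth_manifold\<close>). The class \<open>euclidean_space\<close> is not used because it
  excludes dimension 0.

  \<open>ck_on k S f\<close> is meant for open \<open>S\<close>. On a finite-dimensional domain, continuity of
  \<open>x \<mapsto> Df(x) v\<close> for every fixed \<open>v\<close> is the same as continuity of \<open>Df\<close>.
\<close>

primrec ck_on ::
    "nat \<Rightarrow> 'a::real_normed_vector set \<Rightarrow> ('a \<Rightarrow> 'b::real_normed_vector) \<Rightarrow> bool" where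
  "ck_on 0 S f \<longleftrightarrow> continuous_on S f"
| "ck_on (Suc k) S f \<longleftrightarrow>
     (\<forall>x\<in>S. f differentiable (at x)) \<and> (\<forall>v. ck_on k S (\<lambda>x. frechet_derivative f (at x) v))"

definition smooth_on ::
    "'a::real_normed_vector set \<Rightarrow> ('a \<Rightarrow> 'b::real_normed_vector) \<Rightarrow> bool" where
  "smooth_on S f \<longleftrightarrow> (\<forall>k. ck_on k S f)"

definition finite_dimensional :: "'b::real_vector itself \<Rightarrow> bool" where
  "finite_dimensional _ \<longleftrightarrow> (\<exists>D::'b set. finite D \<and> span D = UNIV)"

definition paracompact_space :: "'p topology \<Rightarrow> bool" where
  "paracompact_space X \<longleftrightarrow> Hausdorff_space X \<and>
     (\<forall>\<U>. (\<forall>U\<in>\<U>. openin X U) \<and> \<Union>\<U> = topspace X \<longrightarrow>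
       (\<exists>\<V>. (\<forall>V\<in>\<V>. openin X V \<and> (\<exists>U\<in>\<U>. V \<subseteq> U)) \<and> \<Union>\<V> = topspace X \<and> locally_finite_in X \<V>))"

text \<open>A chart is a pair of its domain and a map that is only relevant on this domain.\<close>

record ('p, 'b) manifold_data =
  mtop :: "'p topology"
  atlas :: "('p set \<times> ('p \<Rightarrow> 'b)) set"

abbreviation points :: "('p, 'b) manifold_data \<Rightarrow> 'p set" where
  "points M \<equiv> topspace (mtop M)"

definition smooth_manifold :: "('p, 'b::real_normed_vector) manifold_data \<Rightarrow> bool" where
  "smooth_manifold M \<longleftrightarrow>
     finite_dimensional TYPE('b) \<and> paracompact_space (mtop M) \<and> second_countable (mtop M) \<and>
     (\<forall>(U, c)\<in>atlas M. openin (mtop M) U \<and> open (c ` U) \<and>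
        homeomorphic_map (subtopology (mtop M) U) (subtopology euclidean (c ` U)) c) \<and>
     (\<Union>(U, c)\<in>atlas M. U) = points M \<and>
     (\<forall>(U, c)\<in>atlas M. \<forall>(V, d)\<in>atlas M. smooth_on (c ` (U \<inter> V)) (d \<circ> inv_into U c))"

definition smooth_map ::
    "('p, 'b::real_normed_vector) manifold_data \<Rightarrow> ('r, 'c::real_normed_vector) manifold_data \<Rightarrow>
     ('p \<Rightarrow> 'r) \<Rightarrow> bool" where
  "smooth_map M N f \<longleftrightarrow> continuous_map (mtop M) (mtop N) f \<and>
     (\<forall>(U, c)\<in>atlas M. \<forall>(V, d)\<in>atlas N.
        smooth_on (c ` {x\<in>U. f x \<in> V}) (d \<circ> f \<circ> inv_into U c))"

definition diffeomorphism ::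
    "('p, 'b::real_normed_vector) manifold_data \<Rightarrow> ('r, 'c::real_normed_vector) manifold_data \<Rightarrow>
     ('p \<Rightarrow> 'r) \<Rightarrow> bool" where
  "diffeomorphism M N f \<longleftrightarrow> bij_betw f (points M) (points N) \<and>
     smooth_map M N f \<and> smooth_map N M (inv_into (points M) f)"

definition open_submanifold ::
    "('p, 'b) manifold_data \<Rightarrow> 'p set \<Rightarrow> ('p, 'b) manifold_data" where
  "open_submanifold M W =
     \<lparr>mtop = subtopology (mtop M) W, atlas = (\<lambda>(U, c). (U \<inter> W, c)) ` atlas M\<rparr>"

definition vector_manifold :: "('a::real_normed_vector, 'a) manifold_data" where
  "vector_manifold = \<lparr>mtop = euclidean, atlas = {(UNIV, id)}\<rparr>"

definition prod_manifold ::
    "('p, 'b) manifold_data \<Rightarrow> ('r, 'c) manifold_data \<Rightarrow> ('p \<times> 'r, 'b \<times> 'c) manifold_data" where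
  "prod_manifold M N =
     \<lparr>mtop = prod_topology (mtop M) (mtop N),
      atlas = (\<lambda>((U, c), (V, d)). (U \<times> V, map_prod c d)) ` (atlas M \<times> atlas N)\<rparr>"

text \<open>The product with a discrete (0-dimensional) manifold keeps the model space of \<open>M\<close>.\<close>

definition discrete_prod_manifold ::
    "('p, 'b) manifold_data \<Rightarrow> 'k set \<Rightarrow> ('p \<times> 'k, 'b) manifold_data" where
  "discrete_prod_manifold M K =
     \<lparr>mtop = prod_topology (mtop M) (discrete_topology K),
      atlas = (\<lambda>((U, c), k). (U \<times> {k}, c \<circ> fst)) ` (atlas M \<times> K)\<rparr>"


section \<open>Complex algebras and their spectra\<close>

definition complex_alg :: "(complex, complex) module" where
  "complex_alg = \<lparr>carrier = UNIV, mult = (*), one = 1, zero = 0, add = (+), smult = (*)\<rparr>"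

text \<open>The library's algebras are commutative and unital; the zero algebra is allowed.\<close>

abbreviation complex_algebra :: "(complex, 'v) module \<Rightarrow> bool" where
  "complex_algebra B \<equiv> Module.algebra complex_alg B"

text \<open>Homomorphisms are not required to preserve the unit.\<close>

definition alg_hom :: "(complex, 'v) module \<Rightarrow> (complex, 'w) module \<Rightarrow> ('v \<Rightarrow> 'w) set" where
  "alg_hom B C = {h \<in> carrier B \<rightarrow> carrier C.
     (\<forall>x\<in>carrier B. \<forall>y\<in>carrier B.
        h (x \<oplus>\<^bsub>B\<^esub> y) = h x \<oplus>\<^bsub>C\<^esub> h y \<and> h (x \<otimes>\<^bsub>B\<^esub> y) = h x \<otimes>\<^bsub>C\<^esub> h y) \<and>
     (\<forall>a. \<forall>x\<in>carrier B. h (a \<odot>\<^bsub>B\<^esub> x) = a \<odot>\<^bsub>C\<^esub> h x)}"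

definition alg_iso :: "(complex, 'v) module \<Rightarrow> (complex, 'w) module \<Rightarrow> ('v \<Rightarrow> 'w) set" where
  "alg_iso B C = {h \<in> alg_hom B C. bij_betw h (carrier B) (carrier C)}"

definition has_dimension :: "(complex, 'v) module \<Rightarrow> nat \<Rightarrow> bool" where
  "has_dimension B n \<longleftrightarrow> (\<exists>b. b \<in> {1..n} \<rightarrow> carrier B \<and>
     bij_betw (\<lambda>c. \<Oplus>\<^bsub>B\<^esub>i\<in>{1..n}. c i \<odot>\<^bsub>B\<^esub> b i) ({1..n} \<rightarrow>\<^sub>E UNIV) (carrier B))"

definition power_alg :: "nat \<Rightarrow> (complex, nat \<Rightarrow> complex) module" where
  "power_alg n =
     \<lparr>carrier = {1..n} \<rightarrow>\<^sub>E UNIV,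
      mult = (\<lambda>z w. \<lambda>k\<in>{1..n}. z k * w k), one = (\<lambda>k\<in>{1..n}. 1),
      zero = (\<lambda>k\<in>{1..n}. 0), add = (\<lambda>z w. \<lambda>k\<in>{1..n}. z k + w k),
      smult = (\<lambda>a z. \<lambda>k\<in>{1..n}. a * z k)\<rparr>"

definition characters :: "(complex, 'v) module \<Rightarrow> ('v \<Rightarrow> complex) set" where
  "characters B =
     {f \<in> extensional (carrier B) \<inter> alg_hom B complex_alg. \<exists>x\<in>carrier B. f x \<noteq> 0}"

text \<open>Pointwise convergence on \<open>carrier B\<close> is convergence in the product topology.\<close>

definition spectrum_top :: "(complex, 'v) module \<Rightarrow> ('v \<Rightarrow> complex) topology" where
  "spectrum_top B = subtopology (product_topology (\<lambda>_. euclidean) (carrier B)) (characters B)"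

definition jacobson_radical :: "(complex, 'v) module \<Rightarrow> 'v set" where
  "jacobson_radical B = {x \<in> carrier B. \<forall>J. maximalideal J B \<longrightarrow> x \<in> J}"

definition ss_quotient :: "(complex, 'v) module \<Rightarrow> (complex, 'v set) module" where
  "ss_quotient B =
    (let N = jacobson_radical B; Q = B Quot N in
     \<lparr>carrier = carrier Q, mult = mult Q, one = one Q, zero = zero Q, add = add Q,
      smult = (\<lambda>a X. \<Union>x\<in>X. N +>\<^bsub>B\<^esub> (a \<odot>\<^bsub>B\<^esub> x))\<rparr>)"

text \<open>For an isomorphism \<open>f\<close> from \<open>B\<close> to \<open>C\<close>, the induced map \<open>x + rad B \<mapsto> f x + rad C\<close>.\<close>

definition ss_map ::
    "(complex, 'v) module \<Rightarrow> (complex, 'w) module \<Rightarrow> ('v \<Rightarrow> 'w) \<Rightarrow> 'v set \<Rightarrow> 'w set" where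
  "ss_map B C f = (\<lambda>X\<in>carrier (ss_quotient B). \<Union>x\<in>X. jacobson_radical C +>\<^bsub>C\<^esub> f x)"


section \<open>Algebra bundles\<close>

text \<open>
  The typical fibre is an algebra on a whole normed type \<open>'a\<close>, whose vector space structure is the
  one of the type; the norm only serves to provide the canonical smooth structure of a
  finite-dimensional vector space, which is independent of the norm.
  \<open>fibre_at m\<close> is the algebra structure of the fibre over \<open>m\<close>.
\<close>

record ('m, 'b, 'e, 'c, 'a, 'i) bundle_data =
  base_space :: "('m, 'b) manifold_data"
  total_space :: "('e, 'c) manifold_data"
  typical_fibre :: "(complex, 'a) module"
  proj :: "'e \<Rightarrow> 'm"
  fibre_at :: "'m \<Rightarrow> (complex, 'e) module"
  index_set :: "'i set"
  patch :: "'i \<Rightarrow> 'm set"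
  bchart :: "'i \<Rightarrow> 'm \<times> 'a \<Rightarrow> 'e"

definition fd_normed_algebra :: "(complex, 'a::real_normed_vector) module \<Rightarrow> bool" where
  "fd_normed_algebra A \<longleftrightarrow> complex_algebra A \<and> (\<exists>k. has_dimension A k) \<and>
     carrier A = UNIV \<and> add A = (+) \<and> (\<forall>r x. complex_of_real r \<odot>\<^bsub>A\<^esub> x = r *\<^sub>R x)"

definition algebra_bundle ::
    "('m, 'b::real_normed_vector, 'e, 'c::real_normed_vector, 'a::real_normed_vector, 'i) bundle_data
     \<Rightarrow> bool" where
  "algebra_bundle B \<longleftrightarrow>
     smooth_manifold (base_space B) \<and> smooth_manifold (total_space B) \<and>
     smooth_map (total_space B) (base_space B) (proj B) \<and>
     (\<forall>m\<in>points (base_space B). complex_algebra (fibre_at B m) \<and>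
        carrier (fibre_at B m) = {e \<in> points (total_space B). proj B e = m}) \<and>
     (\<Union>i\<in>index_set B. patch B i) = points (base_space B) \<and>
     (\<forall>i\<in>index_set B.
        openin (mtop (base_space B)) (patch B i) \<and>
        diffeomorphism
          (prod_manifold (open_submanifold (base_space B) (patch B i)) vector_manifold)
          (open_submanifold (total_space B) {e \<in> points (total_space B). proj B e \<in> patch B i})
          (bchart B i) \<and>
        (\<forall>x\<in>patch B i. (\<forall>a. proj B (bchart B i (x, a)) = x) \<and>
           (\<lambda>a. bchart B i (x, a)) \<in> alg_iso (typical_fibre B) (fibre_at B x)))"

definition section_alg ::
    "('m, 'b::real_normed_vector, 'e, 'c::real_normed_vector, 'a, 'i) bundle_data
     \<Rightarrow> (complex, 'm \<Rightarrow> 'e) module" where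
  "section_alg B =
    (let P = points (base_space B) in
     \<lparr>carrier = {s \<in> extensional P. smooth_map (base_space B) (total_space B) s \<and>
                    (\<forall>m\<in>P. proj B (s m) = m)},
      mult = (\<lambda>s t. \<lambda>m\<in>P. s m \<otimes>\<^bsub>fibre_at B m\<^esub> t m),
      one = (\<lambda>m\<in>P. \<one>\<^bsub>fibre_at B m\<^esub>),
      zero = (\<lambda>m\<in>P. \<zero>\<^bsub>fibre_at B m\<^esub>),
      add = (\<lambda>s t. \<lambda>m\<in>P. s m \<oplus>\<^bsub>fibre_at B m\<^esub> t m),
      smult = (\<lambda>a s. \<lambda>m\<in>P. a \<odot>\<^bsub>fibre_at B m\<^esub> s m)\<rparr>)"

definition transition ::
    "('m, 'b, 'e, 'c, 'a, 'i) bundle_data \<Rightarrow> 'i \<Rightarrow> 'i \<Rightarrow> 'm \<Rightarrow> 'a \<Rightarrow> 'a" where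
  "transition B i j x a = snd (inv_into (patch B i \<times> UNIV) (bchart B i) (bchart B j (x, a)))"


section \<open>The quotient bundle\<close>

text \<open>
  The point \<open>e + rad\<close> of the quotient bundle over \<open>m\<close> is the coset itself, a subset of the total
  space; cosets in different fibres are disjoint.
\<close>

abbreviation fibre_ss :: "('m, 'b, 'e, 'c, 'a, 'i) bundle_data \<Rightarrow> (complex, 'a set) module" where
  "fibre_ss B \<equiv> ss_quotient (typical_fibre B)"

definition transition_ss ::
    "('m, 'b, 'e, 'c, 'a, 'i) bundle_data \<Rightarrow> 'i \<Rightarrow> 'i \<Rightarrow> 'm \<Rightarrow> 'a set \<Rightarrow> 'a set" where
  "transition_ss B i j x = ss_map (typical_fibre B) (typical_fibre B) (transition B i j x)"

definition bchart_ss ::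
    "('m, 'b, 'e, 'c, 'a, 'i) bundle_data \<Rightarrow> 'i \<Rightarrow> 'm \<times> 'a set \<Rightarrow> 'e set" where
  "bchart_ss B i =
     (\<lambda>(x, X). ss_map (typical_fibre B) (fibre_at B x) (\<lambda>a. bchart B i (x, a)) X)"

definition section_ss ::
    "('m, 'b, 'e, 'c, 'a, 'i) bundle_data \<Rightarrow> ('m \<Rightarrow> 'e) \<Rightarrow> 'm \<Rightarrow> 'e set" where
  "section_ss B s = (\<lambda>m\<in>points (base_space B).
     jacobson_radical (fibre_at B m) +>\<^bsub>fibre_at B m\<^esub> s m)"

text \<open>
  \<open>\<theta>\<close> is the fixed isomorphism from \<open>fibre_ss B\<close> to \<open>power_alg n\<close>; \<open>local_rep B \<theta> i t\<close> is the
  local representative of a section \<open>t\<close> of the quotient bundle over \<open>patch B i\<close>.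
\<close>

definition local_rep ::
    "('m, 'b, 'e, 'c, 'a, 'i) bundle_data \<Rightarrow> ('a set \<Rightarrow> nat \<Rightarrow> complex) \<Rightarrow> 'i \<Rightarrow>
     ('m \<Rightarrow> 'e set) \<Rightarrow> 'm \<Rightarrow> nat \<Rightarrow> complex" where
  "local_rep B \<theta> i t x =
     \<theta> (snd (inv_into (patch B i \<times> carrier (fibre_ss B)) (bchart_ss B i) (t x)))"

text \<open>
  The smooth structure of the quotient bundle is the one for which the charts \<open>bchart_ss B i\<close> are
  diffeomorphisms, so a section is smooth iff all its local representatives are.
\<close>

definition sections_ss ::
    "('m, 'b::real_normed_vector, 'e, 'c, 'a, 'i) bundle_data \<Rightarrow> nat \<Rightarrow>
     ('a set \<Rightarrow> nat \<Rightarrow> complex) \<Rightarrow> ('m \<Rightarrow> 'e set) set" where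
  "sections_ss B n \<theta> =
     {t \<in> (\<Pi>\<^sub>E m\<in>points (base_space B). carrier (ss_quotient (fibre_at B m))).
        \<forall>i\<in>index_set B. \<forall>k\<in>{1..n}.
          smooth_map (open_submanifold (base_space B) (patch B i)) vector_manifold
            (\<lambda>x. local_rep B \<theta> i t x k)}"


section \<open>The associated covering\<close>

definition perm_aut :: "nat \<Rightarrow> (nat \<Rightarrow> nat) \<Rightarrow> (nat \<Rightarrow> complex) \<Rightarrow> nat \<Rightarrow> complex" where
  "perm_aut n \<tau> = (\<lambda>z\<in>carrier (power_alg n). \<lambda>k\<in>{1..n}. z (inv_into UNIV \<tau> k))"

definition perm_transition ::
    "('m, 'b, 'e, 'c, 'a, 'i) bundle_data \<Rightarrow> nat \<Rightarrow> ('a set \<Rightarrow> nat \<Rightarrow> complex) \<Rightarrow>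
     'i \<Rightarrow> 'i \<Rightarrow> 'm \<Rightarrow> nat \<Rightarrow> nat" where
  "perm_transition B n \<theta> i j x =
     inv_into {\<tau>. \<tau> permutes {1..n}} (perm_aut n)
       (\<lambda>z\<in>carrier (power_alg n).
          \<theta> (transition_ss B i j x (inv_into (carrier (fibre_ss B)) \<theta> z)))"

definition associated_covering ::
    "('m, 'b::real_normed_vector, 'e, 'c, 'a, 'i) bundle_data \<Rightarrow> nat \<Rightarrow>
     ('a set \<Rightarrow> nat \<Rightarrow> complex) \<Rightarrow>
     ('h, 'b) manifold_data \<Rightarrow> ('h \<Rightarrow> 'm) \<Rightarrow> ('i \<Rightarrow> 'm \<times> nat \<Rightarrow> 'h) \<Rightarrow> bool" where
  "associated_covering B n \<theta> Mh p \<psi> \<longleftrightarrow>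
     smooth_manifold Mh \<and> smooth_map Mh (base_space B) p \<and>
     (\<forall>i\<in>index_set B.
        diffeomorphism
          (discrete_prod_manifold (open_submanifold (base_space B) (patch B i)) {1..n})
          (open_submanifold Mh {y \<in> points Mh. p y \<in> patch B i})
          (\<psi> i) \<and>
        (\<forall>x\<in>patch B i. \<forall>k\<in>{1..n}. p (\<psi> i (x, k)) = x)) \<and>
     (\<forall>i\<in>index_set B. \<forall>j\<in>index_set B. \<forall>x\<in>patch B i \<inter> patch B j. \<forall>k\<in>{1..n}.
        inv_into (patch B i \<times> {1..n}) (\<psi> i) (\<psi> j (x, k)) = (x, perm_transition B n \<theta> i j x k))"

definition Omega ::
    "('m, 'b::real_normed_vector, 'e, 'c, 'a, 'i) bundle_data \<Rightarrow> nat \<Rightarrow>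
     ('a set \<Rightarrow> nat \<Rightarrow> complex) \<Rightarrow>
     ('h, 'b) manifold_data \<Rightarrow> ('i \<Rightarrow> 'm \<times> nat \<Rightarrow> 'h) \<Rightarrow> ('m \<Rightarrow> 'e set) \<Rightarrow> 'h \<Rightarrow> complex" where
  "Omega B n \<theta> Mh \<psi> = (\<lambda>t\<in>sections_ss B n \<theta>. \<lambda>y\<in>points Mh.
     THE z. \<exists>i\<in>index_set B. \<exists>x\<in>patch B i. \<exists>k\<in>{1..n}.
       y = \<psi> i (x, k) \<and> z = local_rep B \<theta> i t x k)"

definition Xi ::
    "('m, 'b::real_normed_vector, 'e, 'c::real_normed_vector, 'a, 'i) bundle_data \<Rightarrow> nat \<Rightarrow>
     ('a set \<Rightarrow> nat \<Rightarrow> complex) \<Rightarrow>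
     ('h, 'b) manifold_data \<Rightarrow> ('i \<Rightarrow> 'm \<times> nat \<Rightarrow> 'h) \<Rightarrow> 'h \<Rightarrow> ('m \<Rightarrow> 'e) \<Rightarrow> complex" where
  "Xi B n \<theta> Mh \<psi> y =
     (\<lambda>s\<in>carrier (section_alg B). Omega B n \<theta> Mh \<psi> (section_ss B s) y)"

definition n_fold_covering :: "nat \<Rightarrow> 'x topology \<Rightarrow> 'y topology \<Rightarrow> ('x \<Rightarrow> 'y) \<Rightarrow> bool" where
  "n_fold_covering n X Y p \<longleftrightarrow> continuous_map X Y p \<and>
     (\<forall>y\<in>topspace Y. \<exists>U \<psi>. openin Y U \<and> y \<in> U \<and>
        homeomorphic_map (prod_topology (subtopology Y U) (discrete_topology {1..n}))
          (subtopology X {x \<in> topspace X. p x \<in> U}) \<psi> \<and>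
        (\<forall>u\<in>U. \<forall>k\<in>{1..n}. p (\<psi> (u, k)) = u))"

end

theory Submission
  imports Defs
begin

text \<open>
  Let \<open>\<omega>\<close> be a character of the algebra of sections. On multiples \<open>f 1\<close> of the unit section it is a character
  of the algebra of smooth functions on \<open>M\<close>, and this character is the evaluation at some point \<open>m\<close>.
  A bump function that is \<open>1\<close> at \<open>m\<close> and supported in a bundle chart localises any section, and
  expanding it in a basis of \<open>A\<close> shows that \<open>\<omega>\<close> factors through the evaluation of sections at \<open>m\<close>,
  so it comes from a character of \<open>A\<close>. Such a character kills the radical, hence it is a coordinate of
  \<open>A / rad A \<cong> \<complex>\<^sup>n\<close>, that is, a point of the covering over \<open>m\<close>. Conversely, a bump function
  times an element of \<open>A\<close> that lifts a standard idempotent of \<open>\<complex>\<^sup>n\<close> is a section whose transform is a bump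
  on a single sheet; such sections separate points from closed sets, which gives injectivity and openness.
\<close>

section \<open>Calculus of smooth functions\<close>

text \<open>The step that needs work is that \<open>lam\<close> is an evaluation. A value
  \<open>lam f\<close> is always attained by \<open>f\<close>, but at a point that may depend on
  \<open>f\<close>. If \<open>M\<close> were compact, finitely many bumps in the kernel of
  \<open>lam\<close> would have plateaus covering \<open>M\<close>; the product of the functions
  \<open>1 - \<beta>\<close> would then be 0, against its \<open>lam\<close>-value 1. In general the
  cover is only countable, and an infinite sum has to produce the contradiction. A second obstacle
  is that the coordinates of a section exist only over a patch. A section is therefore multiplied by
  the square of a bump: one factor extends the coefficient functions by 0 to \<open>M\<close>, the
  other one extends the constant basis sections. Since \<open>lam\<close> gives the bump the value
  1, the character does not notice the factors. Finally, the model spaces are bare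
  finite-dimensional normed spaces whose norm need not be differentiable. Bumps are built from a
  quadratic form in the coordinates of a basis instead, and this first requires the coordinates to
  be bounded functionals.\<close>

lemma ck_on_local:
  assumes "\<And>x. x \<in> S \<Longrightarrow> \<exists>T g. open T \<and> x \<in> T \<and> ck_on k T g \<and> (\<forall>y\<in>T. f y = g y)"
  shows "ck_on k S f"
  using assms
proof (induction k arbitrary: S f)
  case 0
  show ?case
    unfolding ck_on.simps continuous_on_eq_continuous_within
  proof
    fix x assume "x \<in> S"
    then obtain T g where T: "open T" "x \<in> T" "continuous_on T g" "\<forall>y\<in>T. f y = g y"
      using 0 by (metis ck_on.simps(1))
    then have "continuous_on T f" by (simp cong: continuous_on_cong)
    with T show "continuous (at x within S) f"
      using continuous_on_eq_continuous_at continuous_at_imp_continuous_at_within by blast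
  qed
next
  case (Suc k)
  have *: "\<exists>T g. open T \<and> x \<in> T \<and> ck_on k T (\<lambda>y. frechet_derivative g (at y) v) \<and>
        (\<forall>y\<in>T. frechet_derivative f (at y) v = frechet_derivative g (at y) v) \<and> f differentiable (at x)"
    if x: "x \<in> S" for x v
  proof -
    obtain T g where T: "open T" "x \<in> T" "ck_on (Suc k) T g" "\<forall>y\<in>T. f y = g y"
      using Suc.prems[OF x] by blast
    \<comment> \<open>A derivative depends only on the germ of the function; as \<open>T\<close> is
      open, the agreement of \<open>f\<close> and \<open>g\<close> on \<open>T\<close> carries over
      to their directional derivatives on all of \<open>T\<close>, which is what the induction
      hypothesis asks for.\<close>
    have "(f has_derivative frechet_derivative g (at y)) (at y)" if "y \<in> T" for y
    proof -
      have "(g has_derivative frechet_derivative g (at y)) (at y)"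
        using T(3) that by (simp add: frechet_derivative_works)
      then show ?thesis
        by (rule has_derivative_transform_within_open[OF _ T(1) that]) (use T(4) in auto)
    qed
    note d = this
    have "\<forall>y\<in>T. frechet_derivative f (at y) v = frechet_derivative g (at y) v"
      using d frechet_derivative_at by metis
    moreover have "f differentiable (at x)" using d[OF T(2)] by (auto simp: differentiable_def)
    moreover have "ck_on k T (\<lambda>y. frechet_derivative g (at y) v)" using T(3) by simp
    ultimately show ?thesis using T(1,2) by blast
  qed
  show ?case
    unfolding ck_on.simps
  proof (intro conjI ballI allI)
    show "f differentiable (at x)" if "x \<in> S" for x using *[OF that] by blast
    show "ck_on k S (\<lambda>x. frechet_derivative f (at x) v)" for v
    proof (rule Suc.IH)
      fix x assume "x \<in> S"
      from *[OF this, of v] obtain T g where "open T" "x \<in> T"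
        "ck_on k T (\<lambda>y. frechet_derivative g (at y) v)"
        "\<forall>y\<in>T. frechet_derivative f (at y) v = frechet_derivative g (at y) v" by blast
      then show "\<exists>T g. open T \<and> x \<in> T \<and> ck_on k T g \<and> (\<forall>y\<in>T. frechet_derivative f (at y) v = g y)"
        by (intro exI[of _ T] exI[of _ "\<lambda>y. frechet_derivative g (at y) v"]) simp
    qed
  qed
qed

lemma ck_on_cong:
  assumes "open S" "ck_on k S g" "\<And>x. x \<in> S \<Longrightarrow> f x = g x"
  shows "ck_on k S f"
  by (rule ck_on_local) (use assms in blast)

lemma ck_on_subset: "ck_on k S f \<Longrightarrow> T \<subseteq> S \<Longrightarrow> ck_on k T f"
  by (induction k arbitrary: f) (auto intro: continuous_on_subset)

text \<open>By uniqueness of derivatives an explicit formula \<open>f'\<close> may stand in for the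
  chosen \<open>frechet_derivative\<close>. Most inductions below run through this rule.\<close>

lemma ck_on_SucI:
  assumes "open S"
    and "\<And>x. x \<in> S \<Longrightarrow> (f has_derivative f' x) (at x)"
    and "\<And>v. ck_on k S (\<lambda>x. f' x v)"
  shows "ck_on (Suc k) S f"
proof -
  have "frechet_derivative f (at x) = f' x" if "x \<in> S" for x
    using assms(2)[OF that] frechet_derivative_at by metis
  then have "ck_on k S (\<lambda>x. frechet_derivative f (at x) v)" for v
    by (intro ck_on_cong[OF assms(1) assms(3)[of v]]) auto
  moreover have "f differentiable (at x)" if "x \<in> S" for x
    using assms(2)[OF that] by (auto simp: differentiable_def)
  ultimately show ?thesis by simp
qed

lemma ck_on_Suc_has_derivative:
  "ck_on (Suc k) S f \<Longrightarrow> x \<in> S \<Longrightarrow> (f has_derivative frechet_derivative f (at x)) (at x)"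
  by (simp add: frechet_derivative_works)

text \<open>The recursion does not mention the lower orders of \<open>f\<close> itself. Continuity
  at the bottom comes from differentiability, and above it the induction shifts the claim to the
  directional derivatives.\<close>

lemma ck_on_SucD: "ck_on (Suc k) S f \<Longrightarrow> ck_on k S f"
proof (induction k arbitrary: f)
  case 0
  then show ?case
    by (auto intro!: continuous_at_imp_continuous_on differentiable_imp_continuous_within)
next
  case (Suc k)
  then show ?case using ck_on.simps(2) by blast
qed

lemma ck_on_const: "open S \<Longrightarrow> ck_on k S (\<lambda>x. c)"
proof (induction k arbitrary: c)
  case (Suc k)
  then show ?case
    by (intro ck_on_SucI[where f'="\<lambda>_ _. 0"]) auto
qed auto

lemma ck_on_bounded_linear:
  assumes "bounded_linear L" "open S" "ck_on k S f"
  shows "ck_on k S (\<lambda>x. L (f x))"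
  using assms(3)
proof (induction k arbitrary: f)
  case 0
  then show ?case
    using bounded_linear.continuous_on[OF assms(1)] by auto
next
  case (Suc k)
  show ?case
  proof (rule ck_on_SucI[OF assms(2)])
    show "((\<lambda>x. L (f x)) has_derivative (\<lambda>v. L (frechet_derivative f (at x) v))) (at x)" if "x \<in> S" for x
      using bounded_linear.has_derivative[OF assms(1) ck_on_Suc_has_derivative[OF Suc.prems that]] .
    show "ck_on k S (\<lambda>x. L (frechet_derivative f (at x) v))" for v
      using Suc by auto
  qed
qed

lemma ck_on_add:
  assumes "open S" "ck_on k S f" "ck_on k S g"
  shows "ck_on k S (\<lambda>x. f x + g x)"
  using assms(2,3)
proof (induction k arbitrary: f g)
  case 0
  then show ?case by (auto intro: continuous_on_add)
next
  case (Suc k)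
  show ?case
  proof (rule ck_on_SucI[OF assms(1)])
    show "((\<lambda>x. f x + g x) has_derivative
        (\<lambda>v. frechet_derivative f (at x) v + frechet_derivative g (at x) v)) (at x)" if "x \<in> S" for x
      by (intro has_derivative_add ck_on_Suc_has_derivative[OF Suc.prems(1) that]
          ck_on_Suc_has_derivative[OF Suc.prems(2) that])
    show "ck_on k S (\<lambda>x. frechet_derivative f (at x) v + frechet_derivative g (at x) v)" for v
      using Suc by auto
  qed
qed

lemma ck_on_sum:
  assumes "open S" "\<And>i. i \<in> I \<Longrightarrow> ck_on k S (f i)"
  shows "ck_on k S (\<lambda>x. \<Sum>i\<in>I. f i x)"
  using assms(2)
  by (induction I rule: infinite_finite_induct) (auto intro: ck_on_const ck_on_add assms(1))

lemma ck_on_bilinear: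
  assumes "bounded_bilinear P" "open S" "ck_on k S f" "ck_on k S g"
  shows "ck_on k S (\<lambda>x. P (f x) (g x))"
  using assms(3,4)
proof (induction k arbitrary: f g)
  case 0
  then show ?case using bounded_bilinear.continuous_on[OF assms(1)] by auto
next
  case (Suc k)
  show ?case
  proof (rule ck_on_SucI[OF assms(2)])
    show "((\<lambda>x. P (f x) (g x)) has_derivative
        (\<lambda>v. P (f x) (frechet_derivative g (at x) v) + P (frechet_derivative f (at x) v) (g x))) (at x)"
      if "x \<in> S" for x
      by (intro bounded_bilinear.FDERIV[OF assms(1)] ck_on_Suc_has_derivative[OF Suc.prems(1) that]
          ck_on_Suc_has_derivative[OF Suc.prems(2) that])
    \<comment> \<open>The product rule contains \<open>f\<close> and \<open>g\<close> themselves
      besides their derivatives, so their lower order regularity is needed as well.\<close>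
    have "ck_on k S f" "ck_on k S g" using Suc.prems ck_on_SucD by blast+
    then show "ck_on k S (\<lambda>x. P (f x) (frechet_derivative g (at x) v)
        + P (frechet_derivative f (at x) v) (g x))" for v
      using Suc by (intro ck_on_add assms(2) Suc.IH) auto
  qed
qed

text \<open>The derivative of \<open>1 / f\<close> is built from \<open>1 / f\<close> and the
  derivative of \<open>f\<close>, so the induction keeps \<open>f\<close> fixed and closes with the
  product rule.\<close>

lemma ck_on_inverse:
  fixes f :: "'a::real_normed_vector \<Rightarrow> 'b::real_normed_field"
  assumes "open S" "ck_on k S f" "\<And>x. x \<in> S \<Longrightarrow> f x \<noteq> 0"
  shows "ck_on k S (\<lambda>x. inverse (f x))"
  using assms(2)
proof (induction k)
  case 0
  then show ?case using assms(3) by (auto intro: continuous_on_inverse)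
next
  case (Suc k)
  show ?case
  proof (rule ck_on_SucI[OF assms(1)])
    show "((\<lambda>x. inverse (f x)) has_derivative
        (\<lambda>v. - (inverse (f x) * frechet_derivative f (at x) v * inverse (f x)))) (at x)"
      if "x \<in> S" for x
      using Deriv.has_derivative_inverse[OF assms(3)[OF that] ck_on_Suc_has_derivative[OF Suc.prems that]] .
    have "ck_on k S (\<lambda>x. inverse (f x))" using Suc.prems ck_on_SucD Suc.IH by blast
    with Suc.prems show "ck_on k S (\<lambda>x. - (inverse (f x) * frechet_derivative f (at x) v * inverse (f x)))" for v
      by (intro ck_on_bounded_linear[OF bounded_linear_minus[OF bounded_linear_ident] assms(1)]
          ck_on_bilinear[OF bounded_bilinear_mult assms(1)]) auto
  qed
qed

section \<open>Smoothness of all orders\<close>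

lemma smooth_on_local:
  assumes "\<And>x. x \<in> S \<Longrightarrow> \<exists>T g. open T \<and> x \<in> T \<and> smooth_on T g \<and> (\<forall>y\<in>T. f y = g y)"
  shows "smooth_on S f"
  unfolding smooth_on_def
proof
  fix k
  show "ck_on k S f"
  proof (rule ck_on_local)
    fix x assume "x \<in> S"
    from assms[OF this] obtain T g
      where "open T" "x \<in> T" "smooth_on T g" "\<forall>y\<in>T. f y = g y" by blast
    then show "\<exists>T g. open T \<and> x \<in> T \<and> ck_on k T g \<and> (\<forall>y\<in>T. f y = g y)"
      unfolding smooth_on_def by blast
  qed
qed

lemma smooth_on_cong:
  "open S \<Longrightarrow> smooth_on S g \<Longrightarrow> (\<And>x. x \<in> S \<Longrightarrow> f x = g x) \<Longrightarrow> smooth_on S f"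
  unfolding smooth_on_def using ck_on_cong by blast

lemma smooth_on_subset: "smooth_on S f \<Longrightarrow> T \<subseteq> S \<Longrightarrow> smooth_on T f"
  unfolding smooth_on_def using ck_on_subset by blast

lemma smooth_on_imp_continuous_on: "smooth_on S f \<Longrightarrow> continuous_on S f"
  unfolding smooth_on_def using ck_on.simps(1) by blast

lemma smooth_on_const: "open S \<Longrightarrow> smooth_on S (\<lambda>x. c)"
  by (simp add: smooth_on_def ck_on_const)

lemma smooth_on_bounded_linear_comp:
  "bounded_linear L \<Longrightarrow> open S \<Longrightarrow> smooth_on S f \<Longrightarrow> smooth_on S (\<lambda>x. L (f x))"
  by (simp add: smooth_on_def ck_on_bounded_linear)

lemma smooth_on_ident: "open S \<Longrightarrow> smooth_on S (\<lambda>x. x)"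
  unfolding smooth_on_def
proof
  fix k assume S: "open S"
  show "ck_on k S (\<lambda>x. x)"
  proof (cases k)
    case (Suc l)
    then show ?thesis
      by (auto intro: ck_on_SucI[OF S, where f'="\<lambda>_ v. v"] ck_on_const[OF S])
  qed auto
qed

lemma smooth_on_add:
  "open S \<Longrightarrow> smooth_on S f \<Longrightarrow> smooth_on S g \<Longrightarrow> smooth_on S (\<lambda>x. f x + g x)"
  by (simp add: smooth_on_def ck_on_add)

lemma smooth_on_sum:
  "open S \<Longrightarrow> (\<And>i. i \<in> I \<Longrightarrow> smooth_on S (f i)) \<Longrightarrow> smooth_on S (\<lambda>x. \<Sum>i\<in>I. f i x)"
  by (simp add: smooth_on_def ck_on_sum)

lemma smooth_on_bilinear:
  "bounded_bilinear P \<Longrightarrow> open S \<Longrightarrow> smooth_on S f \<Longrightarrow> smooth_on S g \<Longrightarrow>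
    smooth_on S (\<lambda>x. P (f x) (g x))"
  by (simp add: smooth_on_def ck_on_bilinear)

lemma smooth_on_inverse:
  fixes f :: "'a::real_normed_vector \<Rightarrow> 'b::real_normed_field"
  shows "open S \<Longrightarrow> smooth_on S f \<Longrightarrow> (\<And>x. x \<in> S \<Longrightarrow> f x \<noteq> 0) \<Longrightarrow> smooth_on S (\<lambda>x. inverse (f x))"
  by (simp add: smooth_on_def ck_on_inverse)

lemma smooth_on_Pair:
  assumes "open S" "smooth_on S f" "smooth_on S g"
  shows "smooth_on S (\<lambda>x. (f x, g x))"
proof -
  have "smooth_on S (\<lambda>x. (f x, 0) + (0, g x))"
    by (intro smooth_on_add assms
        smooth_on_bounded_linear_comp[OF bounded_linear_Pair[OF bounded_linear_ident bounded_linear_zero]]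
        smooth_on_bounded_linear_comp[OF bounded_linear_Pair[OF bounded_linear_zero bounded_linear_ident]])
  then show ?thesis by simp
qed

section \<open>A smooth step function on the real line\<close>

text \<open>The exponents \<open>j\<close> are needed because the derivative of the \<open>j\<close>-th function is a combination of
  the functions with index \<open>j + 1\<close> and \<open>j + 2\<close>.\<close>

definition flat_exp :: "nat \<Rightarrow> real \<Rightarrow> real" where
  "flat_exp j t = (if t > 0 then inverse t ^ j * exp (- inverse t) else 0)"

text \<open>On the right, the substitution \<open>s = 1 / t\<close> turns the claim into the decay
  of \<open>s ^ j / exp s\<close> at infinity; on the left the function is 0.\<close>

lemma flat_exp_tendsto_0: "(flat_exp j \<longlongrightarrow> 0) (at 0)"
proof -
  have "((\<lambda>x::real. x ^ j / exp x) \<longlongrightarrow> 0) at_top" by (rule tendsto_power_div_exp_0)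
  then have "((\<lambda>t::real. inverse t ^ j / exp (inverse t)) \<longlongrightarrow> 0) (at_right 0)"
    by (rule filterlim_compose[OF _ filterlim_inverse_at_top_right])
  then have "(flat_exp j \<longlongrightarrow> 0) (at_right 0)"
    by (rule tendsto_cong[THEN iffD1, rotated])
       (simp add: flat_exp_def exp_minus divide_inverse eventually_at_filter)
  moreover have "(flat_exp j \<longlongrightarrow> 0) (at_left 0)"
    by (rule tendsto_eventually) (auto simp: flat_exp_def eventually_at_filter)
  ultimately show ?thesis by (rule filterlim_split_at[rotated])
qed

lemma flat_exp_has_derivative:
  "(flat_exp j has_real_derivative (flat_exp (j + 2) t - real j * flat_exp (j + 1) t)) (at t)"
proof (cases t "0::real" rule: linorder_cases)
  case less
  have "((\<lambda>_. 0) has_real_derivative 0) (at t)" by simp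
  then have "(flat_exp j has_real_derivative 0) (at t)"
    by (rule has_field_derivative_transform_within_open[where S="{..<0}"])
       (use less in \<open>auto simp: flat_exp_def\<close>)
  with less show ?thesis by (simp add: flat_exp_def)
next
  case equal
  have "((\<lambda>h. flat_exp (j + 1) h) \<longlongrightarrow> 0) (at 0)" by (rule flat_exp_tendsto_0)
  \<comment> \<open>The difference quotient of \<open>flat_exp j\<close> at 0 is exactly
    \<open>flat_exp (j + 1)\<close>, on both sides of 0.\<close>
  then have "((\<lambda>h. (flat_exp j (0 + h) - flat_exp j 0) / h) \<longlongrightarrow> 0) (at 0)"
    by (rule tendsto_cong[THEN iffD1, rotated])
       (simp add: flat_exp_def eventually_at_filter divide_inverse)
  with equal show ?thesis by (simp add: DERIV_def flat_exp_def)
next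
  case greater
  have "((\<lambda>t. inverse t ^ j * exp (- inverse t)) has_real_derivative
      (inverse t ^ (j + 2) * exp (- inverse t) - real j * (inverse t ^ (j + 1) * exp (- inverse t)))) (at t)"
    using greater
  proof -
    have p: "((\<lambda>t. inverse t ^ j) has_real_derivative (- real j * inverse t ^ (j + 1))) (at t)"
    proof (cases j)
      case (Suc l)
      have "((\<lambda>t. inverse t ^ Suc l) has_real_derivative
          (1 + real l) * (- (inverse t ^ Suc (Suc 0)) * inverse t ^ l)) (at t)"
        using greater by (intro DERIV_power_Suc DERIV_inverse) simp
      with Suc show ?thesis by (simp add: algebra_simps)
    qed simp
    have "((\<lambda>t. exp (- inverse t)) has_real_derivative
        exp (- inverse t) * (inverse t ^ Suc (Suc 0))) (at t)"
      using DERIV_fun_exp[OF DERIV_minus[OF DERIV_inverse[of t]]] greater by simp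
    from DERIV_mult[OF p this] show ?thesis
      by (simp add: algebra_simps)
  qed
  then have "(flat_exp j has_real_derivative
      (inverse t ^ (j + 2) * exp (- inverse t) - real j * (inverse t ^ (j + 1) * exp (- inverse t)))) (at t)"
    by (rule has_field_derivative_transform_within_open[where S="{0<..}"])
       (use greater in \<open>auto simp: flat_exp_def\<close>)
  with greater show ?thesis by (simp add: flat_exp_def)
qed

lemma smooth_on_flat_exp: "smooth_on UNIV (flat_exp j)"
  unfolding smooth_on_def
proof
  show "ck_on k UNIV (flat_exp j)" for k
  proof (induction k arbitrary: j)
    case 0
    show ?case
      unfolding ck_on.simps
      by (intro continuous_at_imp_continuous_on ballI DERIV_isCont[OF flat_exp_has_derivative])
  next
    case (Suc k)
    show ?case
    proof (rule ck_on_SucI[OF open_UNIV])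
      show "(flat_exp j has_derivative
          (\<lambda>v. (flat_exp (j + 2) x + (- real j) * flat_exp (j + 1) x) * v)) (at x)" for x
        using flat_exp_has_derivative[of j x] by (simp add: has_field_derivative_def)
      show "ck_on k UNIV (\<lambda>x. (flat_exp (j + 2) x + (- real j) * flat_exp (j + 1) x) * v)" for v
        by (intro ck_on_bounded_linear[OF bounded_linear_mult_left]
            ck_on_bounded_linear[OF bounded_linear_mult_right] ck_on_add Suc) auto
    qed
  qed
qed

text \<open>The plateau ends at 1 and the support at 2, the values that bound the sets
  \<open>V\<close> and \<open>K\<close> in \<open>smooth_bump\<close>. The denominator is positive
  because \<open>2 - t\<close> and \<open>t - 1\<close> are never both nonpositive.\<close>

definition step_fun :: "real \<Rightarrow> real" where
  "step_fun t = flat_exp 0 (2 - t) / (flat_exp 0 (2 - t) + flat_exp 0 (t - 1))"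

lemma step_fun_simps:
  "t \<le> 1 \<Longrightarrow> step_fun t = 1" "t \<ge> 2 \<Longrightarrow> step_fun t = 0" "0 \<le> step_fun t" "step_fun t \<le> 1"
proof -
  have "flat_exp 0 s \<ge> 0" for s by (simp add: flat_exp_def)
  moreover have "flat_exp 0 (2 - t) > 0 \<or> flat_exp 0 (t - 1) > 0"
    by (simp add: flat_exp_def)
  ultimately have "flat_exp 0 (2 - t) \<ge> 0" "flat_exp 0 (t - 1) \<ge> 0"
      "flat_exp 0 (2 - t) + flat_exp 0 (t - 1) > 0"
    by (auto simp: add_pos_nonneg add_nonneg_pos)
  then show "0 \<le> step_fun t" "step_fun t \<le> 1"
    by (auto simp: step_fun_def divide_simps)
qed (auto simp: step_fun_def flat_exp_def)

section \<open>Finite-dimensional normed spaces\<close>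

lemma finite_dimensional_basis:
  assumes "finite_dimensional TYPE('b::real_vector)"
  obtains D :: "'b::real_vector set" where "finite D" "independent D" "span D = UNIV"
proof -
  obtain E :: "'b::real_vector set" where E: "finite E" "span E = UNIV"
    using assms by (auto simp: finite_dimensional_def)
  obtain D where D: "D \<subseteq> E" "independent D" "E \<subseteq> span D"
    using real_vector.maximal_independent_subset[of E] by blast
  have "span D = UNIV"
    using D(3) E(2) real_vector.span_minimal real_vector.subspace_span by blast
  with D E that show thesis using finite_subset by blast
qed

lemma representation_sum:
  fixes D :: "'b::real_vector set"
  assumes "finite D" "independent D" "span D = UNIV"
  shows "(\<Sum>e\<in>D. representation D v e *\<^sub>R e) = v"
  by (rule real_vector.sum_representation_eq) (use assms in auto)

lemma compact_coordinate_box: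
  fixes D :: "'b::real_normed_vector set"
  assumes "finite D" "\<And>e. e \<in> D \<Longrightarrow> compact (I e)"
  shows "compact ((\<lambda>c. \<Sum>e\<in>D. c e *\<^sub>R e) ` (PiE D I))"
proof -
  let ?X = "product_topology (\<lambda>_. euclideanreal) D"
  have "continuous_map ?X euclidean (\<lambda>c. \<Sum>e\<in>D. c e *\<^sub>R e)"
  proof (rule continuous_map_sum[OF assms(1)])
    fix e assume "e \<in> D"
    then have "continuous_map ?X euclideanreal (\<lambda>c. c e)"
      by (rule continuous_map_product_projection)
    then show "continuous_map ?X euclidean (\<lambda>c. c e *\<^sub>R e)"
      using continuous_map_compose[of ?X euclideanreal "\<lambda>c. c e" euclidean "\<lambda>x. x *\<^sub>R e"]
        continuous_on_scaleR[OF continuous_on_id continuous_on_const, of UNIV e]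
      by (simp add: o_def)
  qed
  moreover have "compactin ?X (PiE D I)"
    using assms(2) by (simp add: compactin_PiE)
  ultimately show ?thesis
    using image_compactin[of ?X "PiE D I" euclidean] by (simp add: compactin_euclidean_iff)
qed

text \<open>Equivalence of norms: the vectors whose largest coordinate has absolute value 1 form a
  compact set that misses 0 by independence, so their norms are bounded below. Scaling by the
  largest coordinate then bounds all coordinates by the norm.\<close>

lemma bounded_linear_representation:
  fixes D :: "'b::real_normed_vector set"
  assumes D: "finite D" "independent D" "span D = UNIV"
  shows "bounded_linear (\<lambda>v. representation D v e)"
proof -
  define T where "T = (\<lambda>c. \<Sum>e\<in>D. c e *\<^sub>R (e::'b))"
  \<comment> \<open>A pair of opposite faces of the unit cube: coordinate \<open>e'\<close> is 1 or
    -1, the others lie between. Together the faces make up the unit sphere of the maximum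
    norm.\<close>
  define I where "I e' e = (if e = e' then {-1, 1} else {-1..1::real})" for e' e :: 'b
  define K where "K = (\<Union>e'\<in>D. T ` (PiE D (I e')))"
  have "compact K"
    unfolding K_def T_def
    by (intro compact_UN D(1) compact_coordinate_box) (auto simp: I_def)
  have "0 \<notin> K"
  proof
    assume "0 \<in> K"
    then obtain c e' where c: "e' \<in> D" "T c = 0" "c e' \<in> {-1, 1}"
    proof -
      from \<open>0 \<in> K\<close> obtain e' c where "e' \<in> D" "c \<in> PiE D (I e')" "0 = T c"
        unfolding K_def by blast
      moreover from this have "c e' \<in> I e' e'" by (auto simp: PiE_iff)
      ultimately show ?thesis using that by (auto simp: I_def)
    qed
    then have "c e' = 0"
      using real_vector.independentD[OF D(2) D(1) subset_refl, of c e'] by (simp add: T_def)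
    with c show False by auto
  qed
  moreover have "open (- K)" using compact_imp_closed[OF \<open>compact K\<close>] by blast
  ultimately obtain \<delta> where \<delta>: "\<delta> > 0" "ball 0 \<delta> \<subseteq> - K"
    using openE[of "- K" 0] by auto
  have bound: "\<delta> * \<bar>representation D v e\<bar> \<le> norm v" for v e
  proof (cases "e \<in> D \<and> representation D v e \<noteq> 0")
    case False
    then have "representation D v e = 0"
      using real_vector.representation_ne_zero by blast
    then show ?thesis by simp
  next
    case True
    define r where "r = Max ((\<lambda>e. \<bar>representation D v e\<bar>) ` D)"
    have le: "\<bar>representation D v e'\<bar> \<le> r" if "e' \<in> D" for e'
      using that D(1) by (simp add: r_def)
    have "r \<in> (\<lambda>e. \<bar>representation D v e\<bar>) ` D"
      unfolding r_def using D(1) True by (intro Max_in) auto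
    then obtain e' where e': "e' \<in> D" "r = \<bar>representation D v e'\<bar>" by auto
    have "r > 0" using le[of e] True by auto
    \<comment> \<open>Division by the maximum \<open>r\<close> puts the coordinate vector on a face
      that belongs to an index \<open>e'\<close> where \<open>r\<close> is attained.\<close>
    define c where "c = (\<lambda>e\<in>D. representation D v e / r)"
    have "c \<in> PiE D (I e')"
    proof
      fix x assume x: "x \<in> D"
      have "\<bar>representation D v x / r\<bar> \<le> 1" using le[OF x] \<open>r > 0\<close> by simp
      then have "-1 \<le> representation D v x / r" "representation D v x / r \<le> 1" by linarith+
      moreover have "representation D v e' / r \<in> {-1, 1}"
        using e'(2) \<open>r > 0\<close> by (auto simp: abs_if divide_simps split: if_splits)
      ultimately show "c x \<in> I e' x" using x by (simp add: c_def I_def)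
    qed (simp add: c_def)
    then have "T c \<in> K" using e'(1) unfolding K_def by blast
    have "T c = (1 / r) *\<^sub>R v"
      unfolding T_def c_def
      by (subst (2) representation_sum[OF D, of v, symmetric]) (simp add: scaleR_sum_right divide_inverse_commute)
    then have "(1 / r) *\<^sub>R v \<in> K" using \<open>T c \<in> K\<close> by simp
    then have "norm ((1 / r) *\<^sub>R v) \<ge> \<delta>" using \<delta>(2) by (auto simp: not_less[symmetric] subset_iff)
    then have "\<delta> * r \<le> norm v" using \<open>r > 0\<close> by (simp add: divide_simps)
    moreover have "\<delta> * \<bar>representation D v e\<bar> \<le> \<delta> * r"
      using le[of e] True \<delta>(1) by simp
    ultimately show ?thesis by linarith
  qed
  show ?thesis
  proof (rule bounded_linear_intro)
    show "representation D (x + y) e = representation D x e + representation D y e" for x y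
      using D by (simp add: real_vector.representation_add)
    show "representation D (r *\<^sub>R x) e = r *\<^sub>R representation D x e" for x r
      using D by (simp add: real_vector.representation_scale)
    show "norm (representation D x e) \<le> norm x * (1 / \<delta>)" for x
      using bound[of x e] \<delta>(1) by (simp add: field_simps)
  qed
qed

lemma finite_dimensional_linear_expansion:
  fixes D :: "'b::real_vector set"
  assumes D: "finite D" "independent D" "span D = UNIV" and "linear f"
  shows "f v = (\<Sum>e\<in>D. representation D v e *\<^sub>R f e)"
  by (subst (1) representation_sum[OF D, of v, symmetric])
     (simp add: linear_sum[OF assms(4)] linear_scale[OF assms(4)])

lemma finite_dimensional_imp_bounded_linear:
  fixes f :: "'b::real_normed_vector \<Rightarrow> 'c::real_normed_vector"
  assumes "finite_dimensional TYPE('b)" "linear f"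
  shows "bounded_linear f"
proof -
  obtain D :: "'b set" where D: "finite D" "independent D" "span D = UNIV"
    using finite_dimensional_basis[OF assms(1)] .
  have "bounded_linear (\<lambda>v. \<Sum>e\<in>D. representation D v e *\<^sub>R f e)"
    by (intro bounded_linear_sum bounded_linear_scaleR_left[THEN bounded_linear_compose]
        bounded_linear_representation D)
  moreover have "f = (\<lambda>v. \<Sum>e\<in>D. representation D v e *\<^sub>R f e)"
    using finite_dimensional_linear_expansion[OF D assms(2)] by blast
  ultimately show ?thesis by simp
qed

text \<open>Expanding the first argument in a basis leaves finitely many linear maps
  \<open>P e\<close> of the second one, each of them bounded; the bounds \<open>Kc\<close> of the
  coordinates and \<open>L\<close> of these maps multiply.\<close>

lemma finite_dimensional_imp_bounded_bilinear:
  fixes P :: "'b::real_normed_vector \<Rightarrow> 'c::real_normed_vector \<Rightarrow> 'd::real_normed_vector"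
  assumes "finite_dimensional TYPE('b)" "finite_dimensional TYPE('c)"
    "\<And>x. linear (P x)" "\<And>y. linear (\<lambda>x. P x y)"
  shows "bounded_bilinear P"
proof -
  obtain D :: "'b set" where D: "finite D" "independent D" "span D = UNIV"
    using finite_dimensional_basis[OF assms(1)] .
  have bl: "bounded_linear (\<lambda>x. representation D x e)" "bounded_linear (P e)" for e
    using bounded_linear_representation[OF D]
      finite_dimensional_imp_bounded_linear[OF assms(2,3)] by auto
  obtain Kc where Kc: "\<And>e x. norm (representation D x e) \<le> norm x * Kc e"
    using choice[of "\<lambda>e K. \<forall>x. norm (representation D x e) \<le> norm x * K"]
      bounded_linear.bounded[OF bl(1)] by blast
  obtain L where L: "\<And>e y. norm (P e y) \<le> norm y * L e"
    using choice[of "\<lambda>e K. \<forall>y. norm (P e y) \<le> norm y * K"]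
      bounded_linear.bounded[OF bl(2)] by blast
  show ?thesis
  proof
    show "P (a + a') b = P a b + P a' b" "P (r *\<^sub>R a) b = r *\<^sub>R P a b" for a a' b r
      using linear_add[OF assms(4)] linear_scale[OF assms(4)] by auto
    show "P a (b + b') = P a b + P a b'" "P a (r *\<^sub>R b) = r *\<^sub>R P a b" for a b b' r
      using linear_add[OF assms(3)] linear_scale[OF assms(3)] by auto
    show "\<exists>K. \<forall>a b. norm (P a b) \<le> norm a * norm b * K"
    proof (intro exI allI)
      fix a b
      have "norm (P a b) = norm (\<Sum>e\<in>D. representation D a e *\<^sub>R P e b)"
        using finite_dimensional_linear_expansion[OF D assms(4), of a b] by simp
      also have "\<dots> \<le> (\<Sum>e\<in>D. (norm a * Kc e) * (norm b * L e))"
      proof (rule sum_norm_le)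
        fix e
        have "0 \<le> norm a * Kc e" by (rule order_trans[OF norm_ge_zero Kc])
        then show "norm (representation D a e *\<^sub>R P e b) \<le> (norm a * Kc e) * (norm b * L e)"
          using mult_mono[OF Kc[where x=a and e=e] L[where y=b and e=e]] by simp
      qed
      also have "\<dots> = norm a * norm b * (\<Sum>e\<in>D. Kc e * L e)"
        by (simp add: sum_distrib_left algebra_simps)
      finally show "norm (P a b) \<le> norm a * norm b * (\<Sum>e\<in>D. Kc e * L e)" .
    qed
  qed
qed

lemma finite_dimensional_real: "finite_dimensional TYPE(real)"
proof -
  have "x \<in> span {1}" for x :: real
    using real_vector.span_scale[OF real_vector.span_base[of "1::real" "{1}"], of x]
    by (simp del: real_vector.span_insert_0)
  then show ?thesis unfolding finite_dimensional_def by (intro exI[of _ "{1}"]) auto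
qed

lemma finite_dimensional_complex: "finite_dimensional TYPE(complex)"
proof -
  have "z \<in> span {1, \<i>}" for z :: complex
  proof -
    have "Re z *\<^sub>R 1 + Im z *\<^sub>R \<i> \<in> span {1, \<i>}"
      by (intro real_vector.span_add real_vector.span_scale real_vector.span_base) auto
    moreover have "Re z *\<^sub>R 1 + Im z *\<^sub>R \<i> = z" by (simp add: complex_eq_iff)
    ultimately show ?thesis by simp
  qed
  then show ?thesis unfolding finite_dimensional_def by (intro exI[of _ "{1, \<i>}"]) auto
qed

lemma finite_dimensional_prod:
  assumes "finite_dimensional TYPE('b::real_vector)" "finite_dimensional TYPE('c::real_vector)"
  shows "finite_dimensional TYPE('b \<times> 'c)"
proof -
  obtain D :: "'b::real_vector set" and E :: "'c::real_vector set" where D: "finite D" "span D = UNIV" "finite E" "span E = UNIV"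
    using assms by (auto simp: finite_dimensional_def)
  have "(x, y) \<in> span (D \<times> {0} \<union> {0} \<times> E)" for x :: "'b::real_vector" and y :: "'c::real_vector"
  proof -
    have lin: "linear (\<lambda>x::'b. (x, 0::'c))" "linear (\<lambda>y::'c. (0::'b, y))"
      by (auto intro!: linearI)
    have "(x, 0::'c) \<in> (\<lambda>x. (x, 0)) ` span D" "(0::'b, y) \<in> (\<lambda>y. (0, y)) ` span E"
      using D by auto
    then have "(x, 0::'c) \<in> span ((\<lambda>x. (x, 0)) ` D)" "(0::'b, y) \<in> span ((\<lambda>y. (0, y)) ` E)"
      using linear_span_image[OF lin(1), of D] linear_span_image[OF lin(2), of E] by simp_all
    moreover have "span ((\<lambda>x. (x, 0)) ` D) \<subseteq> span (D \<times> {0} \<union> {0} \<times> E)"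
      "span ((\<lambda>y. (0, y)) ` E) \<subseteq> span (D \<times> {0} \<union> {0} \<times> E)"
      by (intro real_vector.span_mono; blast)+
    ultimately have "(x, 0) \<in> span (D \<times> {0} \<union> {0} \<times> E)" "(0, y) \<in> span (D \<times> {0} \<union> {0} \<times> E)"
      by blast+
    then have "(x, 0) + (0, y) \<in> span (D \<times> {0} \<union> {0} \<times> E)"
      by (rule real_vector.span_add)
    then show ?thesis by simp
  qed
  then show ?thesis
    unfolding finite_dimensional_def
    using D by (intro exI[of _ "D \<times> {0} \<union> {0} \<times> E"]) auto
qed

text \<open>The chain rule applies the derivative of \<open>g\<close> to the moving direction
  \<open>Df(x) v\<close>, while \<open>ck_on\<close> controls derivatives in fixed directions only.
  Expanding the moving direction in a basis of the middle space gives a finite sum of fixed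
  directions with scalar coefficients; this is where finite dimension enters.\<close>

lemma ck_on_compose:
  fixes f :: "'a::real_normed_vector \<Rightarrow> 'b::real_normed_vector"
    and g :: "'b \<Rightarrow> 'c::real_normed_vector"
  assumes "finite_dimensional TYPE('b)" "open S" "open T" "f ` S \<subseteq> T"
    "ck_on k S f" "ck_on k T g"
  shows "ck_on k S (\<lambda>x. g (f x))"
  using assms(5,6)
proof (induction k arbitrary: g)
  case 0
  then show ?case using assms(4) by (auto intro: continuous_on_compose2)
next
  case (Suc k)
  obtain D :: "'b set" where D: "finite D" "independent D" "span D = UNIV"
    using finite_dimensional_basis[OF assms(1)] .
  show ?case
  proof (rule ck_on_SucI[OF assms(2)])
    show "((\<lambda>x. g (f x)) has_derivative
        (\<lambda>v. \<Sum>e\<in>D. representation D (frechet_derivative f (at x) v) e *\<^sub>R frechet_derivative g (at (f x)) e)) (at x)"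
      if "x \<in> S" for x
    proof -
      have "f x \<in> T" using that assms(4) by blast
      have "((\<lambda>x. g (f x)) has_derivative
          (\<lambda>v. frechet_derivative g (at (f x)) (frechet_derivative f (at x) v))) (at x)"
        using has_derivative_compose[OF ck_on_Suc_has_derivative[OF Suc.prems(1) that]
            ck_on_Suc_has_derivative[OF Suc.prems(2) \<open>f x \<in> T\<close>]] .
      moreover have "linear (frechet_derivative g (at (f x)))"
        using ck_on_Suc_has_derivative[OF Suc.prems(2) \<open>f x \<in> T\<close>] has_derivative_linear by blast
      ultimately show ?thesis
        by (simp add: finite_dimensional_linear_expansion[OF D, of "frechet_derivative g (at (f x))", symmetric])
    qed
    show "ck_on k S (\<lambda>x. \<Sum>e\<in>D. representation D (frechet_derivative f (at x) v) e *\<^sub>R frechet_derivative g (at (f x)) e)" for v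
    proof (intro ck_on_sum assms(2) ck_on_bilinear[OF bounded_bilinear_scaleR])
      show "ck_on k S (\<lambda>x. representation D (frechet_derivative f (at x) v) e)" for e
        using Suc.prems(1) by (intro ck_on_bounded_linear[OF bounded_linear_representation[OF D] assms(2)]) simp
      show "ck_on k S (\<lambda>x. frechet_derivative g (at (f x)) e)" for e
        using Suc.prems by (intro Suc.IH ck_on_SucD[OF Suc.prems(1)]) simp
    qed
  qed
qed

lemma smooth_on_compose:
  fixes f :: "'a::real_normed_vector \<Rightarrow> 'b::real_normed_vector"
  assumes "finite_dimensional TYPE('b)" "open S" "open T" "f ` S \<subseteq> T"
    "smooth_on S f" "smooth_on T g"
  shows "smooth_on S (\<lambda>x. g (f x))"
  using assms(5,6) ck_on_compose[OF assms(1-4)] unfolding smooth_on_def by blast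

lemma smooth_on_step_fun: "smooth_on UNIV step_fun"
proof -
  have "flat_exp 0 (2 - t) + flat_exp 0 (t - 1) \<noteq> 0" for t
  proof (cases "t < 2")
    case True
    then have "flat_exp 0 (2 - t) > 0" "flat_exp 0 (t - 1) \<ge> 0" by (simp_all add: flat_exp_def)
    then show ?thesis by linarith
  next
    case False
    then have "flat_exp 0 (2 - t) \<ge> 0" "flat_exp 0 (t - 1) > 0" by (simp_all add: flat_exp_def)
    then show ?thesis by linarith
  qed
  moreover have "smooth_on UNIV (\<lambda>t. flat_exp 0 (2 + (-1) * t))" "smooth_on UNIV (\<lambda>t. flat_exp 0 (- 1 + t))"
    by (intro smooth_on_compose[OF finite_dimensional_real open_UNIV open_UNIV _ _ smooth_on_flat_exp]
        smooth_on_add smooth_on_const smooth_on_ident open_UNIV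
        smooth_on_bounded_linear_comp[OF bounded_linear_mult_right] subset_UNIV)+
  ultimately have "smooth_on UNIV (\<lambda>t. flat_exp 0 (2 - t) * inverse (flat_exp 0 (2 - t) + flat_exp 0 (t - 1)))"
    by (intro smooth_on_bilinear[OF bounded_bilinear_mult] smooth_on_inverse smooth_on_add) auto
  then show ?thesis by (simp add: step_fun_def[abs_def] divide_inverse)
qed

lemma smooth_bump:
  fixes v0 :: "'b::real_normed_vector"
  assumes fd: "finite_dimensional TYPE('b)" and "open O'" "v0 \<in> O'"
  obtains \<beta> :: "'b \<Rightarrow> real" and K V where
    "smooth_on UNIV \<beta>" "compact K" "K \<subseteq> O'" "open V" "v0 \<in> V" "V \<subseteq> K"
    "\<And>v. v \<in> V \<Longrightarrow> \<beta> v = 1" "\<And>v. v \<notin> K \<Longrightarrow> \<beta> v = 0" "\<And>v. 0 \<le> \<beta> v" "\<And>v. \<beta> v \<le> 1"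
proof -
  obtain D :: "'b set" where D: "finite D" "independent D" "span D = UNIV"
    using finite_dimensional_basis[OF fd] .
  obtain \<epsilon> where \<epsilon>: "\<epsilon> > 0" "ball v0 \<epsilon> \<subseteq> O'"
    using assms(2,3) open_contains_ball by blast
  define C where "C = (\<Sum>e\<in>D. norm e)"
  have "C \<ge> 0" by (simp add: C_def sum_nonneg)
  \<comment> \<open>For \<open>q v \<le> 2\<close> every coordinate of \<open>v - v0\<close> is at
    most \<open>2 * r\<close>, so the norm is at most \<open>2 * r * C\<close>, which is below
    \<open>\<epsilon>\<close>. The 1 added to \<open>C\<close> avoids a division by 0 when the basis
    is empty.\<close>
  define r where "r = \<epsilon> / (2 * (C + 1))"
  have "r > 0" using \<epsilon>(1) \<open>C \<ge> 0\<close> by (simp add: r_def)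
  define q where "q v = (\<Sum>e\<in>D. representation D (v - v0) e * representation D (v - v0) e) * inverse (r * r)" for v
  have smooth_q: "smooth_on UNIV q"
    unfolding q_def
    by (intro smooth_on_bounded_linear_comp[OF bounded_linear_mult_left] smooth_on_sum
        smooth_on_bilinear[OF bounded_bilinear_mult] open_UNIV
        smooth_on_bounded_linear_comp[OF bounded_linear_representation[OF D]])
      (use smooth_on_add[OF open_UNIV smooth_on_ident smooth_on_const, of "- v0"] in simp)+
  then have cont_q: "continuous_on UNIV q" by (rule smooth_on_imp_continuous_on)
  define K where "K = {v. q v \<le> 2}"
  define V where "V = {v. q v < 1}"
  have coord: "\<bar>representation D (v - v0) e\<bar> \<le> 2 * r" if "v \<in> K" "e \<in> D" for v e
  proof -
    have "(representation D (v - v0) e)\<^sup>2 \<le> (\<Sum>e\<in>D. representation D (v - v0) e * representation D (v - v0) e)"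
      unfolding power2_eq_square by (rule member_le_sum) (use that D in auto)
    also have "\<dots> \<le> 2 * (r * r)"
      using that(1) \<open>r > 0\<close> by (simp add: K_def q_def field_simps)
    also have "\<dots> \<le> (2 * r)\<^sup>2" using \<open>r > 0\<close> by (simp add: power2_eq_square)
    finally have "\<bar>representation D (v - v0) e\<bar> \<le> \<bar>2 * r\<bar>"
      by (simp only: abs_le_square_iff)
    then show ?thesis using \<open>r > 0\<close> by simp
  qed
  have "K \<subseteq> ball v0 \<epsilon>"
  proof
    fix v assume "v \<in> K"
    have "norm (v - v0) = norm (\<Sum>e\<in>D. representation D (v - v0) e *\<^sub>R e)"
      by (simp add: representation_sum[OF D])
    also have "\<dots> \<le> (\<Sum>e\<in>D. 2 * r * norm e)"
      by (intro sum_norm_le) (simp add: mult_right_mono coord[OF \<open>v \<in> K\<close>])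
    also have "\<dots> = 2 * r * C" by (simp add: C_def sum_distrib_left)
    also have "\<dots> < \<epsilon>" using \<epsilon>(1) \<open>C \<ge> 0\<close> by (simp add: r_def field_simps)
    finally show "v \<in> ball v0 \<epsilon>" by (simp add: dist_norm norm_minus_commute)
  qed
  have "closed K" "open V"
    unfolding K_def V_def using cont_q
    by (auto intro: closed_Collect_le open_Collect_less continuous_on_const)
  \<comment> \<open>\<open>K\<close> is closed and lies in this translate of a compact coordinate
    box, hence is compact.\<close>
  have "compact ((+) v0 ` (\<lambda>c. \<Sum>e\<in>D. c e *\<^sub>R e) ` (PiE D (\<lambda>_. {-(2*r)..2*r})))"
    by (intro compact_continuous_image continuous_intros compact_coordinate_box D(1)) auto
  moreover have "K \<subseteq> (+) v0 ` (\<lambda>c. \<Sum>e\<in>D. c e *\<^sub>R e) ` (PiE D (\<lambda>_. {-(2*r)..2*r}))"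
  proof
    fix v assume "v \<in> K"
    have "v = v0 + (\<Sum>e\<in>D. (\<lambda>e\<in>D. representation D (v - v0) e) e *\<^sub>R e)"
      by (simp add: representation_sum[OF D])
    moreover have "(\<lambda>e\<in>D. representation D (v - v0) e) \<in> PiE D (\<lambda>_. {-(2*r)..2*r})"
    proof
      show "(\<lambda>e\<in>D. representation D (v - v0) e) e \<in> {-(2*r)..2*r}" if "e \<in> D" for e
        using coord[OF \<open>v \<in> K\<close> that] that by (simp add: abs_le_iff)
    qed simp
    ultimately show "v \<in> (+) v0 ` (\<lambda>c. \<Sum>e\<in>D. c e *\<^sub>R e) ` (PiE D (\<lambda>_. {-(2*r)..2*r}))" by blast
  qed
  ultimately have "compact K"
    using compact_Int_closed[OF _ \<open>closed K\<close>] inf.absorb2 by fastforce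
  have "q v0 = 0" by (simp add: q_def real_vector.representation_zero)
  show thesis
  proof (rule that)
    show "smooth_on UNIV (\<lambda>v. step_fun (q v))"
      by (rule smooth_on_compose[OF finite_dimensional_real open_UNIV open_UNIV _ smooth_q smooth_on_step_fun]) simp
    show "compact K" "open V" by fact+
    show "K \<subseteq> O'" using \<open>K \<subseteq> ball v0 \<epsilon>\<close> \<epsilon>(2) by blast
    show "v0 \<in> V" "V \<subseteq> K" using \<open>q v0 = 0\<close> by (auto simp: V_def K_def)
  qed (auto simp: V_def K_def step_fun_simps)
qed

section \<open>Smooth functions on a manifold\<close>

text \<open>Charts of \<open>M\<close> are kept whole and only their images are cut down to
  \<open>W\<close>. For open \<open>W\<close> this agrees with \<open>smooth_map\<close> on the open
  submanifold, see \<open>smooth_map_vector_iff\<close>, without its restricted charts.\<close>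

definition smooth_fun ::
  "('p, 'b::real_normed_vector) manifold_data \<Rightarrow> 'p set \<Rightarrow> ('p \<Rightarrow> 'v::real_normed_vector) \<Rightarrow> bool" where
  "smooth_fun M W F \<longleftrightarrow> (\<forall>(U, c)\<in>atlas M. smooth_on (c ` (U \<inter> W)) (F \<circ> inv_into U c))"

lemma smooth_funI:
  "(\<And>U c. (U, c) \<in> atlas M \<Longrightarrow> smooth_on (c ` (U \<inter> W)) (\<lambda>v. F (inv_into U c v))) \<Longrightarrow> smooth_fun M W F"
  by (auto simp: smooth_fun_def o_def)

lemma smooth_funD:
  "smooth_fun M W F \<Longrightarrow> (U, c) \<in> atlas M \<Longrightarrow> smooth_on (c ` (U \<inter> W)) (\<lambda>v. F (inv_into U c v))"
  by (auto simp: smooth_fun_def o_def)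

locale smooth_mfd =
  fixes M :: "('p, 'b::real_normed_vector) manifold_data"
  assumes smooth_manifold: "smooth_manifold M"
begin

lemma fd: "finite_dimensional TYPE('b)"
  and Hausdorff: "Hausdorff_space (mtop M)"
  and second_countable: "second_countable (mtop M)"
  using smooth_manifold by (auto simp: smooth_manifold_def paracompact_space_def)

lemma atlas_conds:
  "\<forall>(U, c)\<in>atlas M. openin (mtop M) U \<and> open (c ` U) \<and>
        homeomorphic_map (subtopology (mtop M) U) (subtopology euclidean (c ` U)) c"
  "(\<Union>(U, c)\<in>atlas M. U) = points M"
  "\<forall>(U, c)\<in>atlas M. \<forall>(V, d)\<in>atlas M. smooth_on (c ` (U \<inter> V)) (d \<circ> inv_into U c)"
  using smooth_manifold unfolding smooth_manifold_def by - (elim conjE, assumption)+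

lemma chart:
  assumes "(U, c) \<in> atlas M"
  shows "openin (mtop M) U" "open (c ` U)"
    "homeomorphic_map (subtopology (mtop M) U) (subtopology euclidean (c ` U)) c"
    "U \<subseteq> points M" "inj_on c U"
proof -
  show *: "openin (mtop M) U" "open (c ` U)"
    "homeomorphic_map (subtopology (mtop M) U) (subtopology euclidean (c ` U)) c"
    using bspec[OF atlas_conds(1) assms] by auto
  show U: "U \<subseteq> points M" using openin_subset[OF *(1)] .
  show "inj_on c U"
    using *(3) U by (auto simp: homeomorphic_eq_everything_map Int_absorb1)
qed

lemma chart_at:
  assumes "x \<in> points M"
  obtains U c where "(U, c) \<in> atlas M" "x \<in> U"
proof -
  have "x \<in> (\<Union>(U, c)\<in>atlas M. U)"
    using atlas_conds(2) assms by simp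
  with that show thesis by blast
qed

lemma chart_transition:
  "(U, c) \<in> atlas M \<Longrightarrow> (V, d) \<in> atlas M \<Longrightarrow> smooth_on (c ` (U \<inter> V)) (d \<circ> inv_into U c)"
  using bspec[OF atlas_conds(3), of "(U, c)"] by auto

lemma open_chart_image:
  assumes "(U, c) \<in> atlas M" "openin (mtop M) W"
  shows "open (c ` (U \<inter> W))"
proof -
  note c = chart[OF assms(1)]
  have "openin (subtopology (mtop M) U) (U \<inter> W)"
    using assms(2) by (auto simp: openin_subtopology)
  then have "openin (subtopology euclidean (c ` U)) (c ` (U \<inter> W))"
    using homeomorphic_imp_open_map[OF c(3)] by (auto simp: open_map_def)
  then show ?thesis using openin_open_eq[OF c(2)] by simp
qed

lemma openin_chart_preimage:
  assumes "(U, c) \<in> atlas M" "open T"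
  shows "openin (mtop M) {x \<in> U. c x \<in> T}"
proof -
  note c = chart[OF assms(1)]
  have "continuous_map (subtopology (mtop M) U) euclidean c"
    using homeomorphic_imp_continuous_map[OF c(3)] by (simp add: continuous_map_in_subtopology)
  then have "openin (subtopology (mtop M) U) {x \<in> topspace (subtopology (mtop M) U). c x \<in> T}"
    using assms(2) by (intro openin_continuous_map_preimage) auto
  moreover have "{x \<in> topspace (subtopology (mtop M) U). c x \<in> T} = {x \<in> U. c x \<in> T}"
    using c(4) by auto
  ultimately show ?thesis using openin_open_subtopology[OF c(1)] by simp
qed

lemma smooth_fun_local:
  assumes "\<And>x. x \<in> W \<Longrightarrow> \<exists>W' G. openin (mtop M) W' \<and> x \<in> W' \<and> smooth_fun M W' G \<and> (\<forall>y\<in>W'. F y = G y)"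
  shows "smooth_fun M W F"
  unfolding smooth_fun_def
proof clarify
  fix U c assume c: "(U, c) \<in> atlas M"
  show "smooth_on (c ` (U \<inter> W)) (F \<circ> inv_into U c)"
  proof (rule smooth_on_local)
    fix v assume "v \<in> c ` (U \<inter> W)"
    then obtain x where x: "x \<in> U" "x \<in> W" "v = c x" by blast
    obtain W' G where W': "openin (mtop M) W'" "x \<in> W'" "smooth_fun M W' G" "\<forall>y\<in>W'. F y = G y"
      using assms[OF x(2)] by blast
    show "\<exists>T g. open T \<and> v \<in> T \<and> smooth_on T g \<and> (\<forall>y\<in>T. (F \<circ> inv_into U c) y = g y)"
    proof (intro exI conjI)
      show "open (c ` (U \<inter> W'))" by (rule open_chart_image[OF c W'(1)])
      show "v \<in> c ` (U \<inter> W')" using x W'(2) by blast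
      show "smooth_on (c ` (U \<inter> W')) (G \<circ> inv_into U c)"
        using W'(3) c by (auto simp: smooth_fun_def)
      show "\<forall>y\<in>c ` (U \<inter> W'). (F \<circ> inv_into U c) y = (G \<circ> inv_into U c) y"
        using W'(4) chart(5)[OF c] by auto
    qed
  qed
qed

lemma smooth_fun_cong:
  "openin (mtop M) W \<Longrightarrow> smooth_fun M W G \<Longrightarrow> (\<And>x. x \<in> W \<Longrightarrow> F x = G x) \<Longrightarrow> smooth_fun M W F"
  by (rule smooth_fun_local) (rule exI[of _ W], rule exI[of _ G], simp)

lemma smooth_fun_subset:
  assumes "smooth_fun M W F" "W' \<subseteq> W"
  shows "smooth_fun M W' F"
  unfolding smooth_fun_def
proof clarify
  fix U c assume "(U, c) \<in> atlas M"
  then have "smooth_on (c ` (U \<inter> W)) (F \<circ> inv_into U c)"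
    using assms(1) by (auto simp: smooth_fun_def)
  then show "smooth_on (c ` (U \<inter> W')) (F \<circ> inv_into U c)"
    by (rule smooth_on_subset) (use assms(2) in blast)
qed

lemma smooth_fun_const: "openin (mtop M) W \<Longrightarrow> smooth_fun M W (\<lambda>_. a)"
  by (rule smooth_funI) (intro smooth_on_const open_chart_image)

lemma smooth_fun_add:
  "openin (mtop M) W \<Longrightarrow> smooth_fun M W F \<Longrightarrow> smooth_fun M W G \<Longrightarrow> smooth_fun M W (\<lambda>x. F x + G x)"
  by (rule smooth_funI) (intro smooth_on_add smooth_funD open_chart_image)

lemma smooth_fun_bounded_linear:
  "bounded_linear L \<Longrightarrow> openin (mtop M) W \<Longrightarrow> smooth_fun M W F \<Longrightarrow> smooth_fun M W (\<lambda>x. L (F x))"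
  by (rule smooth_funI) (intro smooth_on_bounded_linear_comp[where L=L] smooth_funD open_chart_image)

lemma smooth_fun_minus:
  "openin (mtop M) W \<Longrightarrow> smooth_fun M W F \<Longrightarrow> smooth_fun M W (\<lambda>x. - F x)"
  by (rule smooth_fun_bounded_linear[OF bounded_linear_minus[OF bounded_linear_ident]])

lemma smooth_fun_diff:
  "openin (mtop M) W \<Longrightarrow> smooth_fun M W F \<Longrightarrow> smooth_fun M W G \<Longrightarrow> smooth_fun M W (\<lambda>x. F x - G x)"
  using smooth_fun_add[OF _ _ smooth_fun_minus, of W F G] by simp

lemma smooth_fun_sum:
  "openin (mtop M) W \<Longrightarrow> (\<And>i. i \<in> I \<Longrightarrow> smooth_fun M W (F i)) \<Longrightarrow> smooth_fun M W (\<lambda>x. \<Sum>i\<in>I. F i x)"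
  by (induction I rule: infinite_finite_induct) (auto intro: smooth_fun_const smooth_fun_add)

lemma smooth_fun_bilinear:
  "bounded_bilinear P \<Longrightarrow> openin (mtop M) W \<Longrightarrow> smooth_fun M W F \<Longrightarrow> smooth_fun M W G \<Longrightarrow>
    smooth_fun M W (\<lambda>x. P (F x) (G x))"
  by (rule smooth_funI) (intro smooth_on_bilinear[where P=P] smooth_funD open_chart_image)

lemma smooth_fun_mult:
  fixes F G :: "'p \<Rightarrow> 'v::real_normed_algebra"
  shows "openin (mtop M) W \<Longrightarrow> smooth_fun M W F \<Longrightarrow> smooth_fun M W G \<Longrightarrow> smooth_fun M W (\<lambda>x. F x * G x)"
  by (rule smooth_fun_bilinear[OF bounded_bilinear_mult])

lemma smooth_fun_prod:
  fixes F :: "'k \<Rightarrow> 'p \<Rightarrow> 'v::real_normed_field"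
  shows "openin (mtop M) W \<Longrightarrow> (\<And>i. i \<in> I \<Longrightarrow> smooth_fun M W (F i)) \<Longrightarrow> smooth_fun M W (\<lambda>x. \<Prod>i\<in>I. F i x)"
  by (induction I rule: infinite_finite_induct) (auto intro: smooth_fun_const smooth_fun_mult)

lemma smooth_fun_inverse:
  fixes F :: "'p \<Rightarrow> 'v::real_normed_field"
  assumes "openin (mtop M) W" "smooth_fun M W F" "\<And>x. x \<in> W \<Longrightarrow> F x \<noteq> 0"
  shows "smooth_fun M W (\<lambda>x. inverse (F x))"
proof (rule smooth_funI)
  fix U c assume c: "(U, c) \<in> atlas M"
  have "F (inv_into U c v) \<noteq> 0" if "v \<in> c ` (U \<inter> W)" for v
    using that assms(3) chart(5)[OF c] by auto
  then show "smooth_on (c ` (U \<inter> W)) (\<lambda>v. inverse (F (inv_into U c v)))"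
    by (intro smooth_on_inverse open_chart_image c assms(1) smooth_funD[OF assms(2)])
qed

lemma smooth_fun_imp_continuous:
  fixes F :: "'p \<Rightarrow> 'v::real_normed_vector"
  assumes "openin (mtop M) W" "smooth_fun M W F"
  shows "continuous_map (subtopology (mtop M) W) euclidean F"
  unfolding continuous_map_def
proof (intro conjI allI impI)
  fix S :: "'v set" assume "openin euclidean S"
  then have "open S" by simp
  have W: "W \<subseteq> points M" using openin_subset[OF assms(1)] .
  have "openin (mtop M) {x \<in> W. F x \<in> S}"
  proof (subst openin_subopen, rule ballI)
    fix x assume "x \<in> {x \<in> W. F x \<in> S}"
    then have x: "x \<in> W" "F x \<in> S" by auto
    then obtain U c where c: "(U, c) \<in> atlas M" "x \<in> U" using W chart_at by blast
    define T where "T = {v \<in> c ` (U \<inter> W). (F \<circ> inv_into U c) v \<in> S}"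
    have "continuous_on (c ` (U \<inter> W)) (F \<circ> inv_into U c)"
      unfolding o_def by (rule smooth_on_imp_continuous_on[OF smooth_funD[OF assms(2) c(1)]])
    then have "open T"
      unfolding T_def using open_chart_image[OF c(1) assms(1)] \<open>open S\<close>
      using continuous_open_preimage[of "c ` (U \<inter> W)" "F \<circ> inv_into U c" S]
      by (simp add: vimage_def Int_def)
    then have "openin (mtop M) {x \<in> U. c x \<in> T}" by (rule openin_chart_preimage[OF c(1)])
    moreover have "{x \<in> U. c x \<in> T} = {x \<in> U \<inter> W. F x \<in> S}"
      using chart(5)[OF c(1)] by (auto simp: T_def inj_on_eq_iff)
    ultimately show "\<exists>T. openin (mtop M) T \<and> x \<in> T \<and> T \<subseteq> {x \<in> W. F x \<in> S}"
      using x c(2) by (intro exI[of _ "{x \<in> U \<inter> W. F x \<in> S}"]) auto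
  qed
  moreover have "{x \<in> topspace (subtopology (mtop M) W). F x \<in> S} = {x \<in> W. F x \<in> S}"
    using W by auto
  ultimately show "openin (subtopology (mtop M) W) {x \<in> topspace (subtopology (mtop M) W). F x \<in> S}"
    using openin_open_subtopology[OF assms(1)] by auto
qed auto

text \<open>The inverses of a chart on \<open>U\<close> and on \<open>U \<inter> W\<close> agree on
  the image of \<open>U \<inter> W\<close>, and the continuity that \<open>smooth_map\<close>
  demands separately follows from smoothness in charts.\<close>

lemma smooth_map_vector_iff:
  assumes "openin (mtop M) W"
  shows "smooth_map (open_submanifold M W) vector_manifold F \<longleftrightarrow> smooth_fun M W F"
proof -
  have "smooth_on (c ` {x \<in> U \<inter> W. F x \<in> UNIV}) (id \<circ> F \<circ> inv_into (U \<inter> W) c) \<longleftrightarrow>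
      smooth_on (c ` (U \<inter> W)) (F \<circ> inv_into U c)" (is "?L \<longleftrightarrow> ?R") if c: "(U, c) \<in> atlas M" for U c
  proof -
    have o: "open (c ` (U \<inter> W))" by (rule open_chart_image[OF c assms])
    have "inv_into (U \<inter> W) c v = inv_into U c v" if "v \<in> c ` (U \<inter> W)" for v
      using that chart(5)[OF c] by (auto simp: inv_into_f_eq inj_on_Int)
    then have eq: "(id \<circ> F \<circ> inv_into (U \<inter> W) c) v = (F \<circ> inv_into U c) v" if "v \<in> c ` (U \<inter> W)" for v
      using that by simp
    have W: "{x \<in> U \<inter> W. F x \<in> UNIV} = U \<inter> W" by auto
    show ?thesis
      unfolding W by (rule iffI; erule smooth_on_cong[OF o]; simp only: eq)
  qed
  then have "(\<forall>(U, c)\<in>atlas M. smooth_on (c ` {x \<in> U \<inter> W. F x \<in> UNIV}) (id \<circ> F \<circ> inv_into (U \<inter> W) c))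
      \<longleftrightarrow> smooth_fun M W F"
    unfolding smooth_fun_def by blast
  moreover have "smooth_map (open_submanifold M W) vector_manifold F \<longleftrightarrow>
      continuous_map (subtopology (mtop M) W) euclidean F \<and>
      (\<forall>(U, c)\<in>atlas M. smooth_on (c ` {x \<in> U \<inter> W. F x \<in> UNIV}) (id \<circ> F \<circ> inv_into (U \<inter> W) c))"
    by (simp add: smooth_map_def open_submanifold_def vector_manifold_def split_def Int_def)
  ultimately show ?thesis
    using smooth_fun_imp_continuous[OF assms, of F] by blast
qed

lemma smooth_fun_compose:
  fixes F :: "'p \<Rightarrow> 'v::real_normed_vector"
  assumes "finite_dimensional TYPE('v)" "openin (mtop M) W" "open T" "F ` W \<subseteq> T"
    "smooth_fun M W F" "smooth_on T g"
  shows "smooth_fun M W (\<lambda>x. g (F x))"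
  unfolding smooth_fun_def
proof clarify
  fix U c assume c: "(U, c) \<in> atlas M"
  then have "smooth_on (c ` (U \<inter> W)) (F \<circ> inv_into U c)"
    using assms(5) by (auto simp: smooth_fun_def)
  moreover have "(F \<circ> inv_into U c) ` c ` (U \<inter> W) \<subseteq> T"
    using chart(5)[OF c] assms(4) by auto
  ultimately show "smooth_on (c ` (U \<inter> W)) ((\<lambda>x. g (F x)) \<circ> inv_into U c)"
    using smooth_on_compose[OF assms(1) open_chart_image[OF c assms(2)] assms(3) _ _ assms(6)]
    by (simp add: o_def)
qed

lemma smooth_fun_chart:
  assumes "(U, c) \<in> atlas M"
  shows "smooth_fun M U c"
  unfolding smooth_fun_def using chart_transition assms by blast

text \<open>\<open>W\<close> and the complement of \<open>C\<close> are open and cover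
  \<open>M\<close>; on the second set the extension is identically 0.\<close>

lemma smooth_fun_extend_zero:
  fixes F :: "'p \<Rightarrow> 'v::real_normed_vector"
  assumes "openin (mtop M) W" "smooth_fun M W F" "closedin (mtop M) C" "C \<subseteq> W"
    "\<And>x. x \<in> W \<Longrightarrow> x \<notin> C \<Longrightarrow> F x = 0"
  shows "smooth_fun M (points M) (\<lambda>x. if x \<in> W then F x else 0)"
proof (rule smooth_fun_local)
  fix x assume x: "x \<in> points M"
  show "\<exists>W' G. openin (mtop M) W' \<and> x \<in> W' \<and> smooth_fun M W' G \<and> (\<forall>y\<in>W'. (if y \<in> W then F y else 0) = G y)"
  proof (cases "x \<in> W")
    case True
    then show ?thesis using assms(1,2) by (intro exI[of _ W] exI[of _ F]) simp
  next
    case False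
    have "openin (mtop M) (points M - C)" by (rule openin_diff[OF _ assms(3)]) simp
    moreover have "x \<in> points M - C" using False x assms(4) by blast
    ultimately show ?thesis
      using smooth_fun_const[of "points M - C" "0::'v"] assms(5)
      by (intro exI[of _ "points M - C"] exI[of _ "\<lambda>_. 0"]) simp
  qed
qed

text \<open>The bump is built inside one chart. The preimage \<open>C\<close> of the compact set
  \<open>K\<close> is compact, and the Hausdorff property makes it closed in all of
  \<open>M\<close>, as extension by 0 requires.\<close>

lemma smooth_bump_on_manifold:
  assumes "openin (mtop M) W" "m \<in> W"
  obtains \<beta> :: "'p \<Rightarrow> real" and C V where
    "smooth_fun M (points M) \<beta>" "closedin (mtop M) C" "C \<subseteq> W"
    "openin (mtop M) V" "m \<in> V" "V \<subseteq> C" "\<And>x. x \<in> V \<Longrightarrow> \<beta> x = 1"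
    "\<And>x. x \<notin> C \<Longrightarrow> \<beta> x = 0" "\<And>x. 0 \<le> \<beta> x" "\<And>x. \<beta> x \<le> 1"
proof -
  have "m \<in> points M" using assms openin_subset by blast
  then obtain U c where c: "(U, c) \<in> atlas M" "m \<in> U" by (rule chart_at)
  note cc = chart[OF c(1)]
  obtain \<beta> :: "'b \<Rightarrow> real" and K V where \<beta>:
    "smooth_on UNIV \<beta>" "compact K" "K \<subseteq> c ` (U \<inter> W)" "open V" "c m \<in> V" "V \<subseteq> K"
    "\<And>v. v \<in> V \<Longrightarrow> \<beta> v = 1" "\<And>v. v \<notin> K \<Longrightarrow> \<beta> v = 0" "\<And>v. 0 \<le> \<beta> v" "\<And>v. \<beta> v \<le> 1"
    using smooth_bump[OF fd open_chart_image[OF c(1) assms(1)], of "c m"] c(2) assms(2) by blast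
  define C where "C = {x \<in> U. c x \<in> K}"
  define b where "b x = (if x \<in> U then \<beta> (c x) else 0)" for x
  have "c ` C = K" using \<beta>(3) by (auto simp: C_def)
  have "C \<subseteq> U" by (auto simp: C_def)
  have "compactin (subtopology euclidean (c ` U)) (c ` C)"
    using \<beta>(2,3) \<open>c ` C = K\<close> by (auto simp: compactin_subtopology)
  then have "compactin (subtopology (mtop M) U) C"
    using homeomorphic_map_compactness[OF cc(3), of C] \<open>C \<subseteq> U\<close> cc(4) by auto
  then have "compactin (mtop M) C" by (simp add: compactin_subtopology)
  then have closed: "closedin (mtop M) C" by (rule compactin_imp_closedin[OF Hausdorff])
  have "smooth_fun M U (\<lambda>x. \<beta> (c x))"
    by (rule smooth_fun_compose[OF fd cc(1) open_UNIV _ smooth_fun_chart[OF c(1)] \<beta>(1)]) simp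
  then have "smooth_fun M (points M) b"
    unfolding b_def
    by (rule smooth_fun_extend_zero[OF cc(1) _ closed \<open>C \<subseteq> U\<close>]) (simp add: C_def \<beta>(8))
  moreover have "C \<subseteq> W"
    using \<beta>(3) cc(5) by (auto simp: C_def inj_on_eq_iff dest!: subsetD)
  moreover have "openin (mtop M) {x \<in> U. c x \<in> V}" by (rule openin_chart_preimage[OF c(1) \<beta>(4)])
  ultimately show thesis
    using closed c(2) \<beta>(5-10)
    by (intro that[of b C "{x \<in> U. c x \<in> V}"]) (auto simp: b_def C_def)
qed

end

section \<open>Characters of commutative algebras\<close>

lemma complex_alg_simps [simp]:
  "carrier complex_alg = UNIV" "mult complex_alg = (*)" "one complex_alg = 1"
  "zero complex_alg = 0" "add complex_alg = (+)" "smult complex_alg = (*)"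
  by (simp_all add: complex_alg_def)

abbreviation tuples :: "nat \<Rightarrow> (nat \<Rightarrow> complex) set" where
  "tuples n \<equiv> {1..n} \<rightarrow>\<^sub>E UNIV"

lemma power_alg_simps [simp]:
  "carrier (power_alg n) = tuples n" "mult (power_alg n) = (\<lambda>z w. \<lambda>k\<in>{1..n}. z k * w k)"
  "add (power_alg n) = (\<lambda>z w. \<lambda>k\<in>{1..n}. z k + w k)" "smult (power_alg n) = (\<lambda>a z. \<lambda>k\<in>{1..n}. a * z k)"
  by (simp_all add: power_alg_def)

lemma complex_algebra_cring: "complex_algebra B \<Longrightarrow> cring B"
  and complex_algebra_ring: "complex_algebra B \<Longrightarrow> ring B"
  by (simp_all add: algebra_def cring.axioms)

lemma complex_algebra_smult:
  assumes "complex_algebra B" "x \<in> carrier B"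
  shows "a \<odot>\<^bsub>B\<^esub> x \<in> carrier B"
    "a \<odot>\<^bsub>B\<^esub> (b \<odot>\<^bsub>B\<^esub> x) = (a * b) \<odot>\<^bsub>B\<^esub> x" "1 \<odot>\<^bsub>B\<^esub> x = x"
    "(a + b) \<odot>\<^bsub>B\<^esub> x = a \<odot>\<^bsub>B\<^esub> x \<oplus>\<^bsub>B\<^esub> b \<odot>\<^bsub>B\<^esub> x" "0 \<odot>\<^bsub>B\<^esub> x = \<zero>\<^bsub>B\<^esub>"
proof -
  interpret B: algebra complex_alg B by fact
  show "a \<odot>\<^bsub>B\<^esub> x \<in> carrier B" using B.smult_closed[of a x] assms(2) by simp
  show "a \<odot>\<^bsub>B\<^esub> (b \<odot>\<^bsub>B\<^esub> x) = (a * b) \<odot>\<^bsub>B\<^esub> x" using B.smult_assoc1[of a b x] assms(2) by simp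
  show "1 \<odot>\<^bsub>B\<^esub> x = x" using B.smult_one[of x] assms(2) by simp
  show "(a + b) \<odot>\<^bsub>B\<^esub> x = a \<odot>\<^bsub>B\<^esub> x \<oplus>\<^bsub>B\<^esub> b \<odot>\<^bsub>B\<^esub> x" using B.smult_l_distr[of a b x] assms(2) by simp
  show "0 \<odot>\<^bsub>B\<^esub> x = \<zero>\<^bsub>B\<^esub>" using B.smult_l_null[of x] assms(2) by simp
qed

lemma complex_algebra_smult_add:
  assumes "complex_algebra B" "x \<in> carrier B" "y \<in> carrier B"
  shows "a \<odot>\<^bsub>B\<^esub> (x \<oplus>\<^bsub>B\<^esub> y) = a \<odot>\<^bsub>B\<^esub> x \<oplus>\<^bsub>B\<^esub> a \<odot>\<^bsub>B\<^esub> y"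
    "(a \<odot>\<^bsub>B\<^esub> x) \<otimes>\<^bsub>B\<^esub> y = a \<odot>\<^bsub>B\<^esub> (x \<otimes>\<^bsub>B\<^esub> y)"
    "x \<otimes>\<^bsub>B\<^esub> (a \<odot>\<^bsub>B\<^esub> y) = a \<odot>\<^bsub>B\<^esub> (x \<otimes>\<^bsub>B\<^esub> y)"
proof -
  interpret B: algebra complex_alg B by fact
  show "a \<odot>\<^bsub>B\<^esub> (x \<oplus>\<^bsub>B\<^esub> y) = a \<odot>\<^bsub>B\<^esub> x \<oplus>\<^bsub>B\<^esub> a \<odot>\<^bsub>B\<^esub> y"
    using B.smult_r_distr[of a x y] assms by simp
  show *: "(a \<odot>\<^bsub>B\<^esub> x) \<otimes>\<^bsub>B\<^esub> y = a \<odot>\<^bsub>B\<^esub> (x \<otimes>\<^bsub>B\<^esub> y)" 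
    using B.smult_assoc2[of a x y] assms by simp
  show "x \<otimes>\<^bsub>B\<^esub> (a \<odot>\<^bsub>B\<^esub> y) = a \<odot>\<^bsub>B\<^esub> (x \<otimes>\<^bsub>B\<^esub> y)"
    using B.smult_assoc2[of a y x] assms complex_algebra_smult(1)[OF assms(1,3), of a]
    by (simp add: cring.cring_simprules(14)[OF complex_algebra_cring[OF assms(1)]])
qed

lemma alg_homD:
  assumes "h \<in> alg_hom B C" "x \<in> carrier B"
  shows "h x \<in> carrier C" "h (a \<odot>\<^bsub>B\<^esub> x) = a \<odot>\<^bsub>C\<^esub> h x"
    "y \<in> carrier B \<Longrightarrow> h (x \<oplus>\<^bsub>B\<^esub> y) = h x \<oplus>\<^bsub>C\<^esub> h y"
    "y \<in> carrier B \<Longrightarrow> h (x \<otimes>\<^bsub>B\<^esub> y) = h x \<otimes>\<^bsub>C\<^esub> h y"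
  using assms by (auto simp: alg_hom_def)

lemma alg_homI:
  assumes "\<And>x. x \<in> carrier B \<Longrightarrow> h x \<in> carrier C"
    "\<And>x y. x \<in> carrier B \<Longrightarrow> y \<in> carrier B \<Longrightarrow> h (x \<oplus>\<^bsub>B\<^esub> y) = h x \<oplus>\<^bsub>C\<^esub> h y"
    "\<And>x y. x \<in> carrier B \<Longrightarrow> y \<in> carrier B \<Longrightarrow> h (x \<otimes>\<^bsub>B\<^esub> y) = h x \<otimes>\<^bsub>C\<^esub> h y"
    "\<And>a x. x \<in> carrier B \<Longrightarrow> h (a \<odot>\<^bsub>B\<^esub> x) = a \<odot>\<^bsub>C\<^esub> h x"
  shows "h \<in> alg_hom B C"
  using assms by (simp add: alg_hom_def)

lemma alg_isoD:
  assumes "h \<in> alg_iso B C"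
  shows "h \<in> alg_hom B C" "bij_betw h (carrier B) (carrier C)"
  using assms by (simp_all add: alg_iso_def)

section \<open>Isomorphisms, maximal ideals and the Jacobson radical\<close>

lemma alg_iso_inv_into:
  assumes "complex_algebra B" "f \<in> alg_iso B C"
  shows "inv_into (carrier B) f \<in> alg_iso C B"
proof -
  let ?g = "inv_into (carrier B) f"
  note hom = alg_isoD(1)[OF assms(2)] and bij = alg_isoD(2)[OF assms(2)]
  have g: "?g x \<in> carrier B" "f (?g x) = x" if "x \<in> carrier C" for x
    using bij that by (auto simp: bij_betw_def intro: inv_into_into f_inv_into_f)
  have eq: "?g x = y" if "y \<in> carrier B" "f y = x" for x y
    using bij that by (auto simp: bij_betw_def inv_into_f_f)
  interpret B: cring B by (rule complex_algebra_cring[OF assms(1)])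
  have "?g \<in> alg_hom C B"
  proof (rule alg_homI)
    fix x y a assume x: "x \<in> carrier C"
    show "?g x \<in> carrier B" using g x by simp
    show "?g (a \<odot>\<^bsub>C\<^esub> x) = a \<odot>\<^bsub>B\<^esub> ?g x"
      using g[OF x] complex_algebra_smult(1)[OF assms(1)] alg_homD(2)[OF hom] by (intro eq) simp_all
    assume y: "y \<in> carrier C"
    show "?g (x \<oplus>\<^bsub>C\<^esub> y) = ?g x \<oplus>\<^bsub>B\<^esub> ?g y"
      using g[OF x] g[OF y] alg_homD(3)[OF hom] by (intro eq) simp_all
    show "?g (x \<otimes>\<^bsub>C\<^esub> y) = ?g x \<otimes>\<^bsub>B\<^esub> ?g y"
      using g[OF x] g[OF y] alg_homD(4)[OF hom] by (intro eq) simp_all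
  qed
  then show ?thesis using bij_betw_inv_into[OF bij] by (simp add: alg_iso_def)
qed

lemma alg_hom_zero:
  assumes "complex_algebra B" "complex_algebra C" "f \<in> alg_hom B C"
  shows "f \<zero>\<^bsub>B\<^esub> = \<zero>\<^bsub>C\<^esub>"
proof -
  interpret B: cring B by (rule complex_algebra_cring[OF assms(1)])
  have "f (0 \<odot>\<^bsub>B\<^esub> \<zero>\<^bsub>B\<^esub>) = 0 \<odot>\<^bsub>C\<^esub> f \<zero>\<^bsub>B\<^esub>"
    by (rule alg_homD(2)[OF assms(3)]) simp
  then show ?thesis
    using complex_algebra_smult(5)[OF assms(2)] complex_algebra_smult(5)[OF assms(1)]
      alg_homD(1)[OF assms(3)] by simp
qed

text \<open>The image of the unit acts as a unit on the range of a homomorphism, and an isomorphism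
  is onto.\<close>

lemma alg_iso_one:
  assumes "complex_algebra B" "complex_algebra C" "f \<in> alg_iso B C"
  shows "f \<one>\<^bsub>B\<^esub> = \<one>\<^bsub>C\<^esub>"
proof -
  note hom = alg_isoD(1)[OF assms(3)] and bij = alg_isoD(2)[OF assms(3)]
  interpret B: cring B by (rule complex_algebra_cring[OF assms(1)])
  interpret C: cring C by (rule complex_algebra_cring[OF assms(2)])
  obtain x where x: "x \<in> carrier B" "f x = \<one>\<^bsub>C\<^esub>"
    using bij C.one_closed unfolding bij_betw_def by (metis imageE)
  have "f (\<one>\<^bsub>B\<^esub> \<otimes>\<^bsub>B\<^esub> x) = f \<one>\<^bsub>B\<^esub> \<otimes>\<^bsub>C\<^esub> f x"
    by (rule alg_homD(4)[OF hom]) (use x in auto)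
  then show ?thesis
    using x alg_homD(1)[OF hom B.one_closed] by simp
qed

lemma alg_iso_ring_hom_ring:
  assumes "complex_algebra B" "complex_algebra C" "f \<in> alg_iso B C"
  shows "ring_hom_ring B C f"
proof (rule ring_hom_ringI2)
  show "ring B" "ring C" using assms complex_algebra_ring by auto
  show "f \<in> ring_hom B C"
    using alg_homD[OF alg_isoD(1)[OF assms(3)]] alg_iso_one[OF assms]
    by (intro ring_hom_memI) auto
qed

text \<open>An ideal above the preimage of \<open>J\<close> is carried by the inverse isomorphism to
  an ideal above \<open>J\<close>, where maximality applies.\<close>

lemma maximalideal_vimage_alg_iso:
  assumes "complex_algebra B" "complex_algebra C" "f \<in> alg_iso B C" "maximalideal J C"
  shows "maximalideal {x \<in> carrier B. f x \<in> J} B"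
proof (rule maximalidealI)
  let ?g = "inv_into (carrier B) f"
  interpret J: maximalideal J C by fact
  note hom = alg_homD[OF alg_isoD(1)[OF assms(3)]] and bij = alg_isoD(2)[OF assms(3)]
  have g: "?g x \<in> carrier B" "f (?g x) = x" if "x \<in> carrier C" for x
    using bij that by (auto simp: bij_betw_def intro: inv_into_into f_inv_into_f)
  have gf: "?g (f x) = x" if "x \<in> carrier B" for x
    using bij that by (auto simp: bij_betw_def inv_into_f_f)
  show "ideal {x \<in> carrier B. f x \<in> J} B"
    by (rule ring_hom_ring.ideal_vimage[OF alg_iso_ring_hom_ring[OF assms(1-3)] J.is_ideal])
  show "carrier B \<noteq> {x \<in> carrier B. f x \<in> J}"
  proof
    assume a: "carrier B = {x \<in> carrier B. f x \<in> J}"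
    have "carrier C \<subseteq> J"
    proof
      fix y assume "y \<in> carrier C"
      then have "?g y \<in> {x \<in> carrier B. f x \<in> J}" using g(1)[of y] a by blast
      then show "y \<in> J" using g(2)[OF \<open>y \<in> carrier C\<close>] by simp
    qed
    then show False using J.I_notcarr J.a_subset by blast
  qed
  fix I assume I: "ideal I B" "{x \<in> carrier B. f x \<in> J} \<subseteq> I" "I \<subseteq> carrier B"
  have "ideal {y \<in> carrier C. ?g y \<in> I} C"
    by (rule ring_hom_ring.ideal_vimage[OF alg_iso_ring_hom_ring[OF assms(2,1)
          alg_iso_inv_into[OF assms(1,3)]] I(1)])
  moreover have "J \<subseteq> {y \<in> carrier C. ?g y \<in> I}"
  proof
    fix y assume "y \<in> J"
    then have "y \<in> carrier C" using J.a_subset by blast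
    then show "y \<in> {y \<in> carrier C. ?g y \<in> I}" using g[of y] \<open>y \<in> J\<close> I(2) by auto
  qed
  ultimately consider "{y \<in> carrier C. ?g y \<in> I} = J" | "{y \<in> carrier C. ?g y \<in> I} = carrier C"
    using J.I_maximal by blast
  then show "I = {x \<in> carrier B. f x \<in> J} \<or> I = carrier B"
  proof cases
    case 1
    have "x \<in> I \<longleftrightarrow> f x \<in> J" if x: "x \<in> carrier B" for x
    proof -
      have "f x \<in> J \<longleftrightarrow> f x \<in> {y \<in> carrier C. ?g y \<in> I}" using 1 by simp
      then show ?thesis using hom(1)[OF x] gf[OF x] by simp
    qed
    then have "I = {x \<in> carrier B. f x \<in> J}" using I(3) by blast
    then show ?thesis ..
  next
    case 2
    have "x \<in> I" if "x \<in> carrier B" for x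
    proof -
      have "f x \<in> {y \<in> carrier C. ?g y \<in> I}" using 2 hom(1)[OF that] by blast
      then show ?thesis using gf[OF that] by simp
    qed
    then show ?thesis using I(3) by blast
  qed
qed

lemma jacobson_radical_alg_iso:
  assumes "complex_algebra B" "complex_algebra C" "f \<in> alg_iso B C" "x \<in> jacobson_radical B"
  shows "f x \<in> jacobson_radical C"
  using assms(4) maximalideal_vimage_alg_iso[OF assms(1-3)] alg_homD(1)[OF alg_isoD(1)[OF assms(3)]]
  by (auto simp: jacobson_radical_def)

lemma ideal_jacobson_radical:
  assumes "ring B"
  shows "ideal (jacobson_radical B) B"
proof -
  interpret ring B by fact
  \<comment> \<open>The carrier joins the family so that it is nonempty also for the zero algebra,
    which has no maximal ideals.\<close>
  have "jacobson_radical B = \<Inter> (insert (carrier B) {J. maximalideal J B})"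
    by (auto simp: jacobson_radical_def)
  then show ?thesis
    using i_Intersect[of "insert (carrier B) {J. maximalideal J B}"] oneideal maximalideal.axioms(1)
    by (metis (no_types, lifting) insertE insert_not_empty mem_Collect_eq)
qed

lemma jacobson_radical_smult:
  assumes "complex_algebra B" "x \<in> jacobson_radical B"
  shows "a \<odot>\<^bsub>B\<^esub> x \<in> jacobson_radical B"
proof -
  interpret B: cring B by (rule complex_algebra_cring[OF assms(1)])
  interpret N: ideal "jacobson_radical B" B
    by (rule ideal_jacobson_radical[OF complex_algebra_ring[OF assms(1)]])
  have x: "x \<in> carrier B" using assms(2) N.a_subset by blast
  have "(a \<odot>\<^bsub>B\<^esub> \<one>\<^bsub>B\<^esub>) \<otimes>\<^bsub>B\<^esub> x \<in> jacobson_radical B"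
    using N.I_l_closed[OF assms(2)] complex_algebra_smult(1)[OF assms(1)] by simp
  then show ?thesis using complex_algebra_smult_add(2)[OF assms(1) B.one_closed x] x by simp
qed

section \<open>Cosets of the radical and the semisimple quotient\<close>

definition rad_class :: "(complex, 'v) module \<Rightarrow> 'v \<Rightarrow> 'v set" where
  "rad_class B a = jacobson_radical B +>\<^bsub>B\<^esub> a"

lemma carrier_ss_quotient: "carrier (ss_quotient B) = rad_class B ` carrier B"
  by (auto simp: ss_quotient_def Let_def FactRing_def A_RCOSETS_def' rad_class_def)

lemma rad_class_eq_iff:
  assumes "complex_algebra B" "a \<in> carrier B" "b \<in> carrier B"
  shows "rad_class B a = rad_class B b \<longleftrightarrow> a \<ominus>\<^bsub>B\<^esub> b \<in> jacobson_radical B"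
  unfolding rad_class_def
  using ring.quotient_eq_iff_same_a_r_cos[OF complex_algebra_ring[OF assms(1)]
      ideal_jacobson_radical[OF complex_algebra_ring[OF assms(1)]] assms(2,3)] by simp

text \<open>Both \<open>ss_map\<close> and the scalar multiplication of \<open>ss_quotient\<close>
  are unions over representatives. All members of such a union coincide because \<open>f\<close>
  respects the radical, and a coset is nonempty, so the union collapses.\<close>

lemma rad_class_Union:
  assumes "complex_algebra B" "complex_algebra C" "a \<in> carrier B"
    and f: "\<And>x. x \<in> carrier B \<Longrightarrow> f x \<in> carrier C"
      "\<And>x. x \<in> jacobson_radical B \<Longrightarrow> f x \<in> jacobson_radical C"
      "\<And>x y. x \<in> carrier B \<Longrightarrow> y \<in> carrier B \<Longrightarrow> f (x \<oplus>\<^bsub>B\<^esub> y) = f x \<oplus>\<^bsub>C\<^esub> f y"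
  shows "(\<Union>x\<in>rad_class B a. rad_class C (f x)) = rad_class C (f a)"
proof -
  interpret B: cring B by (rule complex_algebra_cring[OF assms(1)])
  interpret C: cring C by (rule complex_algebra_cring[OF assms(2)])
  interpret N: ideal "jacobson_radical B" B
    by (rule ideal_jacobson_radical[OF complex_algebra_ring[OF assms(1)]])
  interpret NC: ideal "jacobson_radical C" C
    by (rule ideal_jacobson_radical[OF complex_algebra_ring[OF assms(2)]])
  have "rad_class C (f x) = rad_class C (f a)" if "x \<in> rad_class B a" for x
  proof -
    obtain h where h: "h \<in> jacobson_radical B" "x = h \<oplus>\<^bsub>B\<^esub> a"
      using \<open>x \<in> rad_class B a\<close> by (auto simp: rad_class_def a_r_coset_def')
    have hc: "h \<in> carrier B" using h(1) N.a_subset by blast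
    have "f x = f h \<oplus>\<^bsub>C\<^esub> f a" using h(2) f(3) hc assms(3) by simp
    then have "f x \<ominus>\<^bsub>C\<^esub> f a = f h"
      using f(1)[OF hc] f(1)[OF assms(3)] by (simp add: a_minus_def C.add.m_assoc C.r_neg)
    then show ?thesis
      using rad_class_eq_iff[OF assms(2) f(1) f(1)] f(2)[OF h(1)] hc assms(3) h(2) by simp
  qed
  moreover have "a \<in> rad_class B a"
    unfolding rad_class_def by (rule N.a_rcos_self[OF assms(3)])
  ultimately show ?thesis by blast
qed

lemma rad_class_ops:
  assumes "complex_algebra B" "a \<in> carrier B"
  shows "c \<odot>\<^bsub>ss_quotient B\<^esub> rad_class B a = rad_class B (c \<odot>\<^bsub>B\<^esub> a)"
    "b \<in> carrier B \<Longrightarrow> rad_class B a \<oplus>\<^bsub>ss_quotient B\<^esub> rad_class B b = rad_class B (a \<oplus>\<^bsub>B\<^esub> b)"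
    "b \<in> carrier B \<Longrightarrow> rad_class B a \<otimes>\<^bsub>ss_quotient B\<^esub> rad_class B b = rad_class B (a \<otimes>\<^bsub>B\<^esub> b)"
proof -
  interpret N: ideal "jacobson_radical B" B
    by (rule ideal_jacobson_radical[OF complex_algebra_ring[OF assms(1)]])
  show "c \<odot>\<^bsub>ss_quotient B\<^esub> rad_class B a = rad_class B (c \<odot>\<^bsub>B\<^esub> a)"
    using rad_class_Union[OF assms(1,1,2), of "\<lambda>x. c \<odot>\<^bsub>B\<^esub> x"]
      complex_algebra_smult(1)[OF assms(1)] jacobson_radical_smult[OF assms(1)]
      complex_algebra_smult_add(1)[OF assms(1)]
    by (simp add: ss_quotient_def Let_def rad_class_def)
  assume b: "b \<in> carrier B"
  show "rad_class B a \<oplus>\<^bsub>ss_quotient B\<^esub> rad_class B b = rad_class B (a \<oplus>\<^bsub>B\<^esub> b)"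
    using N.a_rcos_sum[OF assms(2) b] by (simp add: ss_quotient_def Let_def FactRing_def rad_class_def)
  show "rad_class B a \<otimes>\<^bsub>ss_quotient B\<^esub> rad_class B b = rad_class B (a \<otimes>\<^bsub>B\<^esub> b)"
    using N.rcoset_mult_add[OF assms(2) b] by (simp add: ss_quotient_def Let_def FactRing_def rad_class_def)
qed

lemma ss_map_rad_class:
  assumes "complex_algebra B" "complex_algebra C" "f \<in> alg_iso B C" "a \<in> carrier B"
  shows "ss_map B C f (rad_class B a) = rad_class C (f a)"
  using rad_class_Union[OF assms(1,2,4), of f] jacobson_radical_alg_iso[OF assms(1-3)]
    alg_homD[OF alg_isoD(1)[OF assms(3)]] assms(4)
  by (simp add: ss_map_def carrier_ss_quotient rad_class_def)

text \<open>The map induced by the inverse isomorphism recovers the class of \<open>a\<close> from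
  the class of \<open>f a\<close>.\<close>

lemma rad_class_alg_iso_inj:
  assumes "complex_algebra B" "complex_algebra C" "f \<in> alg_iso B C" "a \<in> carrier B" "b \<in> carrier B"
    "rad_class C (f a) = rad_class C (f b)"
  shows "rad_class B a = rad_class B b"
proof -
  let ?g = "inv_into (carrier B) f"
  note bij = alg_isoD(2)[OF assms(3)] and hom = alg_homD[OF alg_isoD(1)[OF assms(3)]]
  have "ss_map C B ?g (rad_class C (f x)) = rad_class B x" if "x \<in> carrier B" for x
    using ss_map_rad_class[OF assms(2,1) alg_iso_inv_into[OF assms(1,3)] hom(1)[OF that]] bij that
    by (simp add: bij_betw_def inv_into_f_f)
  then show ?thesis using assms(4-6) by metis
qed

section \<open>Characters, and automorphisms of powers of the complex numbers\<close>

lemma character_one: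
  assumes "complex_algebra B" "\<eta> \<in> alg_hom B complex_alg" "x \<in> carrier B" "\<eta> x \<noteq> 0"
  shows "\<eta> \<one>\<^bsub>B\<^esub> = 1"
proof -
  interpret B: cring B by (rule complex_algebra_cring[OF assms(1)])
  have "\<eta> (\<one>\<^bsub>B\<^esub> \<otimes>\<^bsub>B\<^esub> x) = \<eta> \<one>\<^bsub>B\<^esub> * \<eta> x"
    using alg_homD(4)[OF assms(2) B.one_closed assms(3)] by simp
  then show ?thesis using assms(3,4) by simp
qed

text \<open>The kernel of a nonzero character is a maximal ideal, and the radical lies in all of
  these.\<close>

lemma character_vanishes_on_radical:
  assumes "complex_algebra B" "\<eta> \<in> alg_hom B complex_alg" "x \<in> jacobson_radical B"
  shows "\<eta> x = 0"
proof (cases "\<exists>y\<in>carrier B. \<eta> y \<noteq> 0")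
  case False
  then show ?thesis using assms(3) by (auto simp: jacobson_radical_def)
next
  case True
  then have one: "\<eta> \<one>\<^bsub>B\<^esub> = 1" using character_one[OF assms(1,2)] by blast
  interpret B: cring B by (rule complex_algebra_cring[OF assms(1)])
  note \<eta> = alg_homD[OF assms(2), simplified]
  have zero: "\<eta> \<zero>\<^bsub>B\<^esub> = 0"
    using \<eta>(2)[OF B.zero_closed, of 0] complex_algebra_smult(5)[OF assms(1) B.zero_closed] by simp
  have neg: "\<eta> (\<ominus>\<^bsub>B\<^esub> y) = - \<eta> y" if "y \<in> carrier B" for y
  proof -
    have "\<eta> (\<ominus>\<^bsub>B\<^esub> y) + \<eta> y = 0"
      using \<eta>(3)[of "\<ominus>\<^bsub>B\<^esub> y" y] that zero by (simp add: B.l_neg)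
    then show ?thesis by (simp add: add_eq_0_iff2)
  qed
  let ?K = "{y \<in> carrier B. \<eta> y = 0}"
  have K: "ideal ?K B"
  proof (rule idealI)
    show "ring B" by (rule complex_algebra_ring[OF assms(1)])
    show "subgroup ?K (add_monoid B)"
      by (rule group.subgroupI[OF B.a_group]) (auto simp: zero neg \<eta>(3) a_inv_def[symmetric])
  qed (use \<eta>(4) in auto)
  have "maximalideal ?K B"
  proof (rule maximalidealI[OF K])
    show "carrier B \<noteq> ?K"
    proof
      assume "carrier B = ?K"
      with B.one_closed have "\<one>\<^bsub>B\<^esub> \<in> ?K" by blast
      with one show False by simp
    qed
    fix I assume I: "ideal I B" "?K \<subseteq> I" "I \<subseteq> carrier B"
    interpret I: ideal I B by (rule I(1))
    show "I = ?K \<or> I = carrier B"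
    proof (cases "I \<subseteq> ?K")
      case False
      then obtain y where y: "y \<in> I" "y \<in> carrier B" "\<eta> y \<noteq> 0" using I(3) by blast
      \<comment> \<open>Scaled so that \<open>?z\<close> times \<open>y\<close> has character value
        1. It then differs from the unit by an element of the kernel, so an ideal that contains the
        kernel and \<open>y\<close> contains the unit.\<close>
      let ?z = "(1 / \<eta> y) \<odot>\<^bsub>B\<^esub> \<one>\<^bsub>B\<^esub>"
      have z: "?z \<in> carrier B" by (rule complex_algebra_smult(1)[OF assms(1) B.one_closed])
      have zy: "?z \<otimes>\<^bsub>B\<^esub> y \<in> I" by (rule I.I_l_closed[OF y(1) z])
      have "\<eta> (?z \<otimes>\<^bsub>B\<^esub> y) = 1" using \<eta>(4)[OF z y(2)] \<eta>(2)[OF B.one_closed] one y(3) by simp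
      then have "\<one>\<^bsub>B\<^esub> \<ominus>\<^bsub>B\<^esub> ?z \<otimes>\<^bsub>B\<^esub> y \<in> ?K"
        using z y(2) one neg by (simp add: a_minus_def \<eta>(3))
      then have "(\<one>\<^bsub>B\<^esub> \<ominus>\<^bsub>B\<^esub> ?z \<otimes>\<^bsub>B\<^esub> y) \<oplus>\<^bsub>B\<^esub> ?z \<otimes>\<^bsub>B\<^esub> y \<in> I"
        using I(2) zy I.a_closed by blast
      then have "\<one>\<^bsub>B\<^esub> \<in> I" using z y(2) by (simp add: a_minus_def B.add.m_assoc B.l_neg)
      then show ?thesis using I.one_imp_carrier by blast
    qed (use I(2) in blast)
  qed
  then show ?thesis using assms(3) by (auto simp: jacobson_radical_def)
qed

text \<open>The unit is the sum of the idempotents \<open>e k\<close>, so the character is nonzero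
  on one of them; its value there is an idempotent number, hence 1. Multiplication by
  \<open>e k\<close> keeps only the coordinate \<open>k\<close>.\<close>

lemma character_power_alg:
  assumes h: "h \<in> alg_hom (power_alg n) complex_alg" and nz: "z0 \<in> carrier (power_alg n)" "h z0 \<noteq> 0"
  obtains k where "k \<in> {1..n}" "\<And>z. z \<in> carrier (power_alg n) \<Longrightarrow> h z = z k"
proof -
  note hd = alg_homD[OF h, unfolded complex_alg_simps power_alg_simps]
  define e where "e j = (\<lambda>k\<in>{1..n}. if k = j then 1 else 0::complex)" for j
  \<comment> \<open>Partial sums of the \<open>e j\<close>: \<open>r 0\<close> is zero and
    \<open>r n\<close> is the unit.\<close>
  define r where "r m = (\<lambda>k\<in>{1..n}. if k \<le> m then 1 else 0::complex)" for m
  have e: "e j \<in> tuples n" "r j \<in> tuples n" for j by (auto simp: e_def r_def)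
  have "\<exists>k\<in>{1..n}. h (e k) \<noteq> 0"
  proof (rule ccontr)
    assume "\<not> (\<exists>k\<in>{1..n}. h (e k) \<noteq> 0)"
    then have z: "h (e k) = 0" if "k \<in> {1..n}" for k using that by blast
    have "h (r m) = 0" if "m \<le> n" for m
      using that
    proof (induction m)
      case 0
      have "h (\<lambda>k\<in>{1..n}. 0 * r 0 k) = 0" using hd(2)[OF e(2), of 0 0] by simp
      moreover have "(\<lambda>k\<in>{1..n}. 0 * r 0 k) = r 0" by (auto simp: r_def)
      ultimately show ?case by simp
    next
      case (Suc m)
      have "r (Suc m) = (\<lambda>k\<in>{1..n}. r m k + e (Suc m) k)"
        by (auto simp: r_def e_def le_Suc_eq)
      moreover have "h (\<lambda>k\<in>{1..n}. r m k + e (Suc m) k) = 0"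
        using hd(3)[OF e(2) e(1), of m "Suc m"] z[of "Suc m"] Suc by simp
      ultimately show ?case by (simp only:)
    qed
    then have "h (r n) = 0" by simp
    moreover have "(\<lambda>k\<in>{1..n}. r n k * z0 k) = z0" using nz(1) by (auto simp: r_def fun_eq_iff PiE_iff extensional_def)
    ultimately show False using hd(4)[OF e(2), of z0 n] nz by simp
  qed
  then obtain k where k: "k \<in> {1..n}" "h (e k) \<noteq> 0" by blast
  have "(\<lambda>j\<in>{1..n}. e k j * e k j) = e k" by (auto simp: e_def)
  then have "h (e k) * h (e k) = h (e k)" using hd(4)[OF e(1) e(1), of k k] by simp
  then have ek: "h (e k) = 1" using k(2) by simp
  have "h z = z k" if z: "z \<in> carrier (power_alg n)" for z
  proof -
    have "(\<lambda>j\<in>{1..n}. z j * e k j) = (\<lambda>j\<in>{1..n}. z k * e k j)" by (auto simp: e_def)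
    then have "h z * h (e k) = z k * h (e k)"
      using hd(4)[OF _ e(1), of z k] hd(2)[OF e(1), of "z k" k] z by auto
    then show ?thesis using ek by simp
  qed
  with k(1) that show thesis by blast
qed

text \<open>Each coordinate of \<open>\<alpha>\<close> is a character of the power and therefore
  again a coordinate, which yields an index map. Surjectivity of \<open>\<alpha>\<close> makes this
  map injective, hence a permutation of the finite index set.\<close>

lemma automorphism_power_alg:
  assumes "\<alpha> \<in> alg_iso (power_alg n) (power_alg n)"
  obtains \<tau> where "\<tau> permutes {1..n}" "perm_aut n \<tau> = restrict \<alpha> (carrier (power_alg n))"
proof -
  note hom = alg_homD[OF alg_isoD(1)[OF assms], unfolded power_alg_simps]
  have surj: "\<exists>z \<in> tuples n. \<alpha> z = w" if "w \<in> tuples n" for w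
  proof -
    have "w \<in> \<alpha> ` (tuples n)"
      using alg_isoD(2)[OF assms] that unfolding bij_betw_def power_alg_simps by blast
    then show ?thesis by blast
  qed
  have "\<exists>j\<in>{1..n}. \<forall>z\<in>tuples n. \<alpha> z k = z j" if k: "k \<in> {1..n}" for k
  proof -
    have "(\<lambda>z. \<alpha> z k) \<in> alg_hom (power_alg n) complex_alg"
      by (rule alg_homI) (use hom k in auto)
    moreover obtain z0 where "z0 \<in> tuples n" "\<alpha> z0 = (\<lambda>k\<in>{1..n}. 1)"
      using surj[of "\<lambda>k\<in>{1..n}. 1"] by auto
    ultimately show ?thesis
      using character_power_alg[of "\<lambda>z. \<alpha> z k" n z0 thesis for thesis] k
      by (smt (verit) power_alg_simps(1) restrict_apply' zero_neq_one)
  qed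
  then obtain \<sigma> where \<sigma>: "\<And>k. k \<in> {1..n} \<Longrightarrow> \<sigma> k \<in> {1..n}"
    "\<And>k z. k \<in> {1..n} \<Longrightarrow> z \<in> tuples n \<Longrightarrow> \<alpha> z k = z (\<sigma> k)" by metis
  \<comment> \<open>\<open>permutes\<close> requires the identity outside the index set.\<close>
  define \<rho> where "\<rho> k = (if k \<in> {1..n} then \<sigma> k else k)" for k
  have "inj_on \<rho> {1..n}"
  proof (rule inj_onI)
    fix i j assume ij: "i \<in> {1..n}" "j \<in> {1..n}" "\<rho> i = \<rho> j"
    \<comment> \<open>A preimage of the idempotent at \<open>i\<close> tells \<open>i\<close> from
      every other index.\<close>
    obtain z where "z \<in> tuples n" "\<alpha> z = (\<lambda>k\<in>{1..n}. if k = i then 1 else 0)"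
      using surj[of "\<lambda>k\<in>{1..n}. if k = i then 1 else 0"] by auto
    note z = this
    have "\<alpha> z i = \<alpha> z j"
      using \<sigma>(2)[OF ij(1) z(1)] \<sigma>(2)[OF ij(2) z(1)] ij by (simp add: \<rho>_def)
    then show "i = j" unfolding z(2) using ij(1,2) by (simp split: if_splits)
  qed
  moreover have "\<rho> ` {1..n} \<subseteq> {1..n}" using \<sigma>(1) by (auto simp: \<rho>_def)
  ultimately have "bij_betw \<rho> {1..n} {1..n}"
    by (simp add: bij_betw_def endo_inj_surj)
  then have \<rho>: "\<rho> permutes {1..n}" by (rule bij_imp_permutes) (auto simp: \<rho>_def)
  \<comment> \<open>\<open>perm_aut\<close> reads coordinates through the inverse permutation while
    \<open>\<alpha>\<close> reads them through \<open>\<rho>\<close> itself, so the inverse of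
    \<open>\<rho>\<close> is the witness.\<close>
  have "perm_aut n (inv_into UNIV \<rho>) = restrict \<alpha> (carrier (power_alg n))"
  proof (rule ext)
    fix z
    show "perm_aut n (inv_into UNIV \<rho>) z = restrict \<alpha> (carrier (power_alg n)) z"
    proof (cases "z \<in> tuples n")
      case True
      have "(\<lambda>k\<in>{1..n}. z (\<rho> k)) = \<alpha> z"
        using hom(1)[OF True] \<sigma>(2)[OF _ True] by (auto simp: fun_eq_iff \<rho>_def PiE_iff extensional_def)
      then show ?thesis using True permutes_inv_inv[OF \<rho>] by (simp add: perm_aut_def)
    qed (simp add: perm_aut_def)
  qed
  with permutes_inv[OF \<rho>] that show thesis by blast
qed

section \<open>Algebras with split semisimple quotient\<close>

locale split_algebra =
  fixes A :: "(complex, 'v) module" and n :: nat and \<theta> :: "'v set \<Rightarrow> nat \<Rightarrow> complex"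
  assumes algebra: "complex_algebra A" and \<theta>: "\<theta> \<in> alg_iso (ss_quotient A) (power_alg n)"
begin

sublocale cring A by (rule complex_algebra_cring[OF algebra])

definition coords :: "'v \<Rightarrow> nat \<Rightarrow> complex" where
  "coords a = \<theta> (rad_class A a)"

lemma rad_class_in: "a \<in> carrier A \<Longrightarrow> rad_class A a \<in> carrier (ss_quotient A)"
  by (simp add: carrier_ss_quotient)

lemma coords_in: "a \<in> carrier A \<Longrightarrow> coords a \<in> tuples n"
  using alg_homD(1)[OF alg_isoD(1)[OF \<theta>] rad_class_in]
  unfolding coords_def power_alg_simps by blast

lemma coords_ops:
  assumes "a \<in> carrier A"
  shows "coords (c \<odot>\<^bsub>A\<^esub> a) = c \<odot>\<^bsub>power_alg n\<^esub> coords a"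
    "b \<in> carrier A \<Longrightarrow> coords (a \<oplus>\<^bsub>A\<^esub> b) = coords a \<oplus>\<^bsub>power_alg n\<^esub> coords b"
    "b \<in> carrier A \<Longrightarrow> coords (a \<otimes>\<^bsub>A\<^esub> b) = coords a \<otimes>\<^bsub>power_alg n\<^esub> coords b"
proof -
  note hom = alg_homD[OF alg_isoD(1)[OF \<theta>] rad_class_in[OF assms]]
  note ops = rad_class_ops[OF algebra assms, symmetric]
  show "coords (c \<odot>\<^bsub>A\<^esub> a) = c \<odot>\<^bsub>power_alg n\<^esub> coords a"
    unfolding coords_def ops(1) by (rule hom(2))
  assume b: "b \<in> carrier A"
  show "coords (a \<oplus>\<^bsub>A\<^esub> b) = coords a \<oplus>\<^bsub>power_alg n\<^esub> coords b"
    unfolding coords_def ops(2)[OF b] by (rule hom(3)[OF rad_class_in[OF b]])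
  show "coords (a \<otimes>\<^bsub>A\<^esub> b) = coords a \<otimes>\<^bsub>power_alg n\<^esub> coords b"
    unfolding coords_def ops(3)[OF b] by (rule hom(4)[OF rad_class_in[OF b]])
qed

lemma coords_hom:
  assumes "a \<in> carrier A" "k \<in> {1..n}"
  shows "coords (c \<odot>\<^bsub>A\<^esub> a) k = c * coords a k"
    "b \<in> carrier A \<Longrightarrow> coords (a \<oplus>\<^bsub>A\<^esub> b) k = coords a k + coords b k"
    "b \<in> carrier A \<Longrightarrow> coords (a \<otimes>\<^bsub>A\<^esub> b) k = coords a k * coords b k"
  using assms(2) by (simp_all add: coords_ops[OF assms(1)])

lemma coords_surj:
  assumes "z \<in> tuples n"
  obtains a where "a \<in> carrier A" "coords a = z"
proof -
  have "z \<in> \<theta> ` carrier (ss_quotient A)"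
    using alg_isoD(2)[OF \<theta>] assms unfolding bij_betw_def power_alg_simps by blast
  then show thesis using that by (auto simp: carrier_ss_quotient coords_def)
qed

lemma coords_eq_iff:
  assumes "a \<in> carrier A" "b \<in> carrier A"
  shows "coords a = coords b \<longleftrightarrow> rad_class A a = rad_class A b"
  using inj_on_eq_iff[OF bij_betw_imp_inj_on[OF alg_isoD(2)[OF \<theta>]] rad_class_in[OF assms(1)] rad_class_in[OF assms(2)]]
  by (simp add: coords_def)

lemma coords_character:
  assumes "k \<in> {1..n}"
  shows "(\<lambda>a. coords a k) \<in> alg_hom A complex_alg" "\<exists>a\<in>carrier A. coords a k \<noteq> 0"
proof -
  show "(\<lambda>a. coords a k) \<in> alg_hom A complex_alg"
    by (rule alg_homI) (use coords_hom assms in auto)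
  obtain a where "a \<in> carrier A" "coords a = (\<lambda>k\<in>{1..n}. 1)"
    using coords_surj[of "\<lambda>k\<in>{1..n}. 1"] by auto
  with assms show "\<exists>a\<in>carrier A. coords a k \<noteq> 0" by (intro bexI[of _ a]) simp_all
qed

lemma coords_one:
  assumes "k \<in> {1..n}"
  shows "coords \<one>\<^bsub>A\<^esub> k = 1"
  using coords_character[OF assms] character_one[OF algebra] by blast

lemma character_eq_coord:
  assumes \<eta>: "\<eta> \<in> alg_hom A complex_alg" and nz: "a0 \<in> carrier A" "\<eta> a0 \<noteq> 0"
  obtains k where "k \<in> {1..n}" "\<And>a. a \<in> carrier A \<Longrightarrow> \<eta> a = coords a k"
proof -
  note hom = alg_homD[OF \<eta>, unfolded complex_alg_simps]
  \<comment> \<open>The character descends along \<open>coords\<close>. Any choice of a preimage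
    will do, since two choices differ by an element of the radical, on which the character
    vanishes.\<close>
  define h where "h z = \<eta> (SOME a. a \<in> carrier A \<and> coords a = z)" for z
  have h: "h (coords a) = \<eta> a" if a: "a \<in> carrier A" for a
  proof -
    define b where "b = (SOME b. b \<in> carrier A \<and> coords b = coords a)"
    have b: "b \<in> carrier A" "coords b = coords a"
      unfolding b_def using someI[of "\<lambda>b. b \<in> carrier A \<and> coords b = coords a" a] a by blast+
    then have "b \<ominus>\<^bsub>A\<^esub> a \<in> jacobson_radical A"
      using coords_eq_iff[OF b(1) a] rad_class_eq_iff[OF algebra b(1) a] by simp
    then have z: "\<eta> (b \<ominus>\<^bsub>A\<^esub> a) = 0" by (rule character_vanishes_on_radical[OF algebra \<eta>])
    have "\<eta> ((b \<ominus>\<^bsub>A\<^esub> a) \<oplus>\<^bsub>A\<^esub> a) = \<eta> (b \<ominus>\<^bsub>A\<^esub> a) + \<eta> a"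
      by (rule hom(3)) (use a b in auto)
    moreover have "(b \<ominus>\<^bsub>A\<^esub> a) \<oplus>\<^bsub>A\<^esub> a = b"
      using a b by (simp add: a_minus_def add.m_assoc l_neg)
    ultimately show ?thesis using z by (simp add: h_def b_def[symmetric])
  qed
  have "h \<in> alg_hom (power_alg n) complex_alg"
  proof (rule alg_homI)
    fix z w c assume "z \<in> carrier (power_alg n)"
    then have "z \<in> tuples n" unfolding power_alg_simps .
    then obtain a where a: "a \<in> carrier A" "z = coords a" using coords_surj by metis
    show "h (c \<odot>\<^bsub>power_alg n\<^esub> z) = c \<odot>\<^bsub>complex_alg\<^esub> h z"
      unfolding a(2) coords_ops(1)[OF a(1), symmetric] h[OF complex_algebra_smult(1)[OF algebra a(1)]] h[OF a(1)]
      by (rule alg_homD(2)[OF \<eta> a(1)])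
    assume "w \<in> carrier (power_alg n)"
    then have "w \<in> tuples n" unfolding power_alg_simps .
    then obtain b where b: "b \<in> carrier A" "w = coords b" using coords_surj by metis
    show "h (z \<oplus>\<^bsub>power_alg n\<^esub> w) = h z \<oplus>\<^bsub>complex_alg\<^esub> h w"
      unfolding a(2) b(2) coords_ops(2)[OF a(1) b(1), symmetric] h[OF add.m_closed[OF a(1) b(1)]] h[OF a(1)] h[OF b(1)]
      by (rule alg_homD(3)[OF \<eta> a(1) b(1)])
    show "h (z \<otimes>\<^bsub>power_alg n\<^esub> w) = h z \<otimes>\<^bsub>complex_alg\<^esub> h w"
      unfolding a(2) b(2) coords_ops(3)[OF a(1) b(1), symmetric] h[OF m_closed[OF a(1) b(1)]] h[OF a(1)] h[OF b(1)]
      by (rule alg_homD(4)[OF \<eta> a(1) b(1)])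
  qed simp
  moreover have "h (coords a0) \<noteq> 0" using h nz by simp
  moreover have "coords a0 \<in> carrier (power_alg n)"
    unfolding power_alg_simps by (rule coords_in[OF nz(1)])
  ultimately obtain k where k: "k \<in> {1..n}" "\<And>z. z \<in> carrier (power_alg n) \<Longrightarrow> h z = z k"
    using character_power_alg by blast
  have "\<eta> a = coords a k" if "a \<in> carrier A" for a
    using k(2)[of "coords a"] coords_in[OF that] h[OF that] unfolding power_alg_simps by simp
  with k(1) that show thesis by blast
qed

text \<open>\<open>\<tau>\<close> is the expression behind \<open>perm_transition\<close>, for a
  single automorphism \<open>g\<close>. As it is selected by \<open>inv_into\<close>, a permutation
  inducing the automorphism has to be exhibited first; \<open>perm_aut\<close> then moves coordinate
  \<open>k\<close> to position \<open>\<tau> k\<close>.\<close>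

lemma coords_permuted:
  fixes g :: "'v \<Rightarrow> 'v"
  assumes g: "g \<in> alg_iso A A"
  defines "\<tau> \<equiv> inv_into {\<tau>. \<tau> permutes {1..n}} (perm_aut n)
    (\<lambda>z\<in>carrier (power_alg n). \<theta> (ss_map A A g (inv_into (carrier (ss_quotient A)) \<theta> z)))"
  shows "\<tau> permutes {1..n}"
    "\<And>a k. a \<in> carrier A \<Longrightarrow> k \<in> {1..n} \<Longrightarrow> coords (g a) (\<tau> k) = coords a k"
proof -
  let ?\<alpha> = "\<lambda>z. \<theta> (ss_map A A g (inv_into (carrier (ss_quotient A)) \<theta> z))"
  have inj: "inj_on \<theta> (carrier (ss_quotient A))"
    by (rule bij_betw_imp_inj_on[OF alg_isoD(2)[OF \<theta>]])
  note g' = alg_homD[OF alg_isoD(1)[OF g]]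
  have \<alpha>: "?\<alpha> (coords a) = coords (g a)" if "a \<in> carrier A" for a
    using inv_into_f_f[OF inj rad_class_in[OF that]] ss_map_rad_class[OF algebra algebra g that]
    by (simp add: coords_def)
  have "?\<alpha> \<in> alg_iso (power_alg n) (power_alg n)"
  proof -
    have "?\<alpha> \<in> alg_hom (power_alg n) (power_alg n)"
    proof (rule alg_homI)
      fix z w c assume "z \<in> carrier (power_alg n)"
      then have "z \<in> tuples n" unfolding power_alg_simps .
      then obtain a where a: "a \<in> carrier A" "z = coords a" using coords_surj by metis
      note ga = g'(1)[OF a(1)]
      show "?\<alpha> z \<in> carrier (power_alg n)"
        unfolding a(2) \<alpha>[OF a(1)] power_alg_simps by (rule coords_in[OF ga])
      note e = coords_ops(1)[symmetric]
      show "?\<alpha> (c \<odot>\<^bsub>power_alg n\<^esub> z) = c \<odot>\<^bsub>power_alg n\<^esub> ?\<alpha> z"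
        unfolding a(2) e[OF a(1)] \<alpha>[OF a(1)] \<alpha>[OF complex_algebra_smult(1)[OF algebra a(1)]] e[OF ga]
        by (simp only: g'(2)[OF a(1)])
      assume "w \<in> carrier (power_alg n)"
      then have "w \<in> tuples n" unfolding power_alg_simps .
      then obtain b where b: "b \<in> carrier A" "w = coords b" using coords_surj by metis
      note gb = g'(1)[OF b(1)]
      note e2 = coords_ops(2,3)[symmetric]
      show "?\<alpha> (z \<oplus>\<^bsub>power_alg n\<^esub> w) = ?\<alpha> z \<oplus>\<^bsub>power_alg n\<^esub> ?\<alpha> w"
        unfolding a(2) b(2) e2[OF a(1) b(1)] \<alpha>[OF a(1)] \<alpha>[OF b(1)] e2[OF ga gb] \<alpha>[OF add.m_closed[OF a(1) b(1)]]
        by (simp add: g'(3)[OF a(1) b(1)])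
      show "?\<alpha> (z \<otimes>\<^bsub>power_alg n\<^esub> w) = ?\<alpha> z \<otimes>\<^bsub>power_alg n\<^esub> ?\<alpha> w"
        unfolding a(2) b(2) e2[OF a(1) b(1)] \<alpha>[OF a(1)] \<alpha>[OF b(1)] e2[OF ga gb] \<alpha>[OF m_closed[OF a(1) b(1)]]
        by (simp add: g'(4)[OF a(1) b(1)])
    qed
    moreover have "bij_betw ?\<alpha> (tuples n) (tuples n)"
    proof (rule bij_betw_imageI)
      show "inj_on ?\<alpha> (tuples n)"
      proof (rule inj_onI)
        fix z w :: "nat \<Rightarrow> complex" assume zw: "z \<in> tuples n" "w \<in> tuples n" "?\<alpha> z = ?\<alpha> w"
        obtain a b where a: "a \<in> carrier A" "z = coords a" "b \<in> carrier A" "w = coords b"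
          using zw(1,2) coords_surj by metis
        have "coords (g a) = coords (g b)" using zw(3) \<alpha>[OF a(1)] \<alpha>[OF a(3)] a(2,4) by simp
        then have "rad_class A (g a) = rad_class A (g b)"
          using coords_eq_iff g'(1) a(1,3) by blast
        then have "rad_class A a = rad_class A b"
          by (rule rad_class_alg_iso_inj[OF algebra algebra g a(1,3)])
        then show "z = w" using a(2,4) by (simp add: coords_def)
      qed
      show "?\<alpha> ` (tuples n) = tuples n"
      proof (intro equalityI subsetI)
        fix w :: "nat \<Rightarrow> complex" assume "w \<in> tuples n"
        then obtain b where b: "b \<in> carrier A" "w = coords b" using coords_surj by metis
        have "b \<in> g ` carrier A"
          using b(1) bij_betw_imp_surj_on[OF alg_isoD(2)[OF g]] by simp
        then obtain a where a: "a \<in> carrier A" "g a = b" by auto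
        then show "w \<in> ?\<alpha> ` (tuples n)"
          using b \<alpha>[OF a(1)] coords_in[OF a(1)] by (intro image_eqI[of _ _ "coords a"]) simp_all
      next
        fix w assume "w \<in> ?\<alpha> ` (tuples n)"
        then obtain z where z: "z \<in> tuples n" "w = ?\<alpha> z" by blast
        then obtain a where a: "a \<in> carrier A" "z = coords a" using coords_surj by metis
        show "w \<in> tuples n"
          unfolding z(2) a(2) \<alpha>[OF a(1)] by (rule coords_in[OF g'(1)[OF a(1)]])
      qed
    qed
    ultimately show ?thesis unfolding alg_iso_def power_alg_simps by blast
  qed
  then obtain \<tau>' where \<tau>': "\<tau>' permutes {1..n}" "perm_aut n \<tau>' = restrict ?\<alpha> (carrier (power_alg n))"
    by (rule automorphism_power_alg)
  have img: "restrict ?\<alpha> (carrier (power_alg n)) \<in> perm_aut n ` {\<tau>. \<tau> permutes {1..n}}"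
    by (rule image_eqI[of _ "perm_aut n" \<tau>'], rule \<tau>'(2)[symmetric], rule CollectI, rule \<tau>'(1))
  show \<tau>: "\<tau> permutes {1..n}"
    using inv_into_into[OF img] unfolding \<tau>_def by simp
  have eq: "perm_aut n \<tau> = restrict ?\<alpha> (carrier (power_alg n))"
    unfolding \<tau>_def by (rule f_inv_into_f[OF img])
  fix a k assume a: "a \<in> carrier A" and k: "k \<in> {1..n}"
  have "coords (g a) (\<tau> k) = perm_aut n \<tau> (coords a) (\<tau> k)"
    unfolding eq restrict_apply power_alg_simps using coords_in[OF a] \<alpha>[OF a] by simp
  also have "\<dots> = coords a (inv_into UNIV \<tau> (\<tau> k))"
    using coords_in[OF a] permutes_in_image[OF \<tau>, of k] k unfolding perm_aut_def power_alg_simps by simp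
  also have "\<dots> = coords a k" using permutes_inverses(2)[OF \<tau>] by simp
  finally show "coords (g a) (\<tau> k) = coords a k" .
qed

end

section \<open>Smooth sections of an algebra bundle\<close>

lemma finite_dimensional_fd_normed_algebra:
  fixes A :: "(complex, 'a::real_normed_vector) module"
  assumes "fd_normed_algebra A"
  shows "finite_dimensional TYPE('a)"
proof -
  have A: "complex_algebra A" "carrier A = UNIV" "add A = (+)"
    using assms by (auto simp: fd_normed_algebra_def)
  have smult: "complex_of_real r \<odot>\<^bsub>A\<^esub> x = r *\<^sub>R x" for r x
    using assms by (auto simp: fd_normed_algebra_def)
  interpret cring A by (rule complex_algebra_cring[OF A(1)])
  have zero: "\<zero>\<^bsub>A\<^esub> = 0" using r_zero[of 0] A(2,3) by simp
  have finsum: "finsum A g F = sum g F" if "finite F" for g and F :: "nat set"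
    using that by induction (simp_all add: zero finsum_insert A(2,3))
  obtain k where "has_dimension A k" using assms by (auto simp: fd_normed_algebra_def)
  then obtain b where b: "bij_betw (\<lambda>c. \<Oplus>\<^bsub>A\<^esub>i\<in>{1..k}. c i \<odot>\<^bsub>A\<^esub> b i) ({1..k} \<rightarrow>\<^sub>E UNIV) UNIV"
    unfolding has_dimension_def A(2) by blast
  \<comment> \<open>A complex basis together with its multiples by the imaginary unit spans over the
    reals.\<close>
  let ?D = "b ` {1..k} \<union> (\<lambda>i. \<i> \<odot>\<^bsub>A\<^esub> b i) ` {1..k}"
  have summand: "c \<odot>\<^bsub>A\<^esub> b i \<in> span ?D" if i: "i \<in> {1..k}" for c i
  proof -
    have "c \<odot>\<^bsub>A\<^esub> b i = complex_of_real (Re c) \<odot>\<^bsub>A\<^esub> b i + complex_of_real (Im c) \<odot>\<^bsub>A\<^esub> (\<i> \<odot>\<^bsub>A\<^esub> b i)"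
      using complex_algebra_smult(4)[OF A(1), of "b i" "complex_of_real (Re c)" "complex_of_real (Im c) * \<i>"]
        complex_algebra_smult(2)[OF A(1), of "b i" "complex_of_real (Im c)" \<i>] A(2,3) complex_eq[of c]
      by (simp add: mult.commute)
    also have "\<dots> = Re c *\<^sub>R b i + Im c *\<^sub>R (\<i> \<odot>\<^bsub>A\<^esub> b i)" by (simp only: smult)
    also have "\<dots> \<in> span ?D"
      using i by (intro real_vector.span_add real_vector.span_scale real_vector.span_base) blast+
    finally show ?thesis .
  qed
  have "x \<in> span ?D" for x
  proof -
    have "x \<in> (\<lambda>c. \<Oplus>\<^bsub>A\<^esub>i\<in>{1..k}. c i \<odot>\<^bsub>A\<^esub> b i) ` ({1..k} \<rightarrow>\<^sub>E UNIV)"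
      using bij_betw_imp_surj_on[OF b] by simp
    then obtain c where "x = (\<Sum>i\<in>{1..k}. c i \<odot>\<^bsub>A\<^esub> b i)" by (auto simp: finsum)
    then show ?thesis using summand by (auto intro: real_vector.span_sum)
  qed
  then show ?thesis
    unfolding finite_dimensional_def by (intro exI[of _ ?D]) auto
qed

locale smooth_algebra_bundle =
  fixes B :: "('m, 'b::real_normed_vector, 'e, 'c::real_normed_vector,
               'a::real_normed_vector, 'i) bundle_data"
  assumes fibre: "fd_normed_algebra (typical_fibre B)"
    and is_bundle: "algebra_bundle B"
begin

abbreviation "M \<equiv> base_space B"
abbreviation "E \<equiv> total_space B"
abbreviation "\<Gamma> \<equiv> section_alg B"
abbreviation "smooth \<equiv> smooth_fun (base_space B) (points (base_space B))"
abbreviation "openM \<equiv> openin (mtop (base_space B))"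
abbreviation "\<I> \<equiv> index_set B"
abbreviation "A \<equiv> typical_fibre B"
abbreviation "\<phi> \<equiv> bchart B"
abbreviation "over i \<equiv> {e \<in> points (total_space B). proj B e \<in> patch B i}"
abbreviation "product_chart i \<equiv> prod_manifold (open_submanifold (base_space B) (patch B i)) (vector_manifold :: ('a, 'a) manifold_data)"

lemma bundle_conds:
  "smooth_manifold M" "smooth_manifold E" "smooth_map E M (proj B)"
  "\<forall>m\<in>points M. complex_algebra (fibre_at B m) \<and>
        carrier (fibre_at B m) = {e \<in> points E. proj B e = m}"
  "(\<Union>i\<in>\<I>. patch B i) = points M"
  "\<forall>i\<in>\<I>. openM (patch B i) \<and>
        diffeomorphism (prod_manifold (open_submanifold M (patch B i)) vector_manifold)
          (open_submanifold E (over i)) (\<phi> i) \<and>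
        (\<forall>x\<in>patch B i. (\<forall>a. proj B (\<phi> i (x, a)) = x) \<and> (\<lambda>a. \<phi> i (x, a)) \<in> alg_iso A (fibre_at B x))"
  using is_bundle unfolding algebra_bundle_def by - (elim conjE, assumption)+

sublocale M: smooth_mfd M by unfold_locales (rule bundle_conds(1))
sublocale E: smooth_mfd E by unfold_locales (rule bundle_conds(2))

lemma A: "complex_algebra A" "carrier A = UNIV" "add A = (+)"
    "complex_of_real r \<odot>\<^bsub>A\<^esub> x = r *\<^sub>R x"
  using fibre by (auto simp: fd_normed_algebra_def)

sublocale A: cring A by (rule complex_algebra_cring[OF A(1)])

lemma zero_A: "\<zero>\<^bsub>A\<^esub> = 0" using A.r_zero[of 0] A(2,3) by simp

lemma fdA: "finite_dimensional TYPE('a)"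
  by (rule finite_dimensional_fd_normed_algebra[OF fibre])

lemma smult_scaleR: "c \<odot>\<^bsub>A\<^esub> (r *\<^sub>R x) = r *\<^sub>R (c \<odot>\<^bsub>A\<^esub> x)" "(r *\<^sub>R c) \<odot>\<^bsub>A\<^esub> x = r *\<^sub>R (c \<odot>\<^bsub>A\<^esub> x)"
  using complex_algebra_smult(2)[OF A(1)] A(2)
  by (simp_all add: A(4)[symmetric] mult.commute scaleR_conv_of_real)

text \<open>Boundedness is automatic in finite dimension; it admits the fibre operations to the
  calculus of smooth functions. Both factors are regarded as real vector spaces.\<close>

lemma bounded_bilinear_smult: "bounded_bilinear (smult A)"
proof (rule finite_dimensional_imp_bounded_bilinear[OF finite_dimensional_complex fdA])
  show "linear (smult A c)" for c
    using complex_algebra_smult_add(1)[OF A(1)] A(2,3) by (intro linearI) (simp_all add: smult_scaleR)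
  show "linear (\<lambda>c. c \<odot>\<^bsub>A\<^esub> x)" for x
    using complex_algebra_smult(4)[OF A(1)] A(2,3) by (intro linearI) (simp_all add: smult_scaleR)
qed

lemma bounded_bilinear_mult_A: "bounded_bilinear (mult A)"
proof (rule finite_dimensional_imp_bounded_bilinear[OF fdA fdA])
  show "linear (mult A x)" for x
    using complex_algebra_smult_add(3)[OF A(1), of x] A.r_distr A(2,3)
    by (intro linearI) (simp_all add: A(4)[symmetric])
  show "linear (\<lambda>x. x \<otimes>\<^bsub>A\<^esub> y)" for y
    using complex_algebra_smult_add(2)[OF A(1), of _ y] A.l_distr A(2,3)
    by (intro linearI) (simp_all add: A(4)[symmetric])
qed

lemma patch: "i \<in> \<I> \<Longrightarrow> openM (patch B i)"
    "i \<in> \<I> \<Longrightarrow> patch B i \<subseteq> points M"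
  using bspec[OF bundle_conds(6), of i] openin_subset[of "mtop M" "patch B i"] by auto

lemma patch_at:
  assumes "m \<in> points M"
  obtains i where "i \<in> \<I>" "m \<in> patch B i"
  using assms bundle_conds(5) by blast

lemma fibre_at: "m \<in> points M \<Longrightarrow> complex_algebra (fibre_at B m)"
    "m \<in> points M \<Longrightarrow> carrier (fibre_at B m) = {e \<in> points E. proj B e = m}"
  using bspec[OF bundle_conds(4), of m] by auto

lemma bchart_iso:
  assumes "i \<in> \<I>" "x \<in> patch B i"
  shows "(\<lambda>a. \<phi> i (x, a)) \<in> alg_iso A (fibre_at B x)"
  using bspec[OF bundle_conds(6) assms(1)] assms(2) by auto

lemma bchart_diffeo:
  assumes "i \<in> \<I>"
  shows "bij_betw (\<phi> i) (patch B i \<times> UNIV) (over i)"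
    "smooth_map (product_chart i)
       (open_submanifold E (over i)) (\<phi> i)"
    "smooth_map (open_submanifold E (over i))
       (product_chart i)
       (inv_into (patch B i \<times> UNIV) (\<phi> i))"
proof -
  have d: "diffeomorphism (product_chart i)
          (open_submanifold E (over i)) (\<phi> i)"
    using bspec[OF bundle_conds(6) assms] by blast
  have p: "points (product_chart i)
      = patch B i \<times> UNIV"
    using patch(2)[OF assms] by (auto simp: prod_manifold_def open_submanifold_def vector_manifold_def)
  have q: "points (open_submanifold E (over i)) = over i"
    by (auto simp: open_submanifold_def)
  show "bij_betw (\<phi> i) (patch B i \<times> UNIV) (over i)"
    "smooth_map (product_chart i)
       (open_submanifold E (over i)) (\<phi> i)"
    "smooth_map (open_submanifold E (over i))
       (product_chart i)
       (inv_into (patch B i \<times> UNIV) (\<phi> i))"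
    using d unfolding diffeomorphism_def p q by auto
qed

text \<open>Meaningful only for points over \<open>patch B i\<close>. Smoothness and the algebra of
  sections are reduced to these vector valued functions.\<close>

definition cvec :: "'i \<Rightarrow> 'e \<Rightarrow> 'a" where
  "cvec i e = snd (inv_into (patch B i \<times> UNIV) (\<phi> i) e)"

lemma inv_bchart:
  assumes "i \<in> \<I>" "x \<in> patch B i"
  shows "inv_into (patch B i \<times> UNIV) (\<phi> i) (\<phi> i (x, a)) = (x, a)"
  by (rule inv_into_f_f[OF bij_betw_imp_inj_on[OF bchart_diffeo(1)[OF assms(1)]]]) (use assms(2) in simp)

lemma cvec_bchart: "i \<in> \<I> \<Longrightarrow> x \<in> patch B i \<Longrightarrow> cvec i (\<phi> i (x, a)) = a"
  by (simp add: cvec_def inv_bchart)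

lemma bchart_in:
  assumes "i \<in> \<I>" "x \<in> patch B i"
  shows "\<phi> i (x, a) \<in> carrier (fibre_at B x)"
  using alg_homD(1)[OF alg_isoD(1)[OF bchart_iso[OF assms]]] A(2) by simp

lemma fibre_element:
  assumes "i \<in> \<I>" "x \<in> patch B i" "e \<in> carrier (fibre_at B x)"
  obtains a where "e = \<phi> i (x, a)"
proof -
  have "e \<in> (\<lambda>a. \<phi> i (x, a)) ` carrier A"
    using bij_betw_imp_surj_on[OF alg_isoD(2)[OF bchart_iso[OF assms(1,2)]]] assms(3) by simp
  with that show thesis by blast
qed

lemma bchart_vec:
  assumes "i \<in> \<I>" "x \<in> patch B i" "e \<in> carrier (fibre_at B x)"
  shows "\<phi> i (x, cvec i e) = e"
proof -
  obtain a where "e = \<phi> i (x, a)" using fibre_element[OF assms] .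
  then show ?thesis by (simp add: cvec_bchart[OF assms(1,2)])
qed

lemma cvec_hom:
  assumes "i \<in> \<I>" "x \<in> patch B i" "e \<in> carrier (fibre_at B x)"
  shows "cvec i (c \<odot>\<^bsub>fibre_at B x\<^esub> e) = c \<odot>\<^bsub>A\<^esub> cvec i e"
    "e' \<in> carrier (fibre_at B x) \<Longrightarrow> cvec i (e \<oplus>\<^bsub>fibre_at B x\<^esub> e') = cvec i e + cvec i e'"
    "e' \<in> carrier (fibre_at B x) \<Longrightarrow> cvec i (e \<otimes>\<^bsub>fibre_at B x\<^esub> e') = cvec i e \<otimes>\<^bsub>A\<^esub> cvec i e'"
proof -
  note hom = alg_homD(2-4)[OF alg_isoD(1)[OF bchart_iso[OF assms(1,2)]], unfolded A(2,3), OF UNIV_I]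
  note v = cvec_bchart[OF assms(1,2)]
  obtain a where a: "e = \<phi> i (x, a)" using fibre_element[OF assms] .
  show "cvec i (c \<odot>\<^bsub>fibre_at B x\<^esub> e) = c \<odot>\<^bsub>A\<^esub> cvec i e"
    unfolding a hom(1)[symmetric] v ..
  assume "e' \<in> carrier (fibre_at B x)"
  then obtain a' where a': "e' = \<phi> i (x, a')" by (rule fibre_element[OF assms(1,2)])
  show "cvec i (e \<oplus>\<^bsub>fibre_at B x\<^esub> e') = cvec i e + cvec i e'"
    unfolding a a' hom(2)[OF UNIV_I, symmetric] v ..
  show "cvec i (e \<otimes>\<^bsub>fibre_at B x\<^esub> e') = cvec i e \<otimes>\<^bsub>A\<^esub> cvec i e'"
    unfolding a a' hom(3)[OF UNIV_I, symmetric] v ..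
qed

lemma cvec_zero:
  assumes "i \<in> \<I>" "x \<in> patch B i"
  shows "cvec i \<zero>\<^bsub>fibre_at B x\<^esub> = 0"
  using alg_hom_zero[OF A(1) fibre_at(1) alg_isoD(1)[OF bchart_iso[OF assms]]] patch(2)[OF assms(1)] assms(2)
    cvec_bchart[OF assms, of 0] zero_A by auto

lemma cvec_one:
  assumes "i \<in> \<I>" "x \<in> patch B i"
  shows "cvec i \<one>\<^bsub>fibre_at B x\<^esub> = \<one>\<^bsub>A\<^esub>"
  using alg_iso_one[OF A(1) fibre_at(1) bchart_iso[OF assms]] patch(2)[OF assms(1)] assms(2)
    cvec_bchart[OF assms, of "\<one>\<^bsub>A\<^esub>"] by auto

lemma cvec_inject:
  assumes "i \<in> \<I>" "x \<in> patch B i" "e \<in> carrier (fibre_at B x)" "e' \<in> carrier (fibre_at B x)"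
    "cvec i e = cvec i e'"
  shows "e = e'"
  by (subst bchart_vec[OF assms(1-3), symmetric], subst bchart_vec[OF assms(1,2,4), symmetric])
     (simp only: assms(5))

lemma section_fibre:
  assumes "s \<in> carrier \<Gamma>" "m \<in> points M"
  shows "s m \<in> carrier (fibre_at B m)"
proof -
  have "smooth_map M E s" "proj B (s m) = m"
    using assms by (auto simp: section_alg_def Let_def)
  then have "continuous_map (mtop M) (mtop E) s" by (simp add: smooth_map_def)
  then have "s m \<in> points E" using assms(2) by (auto simp: continuous_map_def)
  with \<open>proj B (s m) = m\<close> show ?thesis using fibre_at(2)[OF assms(2)] by simp
qed

lemma over_open:
  assumes "openM W"
  shows "openin (mtop E) {e \<in> points E. proj B e \<in> W}"
  using bundle_conds(3) assms openin_continuous_map_preimage unfolding smooth_map_def by blast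

text \<open>In charts this is the inverse bundle chart after \<open>s\<close>. The base is first
  shrunk to a neighbourhood on which \<open>s\<close> stays in one chart \<open>(V, d)\<close> of
  the total space.\<close>

lemma smooth_section_vec:
  assumes s: "s \<in> carrier \<Gamma>" and i: "i \<in> \<I>"
  shows "smooth_fun M (patch B i) (\<lambda>x. cvec i (s x))"
proof (rule smooth_funI)
  fix U c assume c: "(U, c) \<in> atlas M"
  have ss: "smooth_map M E s" using s by (auto simp: section_alg_def Let_def)
  show "smooth_on (c ` (U \<inter> patch B i)) (\<lambda>v. cvec i (s (inv_into U c v)))"
  proof (rule smooth_on_local)
    fix v assume "v \<in> c ` (U \<inter> patch B i)"
    then obtain x where x: "x \<in> U" "x \<in> patch B i" "v = c x" by blast
    have xP: "x \<in> points M" using x patch(2)[OF i] by blast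
    have "s x \<in> points E" using section_fibre[OF s xP] fibre_at(2)[OF xP] by simp
    then obtain V d where d: "(V, d) \<in> atlas E" "s x \<in> V" by (rule E.chart_at)
    let ?V = "V \<inter> over i"
    let ?inv = "inv_into (patch B i \<times> UNIV) (\<phi> i)"
    define D where "D = d ` (V \<inter> {e \<in> points E. proj B e \<in> U \<inter> patch B i})"
    define W where "W = U \<inter> patch B i \<inter> {y \<in> points M. s y \<in> V}"
    have "openM {y \<in> points M. s y \<in> V}"
      using ss E.chart(1)[OF d(1)] openin_continuous_map_preimage unfolding smooth_map_def by blast
    then have W: "openM W"
      unfolding W_def by (intro openin_Int M.chart(1)[OF c] patch(1)[OF i])
    have oD: "open D"
      unfolding D_def
      by (intro E.open_chart_image[OF d(1)] over_open openin_Int M.chart(1)[OF c] patch(1)[OF i])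
    have in_W: "s y \<in> V" "s y \<in> points E" "proj B (s y) = y" "y \<in> U" "y \<in> patch B i" if "y \<in> W" for y
      using that section_fibre[OF s, of y] fibre_at(2)[of y] by (auto simp: W_def)
    \<comment> \<open>\<open>D\<close> is needed in two shapes: as the chart image of an open set,
      which shows that it is open, and as the domain on which \<open>smooth_map\<close> speaks about
      the inverse bundle chart.\<close>
    have D: "D = d ` {e \<in> ?V. ?inv e \<in> (U \<inter> patch B i) \<times> UNIV}"
    proof -
      have iff: "?inv e \<in> (U \<inter> patch B i) \<times> UNIV \<longleftrightarrow> proj B e \<in> U"
        if e: "e \<in> over i" for e
      proof -
        have "proj B e \<in> patch B i" "e \<in> carrier (fibre_at B (proj B e))"
          using e patch(2)[OF i] by (auto simp: fibre_at(2))
        then show ?thesis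
          using inv_bchart[OF i] fibre_element[OF i, of "proj B e" e] by (metis Int_iff UNIV_I mem_Sigma_iff)
      qed
      have "V \<inter> {e \<in> points E. proj B e \<in> U \<inter> patch B i} = {e \<in> ?V. ?inv e \<in> (U \<inter> patch B i) \<times> UNIV}"
      proof (rule Set.set_eqI)
        fix e
        show "e \<in> V \<inter> {e \<in> points E. proj B e \<in> U \<inter> patch B i} \<longleftrightarrow>
            e \<in> {e \<in> ?V. ?inv e \<in> (U \<inter> patch B i) \<times> UNIV}"
        proof (cases "e \<in> over i")
          case True
          show ?thesis unfolding mem_Collect_eq iff[OF True] using True by simp
        next
          case False
          then show ?thesis by blast
        qed
      qed
      then show ?thesis unfolding D_def by (simp only:)
    qed
    have "(V \<inter> over i, d) \<in> atlas (open_submanifold E (over i))"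
      using d(1) by (force simp: open_submanifold_def)
    moreover have "((U \<inter> patch B i) \<times> UNIV, map_prod c id) \<in>
        atlas (product_chart i)"
      using c by (force simp: prod_manifold_def open_submanifold_def vector_manifold_def)
    ultimately have "smooth_on D (map_prod c id \<circ> ?inv \<circ> inv_into ?V d)"
      using bchart_diffeo(3)[OF i] unfolding smooth_map_def D by fast
    then have G: "smooth_on D (\<lambda>w. snd ((map_prod c id \<circ> ?inv \<circ> inv_into ?V d) w))"
      by (rule smooth_on_bounded_linear_comp[OF bounded_linear_snd oD])
    have oT: "open (c ` (U \<inter> W))" by (rule M.open_chart_image[OF c W])
    have "smooth_on (c ` {x \<in> U. s x \<in> V}) (d \<circ> s \<circ> inv_into U c)"
      using ss c d(1) unfolding smooth_map_def by fast
    then have F: "smooth_on (c ` (U \<inter> W)) (d \<circ> s \<circ> inv_into U c)"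
      by (rule smooth_on_subset) (auto simp: W_def)
    have val: "inv_into U c (c y) = y" if "y \<in> W" for y
      using M.chart(5)[OF c] in_W(4)[OF that] by simp
    have "(d \<circ> s \<circ> inv_into U c) ` (c ` (U \<inter> W)) \<subseteq> D"
    proof clarify
      fix y assume y: "y \<in> U" "y \<in> W"
      show "(d \<circ> s \<circ> inv_into U c) (c y) \<in> D"
        unfolding D_def o_def val[OF y(2)] using in_W[OF y(2)] by auto
    qed
    then have "smooth_on (c ` (U \<inter> W))
        (\<lambda>v. snd ((map_prod c id \<circ> ?inv \<circ> inv_into ?V d) ((d \<circ> s \<circ> inv_into U c) v)))"
      by (rule smooth_on_compose[OF E.fd oT oD _ F G])
    moreover have "cvec i (s (inv_into U c v)) =
        snd ((map_prod c id \<circ> ?inv \<circ> inv_into ?V d) ((d \<circ> s \<circ> inv_into U c) v))"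
      if "v \<in> c ` (U \<inter> W)" for v
    proof -
      obtain y where y: "v = c y" "y \<in> W" using \<open>v \<in> c ` (U \<inter> W)\<close> by blast
      have "inv_into ?V d (d (s y)) = s y"
        using in_W[OF y(2)] by (intro inv_into_f_f inj_on_subset[OF E.chart(5)[OF d(1)]]) auto
      then show ?thesis by (simp add: y(1) val[OF y(2)] cvec_def)
    qed
    moreover have "v \<in> c ` (U \<inter> W)" using x d(2) xP by (auto simp: W_def)
    ultimately show "\<exists>T g. open T \<and> v \<in> T \<and> smooth_on T g \<and> (\<forall>y\<in>T. cvec i (s (inv_into U c y)) = g y)"
      using oT by (intro exI[of _ "c ` (U \<inter> W)"] exI conjI ballI) assumption+
  qed
qed

text \<open>Made for \<open>sectionI\<close>: the box yields continuity there and, with a chart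
  domain for \<open>T\<close>, an open set on which the chain rule can be applied.\<close>

lemma bchart_box:
  assumes i: "i \<in> \<I>" and T: "openin (mtop E) T" and x: "x \<in> patch B i" "\<phi> i (x, a) \<in> T"
  obtains W1 W2 where "openM W1" "x \<in> W1" "W1 \<subseteq> patch B i" "open W2" "a \<in> W2"
    "\<And>y b. y \<in> W1 \<Longrightarrow> b \<in> W2 \<Longrightarrow> \<phi> i (y, b) \<in> T"
proof -
  let ?X = "prod_topology (subtopology (mtop M) (patch B i)) (euclidean :: 'a topology)"
  have "continuous_map ?X (subtopology (mtop E) (over i)) (\<phi> i)"
    using bchart_diffeo(2)[OF i]
    by (simp add: smooth_map_def prod_manifold_def open_submanifold_def vector_manifold_def)
  then have "continuous_map ?X (mtop E) (\<phi> i)" by (simp add: continuous_map_in_subtopology)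
  then have "openin ?X {z \<in> topspace ?X. \<phi> i z \<in> T}"
    by (rule openin_continuous_map_preimage[OF _ T])
  moreover have "(x, a) \<in> {z \<in> topspace ?X. \<phi> i z \<in> T}"
    using x patch(2)[OF i] by auto
  ultimately have "\<exists>W1 W2. openin (subtopology (mtop M) (patch B i)) W1 \<and> openin euclidean W2 \<and>
      x \<in> W1 \<and> a \<in> W2 \<and> W1 \<times> W2 \<subseteq> {z \<in> topspace ?X. \<phi> i z \<in> T}"
    unfolding openin_prod_topology_alt by blast
  then obtain W1 W2 where W: "openin (subtopology (mtop M) (patch B i)) W1" "open W2"
    "x \<in> W1" "a \<in> W2" "W1 \<times> W2 \<subseteq> {z \<in> topspace ?X. \<phi> i z \<in> T}"
    unfolding open_openin[symmetric] by blast
  have "openM W1" "W1 \<subseteq> patch B i"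
    using W(1) openin_open_subtopology[OF patch(1)[OF i]] by auto
  with W show thesis by (intro that[of W1 W2]) auto
qed

text \<open>Converse of \<open>smooth_section_vec\<close>: near each point \<open>s\<close> is a
  bundle chart applied to the base point and its local vector, hence smooth because bundle charts
  are. The bundle chart may vary with the point, and continuity into the total space is part of what
  is derived.\<close>

lemma sectionI:
  assumes ext: "s \<in> extensional (points M)"
    and fib: "\<And>m. m \<in> points M \<Longrightarrow> s m \<in> carrier (fibre_at B m)"
    and loc: "\<And>m. m \<in> points M \<Longrightarrow> \<exists>i\<in>\<I>. \<exists>W. openM W \<and> m \<in> W \<and> W \<subseteq> patch B i \<and>
        smooth_fun M W (\<lambda>x. cvec i (s x))"
  shows "s \<in> carrier \<Gamma>"
proof -
  have box: "\<exists>i W1 W2 W. i \<in> \<I> \<and> openM W1 \<and> open W2 \<and> openM W \<and> x \<in> W \<and>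
      W \<subseteq> W1 \<and> W1 \<subseteq> patch B i \<and> (\<forall>y\<in>W1. \<forall>b\<in>W2. \<phi> i (y, b) \<in> T) \<and>
      smooth_fun M W (\<lambda>x. cvec i (s x)) \<and> (\<forall>y\<in>W. cvec i (s y) \<in> W2 \<and> \<phi> i (y, cvec i (s y)) = s y)"
    if T: "openin (mtop E) T" and x: "x \<in> points M" "s x \<in> T" for T x
  proof -
    obtain i W where W: "i \<in> \<I>" "openM W" "x \<in> W" "W \<subseteq> patch B i"
        "smooth_fun M W (\<lambda>x. cvec i (s x))"
      using loc[OF x(1)] by blast
    have xi: "x \<in> patch B i" using W by blast
    have eq: "\<phi> i (y, cvec i (s y)) = s y" if "y \<in> patch B i" for y
      using bchart_vec[OF W(1) that] fib[of y] patch(2)[OF W(1)] that by blast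
    obtain W1 W2 where b: "openM W1" "x \<in> W1" "W1 \<subseteq> patch B i" "open W2" "cvec i (s x) \<in> W2"
      "\<And>y b. y \<in> W1 \<Longrightarrow> b \<in> W2 \<Longrightarrow> \<phi> i (y, b) \<in> T"
      by (rule bchart_box[OF W(1) T xi, of "cvec i (s x)"]) (use eq[OF xi] x(2) in simp_all)
    let ?W = "W1 \<inter> {y \<in> W. cvec i (s y) \<in> W2}"
    have "openin (subtopology (mtop M) W) {y \<in> topspace (subtopology (mtop M) W). cvec i (s y) \<in> W2}"
      using M.smooth_fun_imp_continuous[OF W(2,5)] b(4) by (intro openin_continuous_map_preimage) auto
    moreover have "{y \<in> topspace (subtopology (mtop M) W). cvec i (s y) \<in> W2} = {y \<in> W. cvec i (s y) \<in> W2}"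
      using openin_subset[OF W(2)] by auto
    ultimately have "openM {y \<in> W. cvec i (s y) \<in> W2}"
      using openin_open_subtopology[OF W(2)] by auto
    then have oW: "openM ?W" by (rule openin_Int[OF b(1)])
    show ?thesis
    proof (rule exI[of _ i], rule exI[of _ W1], rule exI[of _ W2], rule exI[of _ ?W], intro conjI)
      show "smooth_fun M ?W (\<lambda>x. cvec i (s x))" by (rule M.smooth_fun_subset[OF W(5)]) blast
      show "\<forall>y\<in>?W. cvec i (s y) \<in> W2 \<and> \<phi> i (y, cvec i (s y)) = s y"
        using eq b(3) by blast
      show "\<forall>y\<in>W1. \<forall>b\<in>W2. \<phi> i (y, b) \<in> T" by (intro ballI b(6))
      show "x \<in> ?W" using b(2,5) W(3) by simp
      show "?W \<subseteq> W1" by (rule Int_lower1)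
    qed (rule W(1) b(1) b(4) oW b(3))+
  qed
  have cont: "continuous_map (mtop M) (mtop E) s"
    unfolding continuous_map_def
  proof (intro conjI allI impI)
    show "s \<in> points M \<rightarrow> points E" using fib by (auto simp: fibre_at(2))
    fix T assume T: "openin (mtop E) T"
    show "openM {x \<in> points M. s x \<in> T}"
    proof (subst openin_subopen, rule ballI)
      fix x assume "x \<in> {x \<in> points M. s x \<in> T}"
      then obtain i W1 W2 W where w: "openM W" "x \<in> W" "W \<subseteq> W1"
        "\<forall>y\<in>W1. \<forall>b\<in>W2. \<phi> i (y, b) \<in> T" "\<forall>y\<in>W. cvec i (s y) \<in> W2 \<and> \<phi> i (y, cvec i (s y)) = s y"
        using box[OF T, of x] by blast
      have "W \<subseteq> {x \<in> points M. s x \<in> T}"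
      proof
        fix y assume y: "y \<in> W"
        have "\<phi> i (y, cvec i (s y)) \<in> T" using w(3-5) y by blast
        then show "y \<in> {x \<in> points M. s x \<in> T}"
          using w(5) y openin_subset[OF w(1)] by auto
      qed
      with w show "\<exists>S. openM S \<and> x \<in> S \<and> S \<subseteq> {x \<in> points M. s x \<in> T}" by blast
    qed
  qed
  have smooth: "smooth_on (c ` {x \<in> U. s x \<in> V}) (d \<circ> s \<circ> inv_into U c)"
    if c: "(U, c) \<in> atlas M" and d: "(V, d) \<in> atlas E" for U c V d
  proof (rule smooth_on_local)
    fix v assume "v \<in> c ` {x \<in> U. s x \<in> V}"
    then obtain x where x: "x \<in> U" "s x \<in> V" "v = c x" by blast
    have xP: "x \<in> points M" using x(1) M.chart(4)[OF c] by blast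
    obtain i W1 W2 W where w: "i \<in> \<I>" "openM W1" "open W2" "openM W" "x \<in> W"
      "W \<subseteq> W1" "W1 \<subseteq> patch B i" "\<forall>y\<in>W1. \<forall>b\<in>W2. \<phi> i (y, b) \<in> V"
      "smooth_fun M W (\<lambda>x. cvec i (s x))" "\<forall>y\<in>W. cvec i (s y) \<in> W2 \<and> \<phi> i (y, cvec i (s y)) = s y"
      using box[OF E.chart(1)[OF d] xP x(2)] by blast
    let ?V = "V \<inter> over i" and ?UA = "(U \<inter> patch B i) \<times> (UNIV :: 'a set)"
    let ?G = "d \<circ> \<phi> i \<circ> inv_into ?UA (map_prod c id)"
    \<comment> \<open>In coordinates \<open>s\<close> is \<open>?G\<close> after \<open>h\<close>:
      \<open>h\<close> adjoins the local vector to the base coordinate, and \<open>?G\<close> is the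
      bundle chart read in charts.\<close>
    define h where "h v = (v, cvec i (s (inv_into U c v)))" for v
    have "(?V, d) \<in> atlas (open_submanifold E (over i))"
      using d by (force simp: open_submanifold_def)
    moreover have "(?UA, map_prod c id) \<in>
        atlas (product_chart i)"
      using c by (force simp: prod_manifold_def open_submanifold_def vector_manifold_def)
    ultimately have G: "smooth_on (map_prod c id ` {z \<in> ?UA. \<phi> i z \<in> ?V}) ?G"
      using bchart_diffeo(2)[OF w(1)] unfolding smooth_map_def by fast
    have box_sub: "c ` (U \<inter> W1) \<times> W2 \<subseteq> map_prod c id ` {z \<in> ?UA. \<phi> i z \<in> ?V}"
    proof clarify
      fix y b assume y: "y \<in> U" "y \<in> W1" "b \<in> W2"
      have yi: "y \<in> patch B i" using y(2) w(7) by blast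
      then have "\<phi> i (y, b) \<in> over i"
        using bchart_in[OF w(1) yi] fibre_at(2)[of y] patch(2)[OF w(1)] by auto
      then have "(y, b) \<in> {z \<in> ?UA. \<phi> i z \<in> ?V}" using y yi w(8) by blast
      then have "map_prod c id (y, b) \<in> map_prod c id ` {z \<in> ?UA. \<phi> i z \<in> ?V}" by (rule imageI)
      then show "(c y, b) \<in> map_prod c id ` {z \<in> ?UA. \<phi> i z \<in> ?V}" by simp
    qed
    have oT: "open (c ` (U \<inter> W))" "open (c ` (U \<inter> W1) \<times> W2)"
      by (intro open_Times M.open_chart_image[OF c] w(2,3,4))+
    have h: "smooth_on (c ` (U \<inter> W)) h"
      unfolding h_def by (intro smooth_on_Pair smooth_on_ident oT(1) smooth_funD[OF w(9) c])
    have h_sub: "h ` (c ` (U \<inter> W)) \<subseteq> c ` (U \<inter> W1) \<times> W2"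
    proof clarify
      fix y a b assume y: "y \<in> U" "y \<in> W" "(a, b) = h (c y)"
      have "inv_into U c (c y) = y" using M.chart(5)[OF c] y(1) by simp
      then show "a \<in> c ` (U \<inter> W1) \<and> b \<in> W2" using y w(6,10) by (auto simp: h_def)
    qed
    have "smooth_on (c ` (U \<inter> W)) (\<lambda>v. ?G (h v))"
      by (rule smooth_on_compose[OF finite_dimensional_prod[OF M.fd fdA] oT h_sub h smooth_on_subset[OF G box_sub]])
    moreover have "(d \<circ> s \<circ> inv_into U c) v = ?G (h v)" if "v \<in> c ` (U \<inter> W)" for v
    proof -
      obtain y where y: "v = c y" "y \<in> U" "y \<in> W" using \<open>v \<in> c ` (U \<inter> W)\<close> by blast
      have iv: "inv_into U c (c y) = y" using M.chart(5)[OF c] y(2) by simp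
      have "inj_on (map_prod c id) ?UA"
        using M.chart(5)[OF c] by (auto simp: inj_on_def)
      then have "inv_into ?UA (map_prod c id) (map_prod c id (y, cvec i (s y))) = (y, cvec i (s y))"
        by (rule inv_into_f_f) (use y w(6,7) in blast)
      then show ?thesis using y w(10) by (simp add: h_def iv)
    qed
    moreover have "v \<in> c ` (U \<inter> W)" using x w(5) by blast
    ultimately show "\<exists>T g. open T \<and> v \<in> T \<and> smooth_on T g \<and> (\<forall>y\<in>T. (d \<circ> s \<circ> inv_into U c) y = g y)"
      using oT(1) by (intro exI[of _ "c ` (U \<inter> W)"] exI conjI ballI) assumption+
  qed
  have "smooth_map M E s"
    unfolding smooth_map_def by (intro conjI cont, clarify, rule smooth)
  moreover have "proj B (s m) = m" if "m \<in> points M" for m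
    using fib[OF that] fibre_at(2)[OF that] by simp
  ultimately show ?thesis using ext by (simp add: section_alg_def Let_def)
qed

end

section \<open>Characters of the algebra of sections\<close>

lemma complex_algebra_smult_zero:
  assumes "complex_algebra B"
  shows "c \<odot>\<^bsub>B\<^esub> \<zero>\<^bsub>B\<^esub> = \<zero>\<^bsub>B\<^esub>"
proof -
  interpret B: cring B by (rule complex_algebra_cring[OF assms])
  show ?thesis
    using complex_algebra_smult(2)[OF assms B.zero_closed, of c 0] complex_algebra_smult(5)[OF assms B.zero_closed]
    by simp
qed

context smooth_algebra_bundle
begin

lemma openP: "openM (points M)" by simp

lemma fibre_cring: "m \<in> points M \<Longrightarrow> cring (fibre_at B m)"
  by (rule complex_algebra_cring[OF fibre_at(1)])

definition fmul :: "('m \<Rightarrow> complex) \<Rightarrow> ('m \<Rightarrow> 'e) \<Rightarrow> 'm \<Rightarrow> 'e" where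
  "fmul f s = (\<lambda>m\<in>points M. f m \<odot>\<^bsub>fibre_at B m\<^esub> s m)"

text \<open>Extension by 0 from a patch. Smoothness across the boundary of the patch is guaranteed
  when \<open>F\<close> vanishes off a closed set inside the patch, see
  \<open>glue_closed\<close>.\<close>

definition glue :: "'i \<Rightarrow> ('m \<Rightarrow> 'a) \<Rightarrow> 'm \<Rightarrow> 'e" where
  "glue i F = (\<lambda>m\<in>points M. if m \<in> patch B i then \<phi> i (m, F m) else \<zero>\<^bsub>fibre_at B m\<^esub>)"

lemma section_ops:
  assumes "m \<in> points M"
  shows "(s \<otimes>\<^bsub>\<Gamma>\<^esub> t) m = s m \<otimes>\<^bsub>fibre_at B m\<^esub> t m"
    "(s \<oplus>\<^bsub>\<Gamma>\<^esub> t) m = s m \<oplus>\<^bsub>fibre_at B m\<^esub> t m"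
    "(c \<odot>\<^bsub>\<Gamma>\<^esub> s) m = c \<odot>\<^bsub>fibre_at B m\<^esub> s m"
    "\<one>\<^bsub>\<Gamma>\<^esub> m = \<one>\<^bsub>fibre_at B m\<^esub>"
    "fmul f s m = f m \<odot>\<^bsub>fibre_at B m\<^esub> s m"
  using assms by (simp_all add: section_alg_def Let_def fmul_def)

lemma section_ext: "s \<in> carrier \<Gamma> \<Longrightarrow> s \<in> extensional (points M)"
  by (simp add: section_alg_def Let_def)

lemma sectionI_global:
  assumes "s \<in> extensional (points M)"
    and fib: "\<And>m. m \<in> points M \<Longrightarrow> s m \<in> carrier (fibre_at B m)"
    and loc: "\<And>i. i \<in> \<I> \<Longrightarrow> smooth_fun M (patch B i) (F i)"
    and eq: "\<And>i m. i \<in> \<I> \<Longrightarrow> m \<in> patch B i \<Longrightarrow> cvec i (s m) = F i m"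
  shows "s \<in> carrier \<Gamma>"
proof (rule sectionI[OF assms(1) fib])
  fix m assume "m \<in> points M"
  then obtain i where i: "i \<in> \<I>" "m \<in> patch B i" by (rule patch_at)
  have "smooth_fun M (patch B i) (\<lambda>x. cvec i (s x))"
    by (rule M.smooth_fun_cong[OF patch(1)[OF i(1)] loc[OF i(1)] eq[OF i(1)]])
  then show "\<exists>i\<in>\<I>. \<exists>W. openM W \<and> m \<in> W \<and> W \<subseteq> patch B i \<and> smooth_fun M W (\<lambda>x. cvec i (s x))"
    using i patch(1)[OF i(1)] by blast
qed

lemma patch_point: "i \<in> \<I> \<Longrightarrow> m \<in> patch B i \<Longrightarrow> m \<in> points M"
  using patch(2) by blast

lemma section_mult_closed:
  assumes "s \<in> carrier \<Gamma>" "t \<in> carrier \<Gamma>"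
  shows "s \<otimes>\<^bsub>\<Gamma>\<^esub> t \<in> carrier \<Gamma>"
proof (rule sectionI_global)
  show "s \<otimes>\<^bsub>\<Gamma>\<^esub> t \<in> extensional (points M)" by (simp add: section_alg_def Let_def)
  show "(s \<otimes>\<^bsub>\<Gamma>\<^esub> t) m \<in> carrier (fibre_at B m)" if "m \<in> points M" for m
    using cring.cring_simprules(5)[OF fibre_cring[OF that] section_fibre[OF assms(1) that] section_fibre[OF assms(2) that]]
    by (simp add: section_ops that)
  fix i assume i: "i \<in> \<I>"
  show "smooth_fun M (patch B i) (\<lambda>m. cvec i (s m) \<otimes>\<^bsub>A\<^esub> cvec i (t m))"
    by (rule M.smooth_fun_bilinear[OF bounded_bilinear_mult_A patch(1)[OF i]
          smooth_section_vec[OF assms(1) i] smooth_section_vec[OF assms(2) i]])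
  show "cvec i ((s \<otimes>\<^bsub>\<Gamma>\<^esub> t) m) = cvec i (s m) \<otimes>\<^bsub>A\<^esub> cvec i (t m)" if "m \<in> patch B i" for m
    using patch_point[OF i that] cvec_hom(3)[OF i that] section_fibre assms by (simp add: section_ops)
qed

lemma section_add_closed:
  assumes "s \<in> carrier \<Gamma>" "t \<in> carrier \<Gamma>"
  shows "s \<oplus>\<^bsub>\<Gamma>\<^esub> t \<in> carrier \<Gamma>"
proof (rule sectionI_global)
  show "s \<oplus>\<^bsub>\<Gamma>\<^esub> t \<in> extensional (points M)" by (simp add: section_alg_def Let_def)
  show "(s \<oplus>\<^bsub>\<Gamma>\<^esub> t) m \<in> carrier (fibre_at B m)" if "m \<in> points M" for m
    using cring.cring_simprules(1)[OF fibre_cring[OF that] section_fibre[OF assms(1) that] section_fibre[OF assms(2) that]]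
    by (simp add: section_ops that)
  fix i assume i: "i \<in> \<I>"
  show "smooth_fun M (patch B i) (\<lambda>m. cvec i (s m) + cvec i (t m))"
    by (rule M.smooth_fun_add[OF patch(1)[OF i]
          smooth_section_vec[OF assms(1) i] smooth_section_vec[OF assms(2) i]])
  show "cvec i ((s \<oplus>\<^bsub>\<Gamma>\<^esub> t) m) = cvec i (s m) + cvec i (t m)" if "m \<in> patch B i" for m
    using patch_point[OF i that] cvec_hom(2)[OF i that] section_fibre assms by (simp add: section_ops)
qed

lemma section_fmul_closed:
  assumes "smooth f" "s \<in> carrier \<Gamma>"
  shows "fmul f s \<in> carrier \<Gamma>"
proof (rule sectionI_global)
  show "fmul f s \<in> extensional (points M)" by (simp add: fmul_def)
  show "fmul f s m \<in> carrier (fibre_at B m)" if "m \<in> points M" for m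
    using complex_algebra_smult(1)[OF fibre_at(1)[OF that] section_fibre[OF assms(2) that]]
    by (simp add: section_ops that)
  fix i assume i: "i \<in> \<I>"
  show "smooth_fun M (patch B i) (\<lambda>m. f m \<odot>\<^bsub>A\<^esub> cvec i (s m))"
    by (rule M.smooth_fun_bilinear[OF bounded_bilinear_smult patch(1)[OF i]
          M.smooth_fun_subset[OF assms(1) patch(2)[OF i]] smooth_section_vec[OF assms(2) i]])
  show "cvec i (fmul f s m) = f m \<odot>\<^bsub>A\<^esub> cvec i (s m)" if "m \<in> patch B i" for m
    using patch_point[OF i that] cvec_hom(1)[OF i that] section_fibre assms by (simp add: section_ops)
qed

lemma section_smult_eq_fmul: "c \<odot>\<^bsub>\<Gamma>\<^esub> s = fmul (\<lambda>_. c) s"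
  by (simp add: section_alg_def Let_def fmul_def)

lemma section_smult_closed:
  "s \<in> carrier \<Gamma> \<Longrightarrow> c \<odot>\<^bsub>\<Gamma>\<^esub> s \<in> carrier \<Gamma>"
  unfolding section_smult_eq_fmul by (rule section_fmul_closed[OF M.smooth_fun_const[OF openP]])

lemma section_one_closed: "\<one>\<^bsub>\<Gamma>\<^esub> \<in> carrier \<Gamma>"
proof (rule sectionI_global)
  show "\<one>\<^bsub>\<Gamma>\<^esub> \<in> extensional (points M)" by (simp add: section_alg_def Let_def)
  show "\<one>\<^bsub>\<Gamma>\<^esub> m \<in> carrier (fibre_at B m)" if "m \<in> points M" for m
    using cring.cring_simprules(6)[OF fibre_cring[OF that]] by (simp add: section_ops that)
  fix i assume i: "i \<in> \<I>"
  show "smooth_fun M (patch B i) (\<lambda>m. \<one>\<^bsub>A\<^esub>)"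
    by (rule M.smooth_fun_const[OF patch(1)[OF i]])
  show "cvec i (\<one>\<^bsub>\<Gamma>\<^esub> m) = \<one>\<^bsub>A\<^esub>" if "m \<in> patch B i" for m
    using patch_point[OF i that] cvec_one[OF i that] by (simp add: section_ops)
qed

lemma glue_inside: "i \<in> \<I> \<Longrightarrow> m \<in> patch B i \<Longrightarrow> cvec i (glue i F m) = F m"
  using patch_point by (simp add: glue_def cvec_bchart)

lemma glue_outside: "m \<in> points M \<Longrightarrow> m \<notin> patch B i \<Longrightarrow> glue i F m = \<zero>\<^bsub>fibre_at B m\<^esub>"
  by (simp add: glue_def)

lemma glue_closed:
  assumes i: "i \<in> \<I>" and F: "smooth_fun M (patch B i) F"
    and C: "closedin (mtop M) C" "C \<subseteq> patch B i" "\<And>m. m \<in> patch B i \<Longrightarrow> m \<notin> C \<Longrightarrow> F m = 0"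
  shows "glue i F \<in> carrier \<Gamma>"
proof (rule sectionI)
  show "glue i F \<in> extensional (points M)" by (simp add: glue_def)
  show "glue i F m \<in> carrier (fibre_at B m)" if "m \<in> points M" for m
    using that bchart_in[OF i] cring.cring_simprules(2)[OF fibre_cring[OF that]] by (simp add: glue_def)
  fix m assume m: "m \<in> points M"
  show "\<exists>i'\<in>\<I>. \<exists>W. openM W \<and> m \<in> W \<and> W \<subseteq> patch B i' \<and> smooth_fun M W (\<lambda>x. cvec i' (glue i F x))"
  proof (cases "m \<in> patch B i")
    case True
    have "smooth_fun M (patch B i) (\<lambda>x. cvec i (glue i F x))"
      by (rule M.smooth_fun_cong[OF patch(1)[OF i] F]) (rule glue_inside[OF i])
    then show ?thesis using i True patch(1)[OF i] by blast
  next
    case False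
    obtain j where j: "j \<in> \<I>" "m \<in> patch B j" using m by (rule patch_at)
    \<comment> \<open>\<open>C\<close> is closed in \<open>M\<close>, so this is a neighbourhood of
      \<open>m\<close>. The glued section is 0 on all of it, also where \<open>patch B j\<close>
      meets \<open>patch B i\<close>.\<close>
    let ?W = "patch B j - C"
    have W: "openM ?W" by (rule openin_diff[OF patch(1)[OF j(1)] C(1)])
    have "glue i F x = \<zero>\<^bsub>fibre_at B x\<^esub>" if x: "x \<in> ?W" for x
    proof (cases "x \<in> patch B i")
      case True
      have xP: "x \<in> points M" using patch_point[OF i True] .
      have "cvec i (glue i F x) = cvec i \<zero>\<^bsub>fibre_at B x\<^esub>"
        using C(3)[OF True] x by (simp add: glue_inside[OF i True] cvec_zero[OF i True])
      then show ?thesis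
        using True xP bchart_in[OF i True] cring.cring_simprules(2)[OF fibre_cring[OF xP]]
        by (intro cvec_inject[OF i True]) (simp_all add: glue_def)
    next
      case False
      then show ?thesis using x patch_point[OF j(1)] by (intro glue_outside) auto
    qed
    then have "smooth_fun M ?W (\<lambda>x. cvec j (glue i F x))"
      by (intro M.smooth_fun_cong[OF W M.smooth_fun_const[OF W, of 0]]) (simp add: cvec_zero[OF j(1)])
    moreover have "m \<in> ?W" using False j(2) C(2) by blast
    ultimately show ?thesis using j(1) W by blast
  qed
qed

lemma section_eqI:
  assumes "s \<in> carrier \<Gamma>" "t \<in> carrier \<Gamma>" "i \<in> \<I>"
    "\<And>m. m \<in> patch B i \<Longrightarrow> cvec i (s m) = cvec i (t m)"
    "\<And>m. m \<in> points M \<Longrightarrow> m \<notin> patch B i \<Longrightarrow> s m = t m"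
  shows "s = t"
proof (rule extensionalityI[OF section_ext[OF assms(1)] section_ext[OF assms(2)]])
  fix m assume m: "m \<in> points M"
  show "s m = t m"
  proof (cases "m \<in> patch B i")
    case True
    show ?thesis
      by (rule cvec_inject[OF assms(3) True section_fibre[OF assms(1) m] section_fibre[OF assms(2) m] assms(4)[OF True]])
  qed (rule assms(5)[OF m])
qed

lemma bump_in_patch:
  assumes "openM W" "m \<in> W"
  obtains \<beta> :: "'m \<Rightarrow> real" and C where
    "smooth \<beta>" "closedin (mtop M) C" "C \<subseteq> W" "\<beta> m = 1" "\<And>x. x \<notin> C \<Longrightarrow> \<beta> x = 0"
  using M.smooth_bump_on_manifold[OF assms] by metis

end

section \<open>A character restricted to the smooth functions\<close>

locale section_character = smooth_algebra_bundle B
  for B :: "('m, 'b::real_normed_vector, 'e, 'c::real_normed_vector,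
               'a::real_normed_vector, 'i) bundle_data" +
  fixes \<omega> :: "('m \<Rightarrow> 'e) \<Rightarrow> complex" and s0
  assumes \<omega>: "\<omega> \<in> alg_hom \<Gamma> complex_alg"
    and s0: "s0 \<in> carrier \<Gamma>" "\<omega> s0 \<noteq> 0"
begin

definition lam :: "('m \<Rightarrow> complex) \<Rightarrow> complex" where
  "lam f = \<omega> (fmul f \<one>\<^bsub>\<Gamma>\<^esub>)"

lemmas \<omega>_hom = alg_homD[OF \<omega>, unfolded complex_alg_simps]

text \<open>\<open>fmul f s\<close> is the product of \<open>s\<close> with the
  \<open>f\<close>-multiple of the unit section, so the character turns multiplication by a function
  into multiplication by a number.\<close>

lemma \<omega>_fmul:
  assumes "smooth f" "s \<in> carrier \<Gamma>"
  shows "\<omega> (fmul f s) = lam f * \<omega> s"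
proof -
  have "fmul f \<one>\<^bsub>\<Gamma>\<^esub> \<otimes>\<^bsub>\<Gamma>\<^esub> s = fmul f s"
  proof (rule extensionalityI)
    fix m assume m: "m \<in> points M"
    interpret F: cring "fibre_at B m" by (rule fibre_cring[OF m])
    show "(fmul f \<one>\<^bsub>\<Gamma>\<^esub> \<otimes>\<^bsub>\<Gamma>\<^esub> s) m = fmul f s m"
      using complex_algebra_smult_add(2)[OF fibre_at(1)[OF m] F.one_closed section_fibre[OF assms(2) m]]
        section_fibre[OF assms(2) m]
      by (simp add: section_ops[OF m])
  qed (simp_all add: fmul_def section_alg_def Let_def)
  then show ?thesis
    using \<omega>_hom(4)[OF section_fmul_closed[OF assms(1) section_one_closed] assms(2)] by (simp add: lam_def)
qed

text \<open>Derived through \<open>lam\<close> rather than \<open>character_one\<close>, which would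
  ask for all algebra axioms of \<open>\<Gamma>\<close>.\<close>

lemma \<omega>_one: "\<omega> \<one>\<^bsub>\<Gamma>\<^esub> = 1"
proof -
  have "\<omega> s0 = \<omega> (fmul (\<lambda>_. 1) s0)"
    using complex_algebra_smult(3)[OF fibre_at(1) section_fibre[OF s0(1)]]
    by (intro arg_cong[of _ _ \<omega>] extensionalityI[OF section_ext[OF s0(1)]])
       (simp_all add: fmul_def)
  also have "\<dots> = lam (\<lambda>_. 1) * \<omega> s0" by (rule \<omega>_fmul[OF M.smooth_fun_const[OF openP] s0(1)])
  finally have "lam (\<lambda>_. 1) = 1" using s0(2) by simp
  moreover have "lam (\<lambda>_. 1) = \<omega> \<one>\<^bsub>\<Gamma>\<^esub>"
    using \<omega>_hom(2)[OF section_one_closed, of 1] by (simp add: lam_def section_smult_eq_fmul)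
  ultimately show ?thesis by simp
qed

lemma lam_cong: "(\<And>m. m \<in> points M \<Longrightarrow> f m = g m) \<Longrightarrow> lam f = lam g"
  unfolding lam_def fmul_def by (simp cong: restrict_cong)

lemma lam_const: "lam (\<lambda>_. c) = c"
  using \<omega>_hom(2)[OF section_one_closed, of c] \<omega>_one by (simp add: lam_def section_smult_eq_fmul)

lemma lam_add:
  assumes "smooth f" "smooth g"
  shows "lam (\<lambda>x. f x + g x) = lam f + lam g"
proof -
  have "fmul (\<lambda>x. f x + g x) \<one>\<^bsub>\<Gamma>\<^esub> =
      fmul f \<one>\<^bsub>\<Gamma>\<^esub> \<oplus>\<^bsub>\<Gamma>\<^esub> fmul g \<one>\<^bsub>\<Gamma>\<^esub>"
  proof (rule extensionalityI)
    fix m assume m: "m \<in> points M"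
    show "fmul (\<lambda>x. f x + g x) \<one>\<^bsub>\<Gamma>\<^esub> m =
        (fmul f \<one>\<^bsub>\<Gamma>\<^esub> \<oplus>\<^bsub>\<Gamma>\<^esub> fmul g \<one>\<^bsub>\<Gamma>\<^esub>) m"
      using complex_algebra_smult(4)[OF fibre_at(1)[OF m] cring.cring_simprules(6)[OF fibre_cring[OF m]]]
      by (simp add: section_ops[OF m])
  qed (simp_all add: fmul_def section_alg_def Let_def)
  then show ?thesis
    using \<omega>_hom(3)[OF section_fmul_closed section_fmul_closed] assms section_one_closed by (simp add: lam_def)
qed

lemma lam_mult:
  assumes "smooth f" "smooth g"
  shows "lam (\<lambda>x. f x * g x) = lam f * lam g"
proof -
  have "fmul (\<lambda>x. f x * g x) \<one>\<^bsub>\<Gamma>\<^esub> = fmul f (fmul g \<one>\<^bsub>\<Gamma>\<^esub>)"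
    using complex_algebra_smult(2)[OF fibre_at(1) cring.cring_simprules(6)[OF fibre_cring]]
    by (intro extensionalityI[of _ "points M"]) (simp_all add: section_ops, simp_all add: fmul_def)
  then show ?thesis
    using \<omega>_fmul[OF assms(1) section_fmul_closed[OF assms(2) section_one_closed]] by (simp add: lam_def)
qed

lemma lam_diff_const:
  assumes "smooth f"
  shows "smooth (\<lambda>x. f x - c)" "lam (\<lambda>x. f x - c) = lam f - c"
  using M.smooth_fun_diff[OF openP assms M.smooth_fun_const[OF openP], of c]
    lam_add[OF assms M.smooth_fun_const[OF openP], of "- c"]
  by (simp_all add: lam_const)

text \<open>Without a zero, \<open>f - lam f\<close> would be invertible among the smooth functions,
  while \<open>lam\<close> sends it to 0 and the constant 1 to 1.\<close>

lemma lam_in_range: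
  assumes f: "smooth f"
  obtains m where "m \<in> points M" "f m = lam f"
proof -
  let ?g = "\<lambda>x. f x - lam f"
  have "\<exists>m\<in>points M. ?g m = 0"
  proof (rule ccontr)
    assume "\<not> (\<exists>m\<in>points M. ?g m = 0)"
    then have nz: "?g m \<noteq> 0" if "m \<in> points M" for m using that by blast
    have "lam (\<lambda>x. ?g x * inverse (?g x)) = lam ?g * lam (\<lambda>x. inverse (?g x))"
      by (rule lam_mult[OF lam_diff_const(1)[OF f] M.smooth_fun_inverse[OF openP lam_diff_const(1)[OF f] nz]])
    also have "\<dots> = 0" using lam_diff_const(2)[OF f] by simp
    also have "lam (\<lambda>x. ?g x * inverse (?g x)) = lam (\<lambda>_. 1)"
      by (rule lam_cong) (use nz in simp)
    finally show False using lam_const[of 1] by simp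
  qed
  with that show thesis by auto
qed

lemma smooth_of_real: "openM W \<Longrightarrow> smooth_fun M W \<beta> \<Longrightarrow> smooth_fun M W (\<lambda>x. complex_of_real (\<beta> x))"
  by (rule M.smooth_fun_bounded_linear[OF bounded_linear_of_real])

text \<open>A bump supported where \<open>f\<close> differs from the number \<open>lam f\<close> is
  a smooth multiple of \<open>f - lam f\<close>, and \<open>lam\<close> kills that function.\<close>

lemma bump_in_kernel:
  assumes m: "m \<in> points M" and f: "smooth f" "lam f \<noteq> f m"
  obtains \<beta> :: "'m \<Rightarrow> real" and V where
    "openM V" "m \<in> V" "smooth \<beta>" "\<And>x. x \<in> V \<Longrightarrow> \<beta> x = 1"
    "\<And>x. 0 \<le> \<beta> x" "\<And>x. \<beta> x \<le> 1" "lam (\<lambda>x. complex_of_real (\<beta> x)) = 0"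
proof -
  let ?g = "\<lambda>x. f x - lam f"
  define W where "W = {x \<in> points M. ?g x \<noteq> 0}"
  have "continuous_map (mtop M) euclidean ?g"
    using M.smooth_fun_imp_continuous[OF openP lam_diff_const(1)[OF f(1)]] by simp
  then have "openM {x \<in> points M. ?g x \<in> - {0}}"
    by (rule openin_continuous_map_preimage) auto
  then have W: "openM W" by (simp add: W_def)
  have mW: "m \<in> W" using m f(2) by (simp add: W_def)
  obtain \<beta> C V where \<beta>: "smooth \<beta>" "closedin (mtop M) C" "C \<subseteq> W"
    "openM V" "m \<in> V" "V \<subseteq> C" "\<And>x. x \<in> V \<Longrightarrow> \<beta> x = (1::real)"
    "\<And>x. x \<notin> C \<Longrightarrow> \<beta> x = 0" "\<And>x. 0 \<le> \<beta> x" "\<And>x. \<beta> x \<le> 1"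
    by (rule M.smooth_bump_on_manifold[OF W mW]) blast
  define h where "h x = (if x \<in> W then complex_of_real (\<beta> x) * inverse (?g x) else 0)" for x
  have WP: "W \<subseteq> points M" by (auto simp: W_def)
  have "smooth_fun M W (\<lambda>x. complex_of_real (\<beta> x) * inverse (?g x))"
    by (intro M.smooth_fun_mult[OF W] M.smooth_fun_inverse[OF W]
        M.smooth_fun_subset[OF smooth_of_real[OF openP \<beta>(1)] WP]
        M.smooth_fun_subset[OF lam_diff_const(1)[OF f(1)] WP]) (simp add: W_def)
  then have "smooth h"
    unfolding h_def by (rule M.smooth_fun_extend_zero[OF W _ \<beta>(2,3)]) (simp add: \<beta>(8))
  then have "lam (\<lambda>x. h x * ?g x) = lam h * lam ?g"
    by (rule lam_mult[OF _ lam_diff_const(1)[OF f(1)]])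
  also have "\<dots> = 0" using lam_diff_const(2)[OF f(1)] by simp
  also have "lam (\<lambda>x. h x * ?g x) = lam (\<lambda>x. complex_of_real (\<beta> x))"
  proof (rule lam_cong)
    fix x assume "x \<in> points M"
    show "h x * ?g x = complex_of_real (\<beta> x)"
    proof (cases "x \<in> W")
      case False
      then have "x \<notin> C" using \<beta>(3) by blast
      then show ?thesis using False \<beta>(8) by (simp add: h_def)
    qed (simp add: h_def W_def)
  qed
  finally show thesis using that \<beta> by blast
qed

text \<open>If no point works, \<open>M\<close> is covered by countably many plateaus of bumps \<open>\<beta> n\<close> with \<open>lam (\<beta> n) = 0\<close>.
  The products \<open>\<Prod>n<N. 1 - \<beta> n\<close> have \<open>lam\<close>-value 1 and form a locally finite family, and their sum would
  have an infinite \<open>lam\<close>-value because \<open>lam\<close> is monotone.\<close>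

lemma lam_eq_evaluation: "\<exists>m\<in>points M. \<forall>f. smooth f \<longrightarrow> lam f = f m"
proof (rule ccontr)
  assume no: "\<not> ?thesis"
  define good where "good V \<beta> \<longleftrightarrow> openM V \<and> smooth \<beta> \<and> (\<forall>x\<in>V. \<beta> x = 1) \<and>
      (\<forall>x. 0 \<le> \<beta> x \<and> \<beta> x \<le> 1) \<and> lam (\<lambda>x. complex_of_real (\<beta> x)) = 0" for V and \<beta> :: "'m \<Rightarrow> real"
  define \<U> where "\<U> = {V. \<exists>\<beta>. good V \<beta>}"
  have "\<exists>V\<in>\<U>. m \<in> V" if m: "m \<in> points M" for m
  proof -
    obtain f where f: "smooth f" "lam f \<noteq> f m" using no m by blast
    obtain \<beta> V where "openM V" "m \<in> V" "smooth \<beta>" "\<And>x. x \<in> V \<Longrightarrow> \<beta> x = (1::real)"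
      "\<And>x. 0 \<le> \<beta> x" "\<And>x. \<beta> x \<le> 1" "lam (\<lambda>x. complex_of_real (\<beta> x)) = 0"
      by (rule bump_in_kernel[OF m f]) blast
    then show ?thesis unfolding \<U>_def good_def by blast
  qed
  moreover have "openM V" if "V \<in> \<U>" for V using that unfolding \<U>_def good_def by blast
  ultimately have "\<Union>\<U> = points M" using openin_subset by blast
  moreover have "Lindelof_space (mtop M)"
    using M.second_countable second_countable_imp_Lindelof_space by blast
  ultimately obtain \<V> where \<V>: "countable \<V>" "\<V> \<subseteq> \<U>" "\<Union>\<V> = points M"
    using Lindelof_spaceD[of "mtop M" \<U>] \<open>\<And>V. V \<in> \<U> \<Longrightarrow> openM V\<close> by metis
  \<comment> \<open>That \<open>M\<close> has a point comes from the character itself; it rules out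
    an empty cover, which \<open>from_nat_into\<close> could not enumerate.\<close>
  obtain m0 where "m0 \<in> points M" using lam_in_range[OF M.smooth_fun_const[OF openP]] by blast
  then have "\<V> \<noteq> {}" using \<V>(3) by blast
  define V where "V = from_nat_into \<V>"
  have V: "V n \<in> \<U>" "(\<Union>n. V n) = points M" for n
    using from_nat_into[OF \<open>\<V> \<noteq> {}\<close>] range_from_nat_into[OF \<open>\<V> \<noteq> {}\<close> \<V>(1)] \<V>(2,3) by (auto simp: V_def)
  have "\<exists>\<beta>. good (V n) \<beta>" for n using V(1)[of n] by (simp add: \<U>_def)
  then obtain \<beta> where \<beta>: "\<And>n. good (V n) (\<beta> n)" by metis
  define p where "p N x = (\<Prod>n<N. 1 - \<beta> n x)" for N x
  \<comment> \<open>Tails of the sum: raising \<open>L\<close> by one splits off one product, whose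
    \<open>lam\<close>-value is 1.\<close>
  define h where "h L x = (\<Sum>k. p (L + k) x)" for L x
  have smooth_p: "smooth (p N)" for N
    unfolding p_def using \<beta> unfolding good_def
    by (intro M.smooth_fun_prod M.smooth_fun_diff M.smooth_fun_const openP) blast
  have p_nonneg: "0 \<le> p N x" for N x
    unfolding p_def using \<beta> unfolding good_def by (intro prod_nonneg) simp
  have p_zero: "p N x = 0" if "x \<in> V j" "j < N" for x j N
    unfolding p_def using \<beta>[of j] that by (intro prod_zero) (auto simp: good_def)
  \<comment> \<open>On \<open>V j\<close> every product with more than \<open>j\<close> factors
    contains the vanishing factor \<open>1 - \<beta> j\<close>; hence only \<open>k \<le> j\<close>
    can contribute, whatever \<open>L\<close> is.\<close>
  have h_eq: "h L x = (\<Sum>k<Suc j. p (L + k) x)" "summable (\<lambda>k. p (L + k) x)" if "x \<in> V j" for x j L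
    unfolding h_def
    by (intro suminf_finite summable_finite[of "{..<Suc j}"]; simp add: p_zero[OF that])+
  have smooth_h: "smooth (h L)" for L
  proof (rule M.smooth_fun_local)
    fix x assume x: "x \<in> points M"
    obtain j where j: "x \<in> V j" using x V(2) by blast
    have "smooth_fun M (V j) (\<lambda>x. \<Sum>k<Suc j. p (L + k) x)"
    proof (rule M.smooth_fun_sum)
      show "openM (V j)" using \<beta>[of j] by (simp add: good_def)
      then show "smooth_fun M (V j) (p (L + k))" for k
        by (intro M.smooth_fun_subset[OF smooth_p]) (rule openin_subset)
    qed
    then show "\<exists>W' G. openM W' \<and> x \<in> W' \<and> smooth_fun M W' G \<and> (\<forall>y\<in>W'. h L y = G y)"
      using j h_eq(1) \<beta>[of j] unfolding good_def
      by (intro exI[of _ "V j"] exI[of _ "\<lambda>x. \<Sum>k<Suc j. p (L + k) x"]) blast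
  qed
  have lam_p: "lam (\<lambda>x. complex_of_real (p N x)) = 1" for N
  proof (induction N)
    case 0
    show ?case using lam_const[of 1] by (simp add: p_def)
  next
    case (Suc N)
    have b: "smooth (\<lambda>x. complex_of_real (\<beta> N x))" "lam (\<lambda>x. complex_of_real (\<beta> N x)) = 0"
      using \<beta>[of N] smooth_of_real[OF openP] by (auto simp: good_def)
    have mb: "smooth (\<lambda>x. (-1) * complex_of_real (\<beta> N x))"
      by (intro M.smooth_fun_mult[OF openP M.smooth_fun_const[OF openP] b(1)])
    have "lam (\<lambda>x. 1 + (-1) * complex_of_real (\<beta> N x)) = 1"
      using lam_add[OF M.smooth_fun_const[OF openP] mb, of 1] lam_const[of 1] lam_const[of "-1"]
        lam_mult[OF M.smooth_fun_const[OF openP] b(1), of "-1"] b(2) by simp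
    then show ?case
      using lam_mult[OF smooth_of_real[OF openP smooth_p] M.smooth_fun_add[OF openP M.smooth_fun_const[OF openP] mb], of N 1] Suc
      by (simp add: p_def)
  qed
  have lam_h: "lam (\<lambda>x. complex_of_real (h L x)) = 1 + lam (\<lambda>x. complex_of_real (h (Suc L) x))" for L
  proof -
    have "lam (\<lambda>x. complex_of_real (h L x)) = lam (\<lambda>x. complex_of_real (p L x) + complex_of_real (h (Suc L) x))"
    proof (rule lam_cong)
      fix x assume "x \<in> points M"
      then obtain j where j: "x \<in> V j" using V(2) by blast
      have "h L x = p L x + h (Suc L) x"
        unfolding h_def using suminf_split_head[OF h_eq(2)[OF j, of L]] by simp
      then show "complex_of_real (h L x) = complex_of_real (p L x) + complex_of_real (h (Suc L) x)" by simp
    qed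
    then show ?thesis
      using lam_add[OF smooth_of_real[OF openP smooth_p] smooth_of_real[OF openP smooth_h], of L "Suc L"] lam_p by simp
  qed
  have lam_h0: "lam (\<lambda>x. complex_of_real (h 0 x)) = of_nat L + lam (\<lambda>x. complex_of_real (h L x))" for L
  proof (induction L)
    case (Suc L)
    then show ?case using lam_h[of L] by simp
  qed simp
  \<comment> \<open>Positivity of \<open>lam\<close> on a nonnegative function holds because its
    value is attained somewhere.\<close>
  have "Re (lam (\<lambda>x. complex_of_real (h L x))) \<ge> 0" for L
  proof -
    obtain m where m: "m \<in> points M" "complex_of_real (h L m) = lam (\<lambda>x. complex_of_real (h L x))"
      by (rule lam_in_range[OF smooth_of_real[OF openP smooth_h]])
    obtain j where j: "m \<in> V j" using m(1) V(2) by blast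
    have "0 \<le> h L m" unfolding h_eq(1)[OF j] by (intro sum_nonneg p_nonneg)
    then show ?thesis by (simp flip: m(2))
  qed
  then have "Re (lam (\<lambda>x. complex_of_real (h 0 x))) \<ge> real L" for L
    using lam_h0[of L] by simp
  moreover obtain L :: nat where "Re (lam (\<lambda>x. complex_of_real (h 0 x))) < real L"
    using reals_Archimedean2 by blast
  ultimately show False by (meson not_le)
qed

text \<open>\<open>\<eta> a\<close> is the value of the character on the constant local section
  \<open>a\<close>, cut off by a bump that is 1 at \<open>m\<close>. Multiplicativity and the
  comparison with an arbitrary section hold up to powers of the bump, which are invisible because
  \<open>lam\<close> gives the bump the value 1.\<close>

lemma character_factors_through_fibre:
  obtains m i \<eta> where "m \<in> points M" "i \<in> \<I>" "m \<in> patch B i"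
    "\<eta> \<in> alg_hom A complex_alg" "\<And>s. s \<in> carrier \<Gamma> \<Longrightarrow> \<omega> s = \<eta> (cvec i (s m))"
proof -
  obtain m where m: "m \<in> points M" and lam: "\<And>f. smooth f \<Longrightarrow> lam f = f m"
    using lam_eq_evaluation by blast
  obtain i where i: "i \<in> \<I>" "m \<in> patch B i" using m by (rule patch_at)
  note oU = patch(1)[OF i(1)] and UP = patch(2)[OF i(1)]
  obtain \<beta> :: "'m \<Rightarrow> real" and C where \<beta>: "smooth \<beta>" "closedin (mtop M) C" "C \<subseteq> patch B i"
    "\<beta> m = 1" "\<And>x. x \<notin> C \<Longrightarrow> \<beta> x = 0"
    by (rule bump_in_patch[OF oU i(2)]) blast
  define b where "b x = complex_of_real (\<beta> x)" for x
  have b: "smooth b" unfolding b_def by (rule smooth_of_real[OF openP \<beta>(1)])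
  have lam_b: "lam b = 1" using lam[OF b] \<beta>(4) by (simp add: b_def)
  define S where "S a = glue i (\<lambda>x. \<beta> x *\<^sub>R a)" for a
  have \<beta>_U: "smooth_fun M (patch B i) \<beta>" by (rule M.smooth_fun_subset[OF \<beta>(1) UP])
  have S: "S a \<in> carrier \<Gamma>" for a
    unfolding S_def
    by (rule glue_closed[OF i(1) _ \<beta>(2,3)])
       (auto intro!: M.smooth_fun_bilinear[OF bounded_bilinear_scaleR oU] \<beta>_U M.smooth_fun_const[OF oU] simp: \<beta>(5))
  have S_in: "cvec i (S a x) = \<beta> x *\<^sub>R a" if "x \<in> patch B i" for a x
    unfolding S_def by (rule glue_inside[OF i(1) that])
  have S_out: "S a x = \<zero>\<^bsub>fibre_at B x\<^esub>" if "x \<in> points M" "x \<notin> patch B i" for a x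
    unfolding S_def by (rule glue_outside[OF that])
  define \<eta> where "\<eta> a = \<omega> (S a)" for a
  have add: "\<eta> (a + a') = \<eta> a + \<eta> a'" for a a'
  proof -
    have "S (a + a') = S a \<oplus>\<^bsub>\<Gamma>\<^esub> S a'"
    proof (rule section_eqI[OF S section_add_closed[OF S S] i(1)])
      fix x assume x: "x \<in> patch B i"
      note xP = patch_point[OF i(1) x]
      show "cvec i (S (a + a') x) = cvec i ((S a \<oplus>\<^bsub>\<Gamma>\<^esub> S a') x)"
        using cvec_hom(2)[OF i(1) x section_fibre[OF S xP] section_fibre[OF S xP]]
        by (simp add: section_ops[OF xP] S_in[OF x] scaleR_add_right)
    next
      fix x assume x: "x \<in> points M" "x \<notin> patch B i"
      interpret F: cring "fibre_at B x" by (rule fibre_cring[OF x(1)])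
      show "S (a + a') x = (S a \<oplus>\<^bsub>\<Gamma>\<^esub> S a') x"
        by (simp add: section_ops[OF x(1)] S_out[OF x])
    qed
    then show ?thesis using \<omega>_hom(3)[OF S S] by (simp add: \<eta>_def)
  qed
  have smult: "\<eta> (c \<odot>\<^bsub>A\<^esub> a) = c * \<eta> a" for c a
  proof -
    have "S (c \<odot>\<^bsub>A\<^esub> a) = c \<odot>\<^bsub>\<Gamma>\<^esub> S a"
    proof (rule section_eqI[OF S section_smult_closed[OF S] i(1)])
      fix x assume x: "x \<in> patch B i"
      note xP = patch_point[OF i(1) x]
      show "cvec i (S (c \<odot>\<^bsub>A\<^esub> a) x) = cvec i ((c \<odot>\<^bsub>\<Gamma>\<^esub> S a) x)"
        using cvec_hom(1)[OF i(1) x section_fibre[OF S xP]]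
        by (simp add: section_ops[OF xP] S_in[OF x] smult_scaleR)
    next
      fix x assume x: "x \<in> points M" "x \<notin> patch B i"
      show "S (c \<odot>\<^bsub>A\<^esub> a) x = (c \<odot>\<^bsub>\<Gamma>\<^esub> S a) x"
        using complex_algebra_smult_zero[OF fibre_at(1)[OF x(1)]]
        by (simp add: section_ops[OF x(1)] S_out[OF x])
    qed
    then show ?thesis using \<omega>_hom(2)[OF S] by (simp add: \<eta>_def)
  qed
  have mult: "\<eta> (a \<otimes>\<^bsub>A\<^esub> a') = \<eta> a * \<eta> a'" for a a'
  proof -
    \<comment> \<open>The product of two cut off sections carries the bump twice, one factor more
      than \<open>S\<close> of the product.\<close>
    have "fmul b (S (a \<otimes>\<^bsub>A\<^esub> a')) = S a \<otimes>\<^bsub>\<Gamma>\<^esub> S a'"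
    proof (rule section_eqI[OF section_fmul_closed[OF b S] section_mult_closed[OF S S] i(1)])
      fix x assume x: "x \<in> patch B i"
      note xP = patch_point[OF i(1) x]
      show "cvec i (fmul b (S (a \<otimes>\<^bsub>A\<^esub> a')) x) = cvec i ((S a \<otimes>\<^bsub>\<Gamma>\<^esub> S a') x)"
        using cvec_hom(1)[OF i(1) x section_fibre[OF S xP]]
          cvec_hom(3)[OF i(1) x section_fibre[OF S xP] section_fibre[OF S xP]]
        by (simp add: section_ops[OF xP] S_in[OF x] b_def A(4)
            bounded_bilinear.scaleR_left[OF bounded_bilinear_mult_A] bounded_bilinear.scaleR_right[OF bounded_bilinear_mult_A])
    next
      fix x assume x: "x \<in> points M" "x \<notin> patch B i"
      interpret F: cring "fibre_at B x" by (rule fibre_cring[OF x(1)])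
      show "fmul b (S (a \<otimes>\<^bsub>A\<^esub> a')) x = (S a \<otimes>\<^bsub>\<Gamma>\<^esub> S a') x"
        using complex_algebra_smult_zero[OF fibre_at(1)[OF x(1)]]
        by (simp add: section_ops[OF x(1)] S_out[OF x])
    qed
    then show ?thesis
      using \<omega>_hom(4)[OF S S] \<omega>_fmul[OF b S, of "a \<otimes>\<^bsub>A\<^esub> a'"] lam_b by (simp add: \<eta>_def)
  qed
  have \<eta>: "\<eta> \<in> alg_hom A complex_alg"
    by (rule alg_homI) (simp_all add: A(3) add smult mult)
  have "linear \<eta>"
    using smult[of "complex_of_real r" for r] by (intro linearI add) (simp add: A(4) scaleR_conv_of_real)
  obtain D :: "'a set" where D: "finite D" "independent D" "span D = UNIV"
    using finite_dimensional_basis[OF fdA] .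
  have "\<omega> s = \<eta> (cvec i (s m))" if s: "s \<in> carrier \<Gamma>" for s
  proof -
    \<comment> \<open>The coordinates of \<open>s\<close> exist only over the patch; the factor
      \<open>\<beta>\<close> makes them smooth functions on all of \<open>M\<close>.\<close>
    define r where "r e x = (if x \<in> patch B i then \<beta> x * representation D (cvec i (s x)) e else 0)" for e x
    define f where "f e x = complex_of_real (r e x)" for e x
    have r_U: "smooth_fun M (patch B i) (\<lambda>x. \<beta> x * representation D (cvec i (s x)) e)" for e
      by (intro M.smooth_fun_mult[OF oU \<beta>_U]
          M.smooth_fun_bounded_linear[OF bounded_linear_representation[OF D] oU] smooth_section_vec[OF s i(1)])
    have smooth_r: "smooth (r e)" for e
      unfolding r_def by (rule M.smooth_fun_extend_zero[OF oU r_U \<beta>(2,3)]) (simp add: \<beta>(5))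
    have f: "smooth (f e)" for e
      unfolding f_def by (rule smooth_of_real[OF openP smooth_r])
    \<comment> \<open>The index set \<open>F\<close> is variable so that the character value can be
      computed by adding one basis vector at a time.\<close>
    define T where "T F = glue i (\<lambda>x. \<Sum>e\<in>F. r e x *\<^sub>R \<beta> x *\<^sub>R e)" for F
    have T_in: "cvec i (T F x) = (\<Sum>e\<in>F. r e x *\<^sub>R \<beta> x *\<^sub>R e)" if "x \<in> patch B i" for F x
      unfolding T_def by (rule glue_inside[OF i(1) that])
    have T_out: "T F x = \<zero>\<^bsub>fibre_at B x\<^esub>" if "x \<in> points M" "x \<notin> patch B i" for F x
      unfolding T_def by (rule glue_outside[OF that])
    have T: "T F \<in> carrier \<Gamma>" for F
      unfolding T_def
    proof (rule glue_closed[OF i(1) _ \<beta>(2,3)])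
      show "smooth_fun M (patch B i) (\<lambda>x. \<Sum>e\<in>F. r e x *\<^sub>R \<beta> x *\<^sub>R e)"
        by (intro M.smooth_fun_sum M.smooth_fun_bilinear[OF bounded_bilinear_scaleR] oU \<beta>_U M.smooth_fun_const[OF oU]
            M.smooth_fun_subset[OF smooth_r UP])
    qed (simp add: \<beta>(5))
    have \<omega>_T: "\<omega> (T F) = (\<Sum>e\<in>F. f e m * \<eta> e)" if "finite F" for F
      using that
    proof induction
      case empty
      \<comment> \<open>Additivity gives the value 0 here, since \<open>\<eta> 0\<close> equals its
        own double.\<close>
      have "T {} = S 0" by (simp add: T_def S_def)
      then show ?case using add[of 0 0] by (simp add: \<eta>_def)
    next
      case (insert e F)
      have "T (insert e F) = fmul (f e) (S e) \<oplus>\<^bsub>\<Gamma>\<^esub> T F"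
      proof (rule section_eqI[OF T section_add_closed[OF section_fmul_closed[OF f S] T] i(1)])
        fix x assume x: "x \<in> patch B i"
        note xP = patch_point[OF i(1) x]
        show "cvec i (T (insert e F) x) = cvec i ((fmul (f e) (S e) \<oplus>\<^bsub>\<Gamma>\<^esub> T F) x)"
          using cvec_hom(2)[OF i(1) x section_fibre[OF section_fmul_closed[OF f S] xP] section_fibre[OF T xP], of e e F]
            cvec_hom(1)[OF i(1) x section_fibre[OF S xP], of "f e x" e] insert
          by (simp add: section_ops[OF xP] T_in[OF x] S_in[OF x] f_def A(4))
      next
        fix x assume x: "x \<in> points M" "x \<notin> patch B i"
        interpret F: cring "fibre_at B x" by (rule fibre_cring[OF x(1)])
        show "T (insert e F) x = (fmul (f e) (S e) \<oplus>\<^bsub>\<Gamma>\<^esub> T F) x"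
          using complex_algebra_smult_zero[OF fibre_at(1)[OF x(1)]]
          by (simp add: section_ops[OF x(1)] S_out[OF x] T_out[OF x])
      qed
      then have "\<omega> (T (insert e F)) = lam (f e) * \<eta> e + \<omega> (T F)"
        using \<omega>_hom(3)[OF section_fmul_closed[OF f S] T] \<omega>_fmul[OF f S] by (simp add: \<eta>_def)
      then show ?case using insert lam[OF f] by simp
    qed
    \<comment> \<open>One bump factor sits in the coefficients \<open>r e\<close>, the other one in
      the cut off basis sections.\<close>
    have "fmul b (fmul b s) = T D"
    proof (rule section_eqI[OF section_fmul_closed[OF b section_fmul_closed[OF b s]] T i(1)])
      fix x assume x: "x \<in> patch B i"
      note xP = patch_point[OF i(1) x]
      have "cvec i (T D x) = \<beta> x *\<^sub>R \<beta> x *\<^sub>R (\<Sum>e\<in>D. representation D (cvec i (s x)) e *\<^sub>R e)"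
        by (simp add: T_in[OF x] r_def x scaleR_sum_right algebra_simps)
      then show "cvec i (fmul b (fmul b s) x) = cvec i (T D x)"
        using cvec_hom(1)[OF i(1) x section_fibre[OF s xP]] cvec_hom(1)[OF i(1) x section_fibre[OF section_fmul_closed[OF b s] xP]]
        by (simp add: section_ops[OF xP] b_def A(4) representation_sum[OF D])
    next
      fix x assume x: "x \<in> points M" "x \<notin> patch B i"
      then have "b x = 0" using \<beta>(3,5) by (auto simp: b_def)
      then show "fmul b (fmul b s) x = T D x"
        using complex_algebra_smult(5)[OF fibre_at(1)[OF x(1)] section_fibre[OF section_fmul_closed[OF b s] x(1)]]
        by (simp add: section_ops(5)[OF x(1)] T_out[OF x])
    qed
    then have "\<omega> s = \<omega> (T D)"
      using \<omega>_fmul[OF b section_fmul_closed[OF b s]] \<omega>_fmul[OF b s] lam_b by simp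
    \<comment> \<open>At \<open>m\<close> the bump is 1, so the coefficients are the true
      coordinates of the section.\<close>
    also have "\<dots> = (\<Sum>e\<in>D. representation D (cvec i (s m)) e *\<^sub>R \<eta> e)"
      using i(2) \<beta>(4) by (simp add: \<omega>_T[OF D(1)] f_def r_def scaleR_conv_of_real)
    also have "\<dots> = \<eta> (cvec i (s m))"
      by (rule finite_dimensional_linear_expansion[OF D \<open>linear \<eta>\<close>, symmetric])
    finally show ?thesis .
  qed
  then show thesis by (rule that[OF m i \<eta>])
qed

end

section \<open>The spectrum as a covering\<close>

lemma rad_class_self:
  assumes "complex_algebra B" "a \<in> carrier B"
  shows "a \<in> rad_class B a" "rad_class B a \<subseteq> carrier B"
proof -
  interpret B: cring B by (rule complex_algebra_cring[OF assms(1)])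
  interpret N: ideal "jacobson_radical B" B
    by (rule ideal_jacobson_radical[OF complex_algebra_ring[OF assms(1)]])
  show "a \<in> rad_class B a" unfolding rad_class_def by (rule N.a_rcos_self[OF assms(2)])
  show "rad_class B a \<subseteq> carrier B"
    unfolding rad_class_def by (rule B.a_r_coset_subset_G[OF N.a_subset assms(2)])
qed

locale split_algebra_bundle = smooth_algebra_bundle B
  for B :: "('m, 'b::real_normed_vector, 'e, 'c::real_normed_vector,
               'a::real_normed_vector, 'i) bundle_data" +
  fixes n :: nat
    and \<theta> :: "'a set \<Rightarrow> nat \<Rightarrow> complex"
    and Mh :: "('h, 'b) manifold_data"
    and p :: "'h \<Rightarrow> 'm"
    and \<psi> :: "'i \<Rightarrow> 'm \<times> nat \<Rightarrow> 'h"
  assumes theta: "\<theta> \<in> alg_iso (fibre_ss B) (power_alg n)"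
    and covering: "associated_covering B n \<theta> Mh p \<psi>"
begin

sublocale split: split_algebra "typical_fibre B" n \<theta>
  by (rule split_algebra.intro[OF A(1) theta])

abbreviation "coords \<equiv> split.coords"
abbreviation "sheets i \<equiv> {y \<in> points Mh. p y \<in> patch B i}"

lemma carrier_A: "a \<in> carrier A" by (simp add: A(2))

lemma coords_linear:
  assumes "k \<in> {1..n}"
  shows "bounded_linear (\<lambda>a. coords a k)"
proof (rule finite_dimensional_imp_bounded_linear[OF fdA])
  show "linear (\<lambda>a. coords a k)"
    using split.coords_hom(2)[OF carrier_A assms carrier_A] split.coords_hom(1)[OF carrier_A assms, of "complex_of_real _"]
    by (intro linearI) (simp_all add: A(3,4) scaleR_conv_of_real)
qed

lemma bchart_ss_rad_class:
  assumes "i \<in> \<I>" "x \<in> patch B i"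
  shows "bchart_ss B i (x, rad_class A a) = rad_class (fibre_at B x) (\<phi> i (x, a))"
  using ss_map_rad_class[OF A(1) fibre_at(1)[OF patch_point[OF assms]] bchart_iso[OF assms] carrier_A]
  by (simp add: bchart_ss_def)

text \<open>A coset is a nonempty subset of a single fibre, so it determines its base point; over a
  fixed point the bundle chart is an isomorphism and hence injective on classes.\<close>

lemma inj_bchart_ss:
  assumes i: "i \<in> \<I>"
  shows "inj_on (bchart_ss B i) (patch B i \<times> carrier (fibre_ss B))"
proof (rule inj_onI)
  fix z w assume zw: "z \<in> patch B i \<times> carrier (fibre_ss B)" "w \<in> patch B i \<times> carrier (fibre_ss B)"
    "bchart_ss B i z = bchart_ss B i w"
  obtain x a where z: "z = (x, rad_class A a)" "x \<in> patch B i"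
    using zw(1) by (auto simp: carrier_ss_quotient)
  obtain y b where w: "w = (y, rad_class A b)" "y \<in> patch B i"
    using zw(2) by (auto simp: carrier_ss_quotient)
  note xP = patch_point[OF i z(2)] and yP = patch_point[OF i w(2)]
  have eq: "rad_class (fibre_at B x) (\<phi> i (x, a)) = rad_class (fibre_at B y) (\<phi> i (y, b))"
    using zw(3) bchart_ss_rad_class[OF i] z w by simp
  have "\<phi> i (x, a) \<in> carrier (fibre_at B y)"
    using rad_class_self(1)[OF fibre_at(1)[OF xP] bchart_in[OF i z(2)], of a] eq
      rad_class_self(2)[OF fibre_at(1)[OF yP] bchart_in[OF i w(2)], of b] by blast
  then have "x = y" using bchart_in[OF i z(2), of a] fibre_at(2)[OF xP] fibre_at(2)[OF yP] by simp
  moreover have "rad_class A a = rad_class A b"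
    by (rule rad_class_alg_iso_inj[OF A(1) fibre_at(1)[OF xP] bchart_iso[OF i z(2)] carrier_A carrier_A])
       (use eq \<open>x = y\<close> in simp)
  ultimately show "z = w" using z(1) w(1) by simp
qed

lemma section_ss_apply: "m \<in> points M \<Longrightarrow> section_ss B s m = rad_class (fibre_at B m) (s m)"
  by (simp add: section_ss_def rad_class_def)

text \<open>The bridge from cosets to the numbers \<open>coords\<close>, in which the values of
  \<open>Omega\<close> and \<open>Xi\<close> are computed.\<close>

lemma local_rep_section_ss:
  assumes "s \<in> carrier \<Gamma>" "i \<in> \<I>" "x \<in> patch B i"
  shows "local_rep B \<theta> i (section_ss B s) x = coords (cvec i (s x))"
proof -
  note xP = patch_point[OF assms(2,3)]
  have "section_ss B s x = bchart_ss B i (x, rad_class A (cvec i (s x)))"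
    by (simp add: section_ss_apply[OF xP] bchart_ss_rad_class[OF assms(2,3)]
        bchart_vec[OF assms(2,3) section_fibre[OF assms(1) xP]])
  then have "inv_into (patch B i \<times> carrier (fibre_ss B)) (bchart_ss B i) (section_ss B s x) =
      (x, rad_class A (cvec i (s x)))"
    using inv_into_f_f[OF inj_bchart_ss[OF assms(2)], of "(x, rad_class A (cvec i (s x)))"]
      assms(3) split.rad_class_in[OF carrier_A] by simp
  then show ?thesis by (simp add: local_rep_def split.coords_def)
qed

lemma smooth_coords:
  assumes "s \<in> carrier \<Gamma>" "i \<in> \<I>" "k \<in> {1..n}"
  shows "smooth_fun M (patch B i) (\<lambda>x. coords (cvec i (s x)) k)"
  by (rule M.smooth_fun_bounded_linear[OF coords_linear[OF assms(3)] patch(1)[OF assms(2)]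
        smooth_section_vec[OF assms(1,2)]])

lemma section_ss_in:
  assumes s: "s \<in> carrier \<Gamma>"
  shows "section_ss B s \<in> sections_ss B n \<theta>"
  unfolding sections_ss_def mem_Collect_eq
proof (intro conjI ballI PiE_I)
  fix m assume m: "m \<in> points M"
  show "section_ss B s m \<in> carrier (ss_quotient (fibre_at B m))"
    using section_fibre[OF s m] by (simp add: section_ss_apply[OF m] carrier_ss_quotient)
next
  fix m assume "m \<notin> points M"
  then show "section_ss B s m = undefined" by (simp add: section_ss_def)
next
  fix i k assume i: "i \<in> \<I>" and k: "k \<in> {1..n}"
  have "smooth_fun M (patch B i) (\<lambda>x. local_rep B \<theta> i (section_ss B s) x k)"
    by (rule M.smooth_fun_cong[OF patch(1)[OF i] smooth_coords[OF s i k]])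
       (simp only: local_rep_section_ss[OF s i])
  then show "smooth_map (open_submanifold M (patch B i)) vector_manifold
      (\<lambda>x. local_rep B \<theta> i (section_ss B s) x k)"
    using M.smooth_map_vector_iff[OF patch(1)[OF i]] by blast
qed

section \<open>The sheets of the covering\<close>

lemma covering_conds:
  "smooth_manifold Mh" "smooth_map Mh M p"
  "\<forall>i\<in>\<I>.
      diffeomorphism (discrete_prod_manifold (open_submanifold M (patch B i)) {1..n})
        (open_submanifold Mh (sheets i)) (\<psi> i) \<and>
      (\<forall>x\<in>patch B i. \<forall>k\<in>{1..n}. p (\<psi> i (x, k)) = x)"
  "\<forall>i\<in>\<I>. \<forall>j\<in>\<I>. \<forall>x\<in>patch B i \<inter> patch B j. \<forall>k\<in>{1..n}.
      inv_into (patch B i \<times> {1..n}) (\<psi> i) (\<psi> j (x, k)) = (x, perm_transition B n \<theta> i j x k)"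
  using covering unfolding associated_covering_def by - (elim conjE, assumption)+

sublocale Mh: smooth_mfd Mh by unfold_locales (rule covering_conds(1))

abbreviation "sheet_top i \<equiv> prod_topology (subtopology (mtop M) (patch B i)) (discrete_topology {1..n})"

lemma topspace_sheet_top: "i \<in> \<I> \<Longrightarrow> topspace (sheet_top i) = patch B i \<times> {1..n}"
  using patch(2) by auto

lemma p_continuous: "continuous_map (mtop Mh) (mtop M) p"
  using covering_conds(2) by (simp add: smooth_map_def)

lemma p_point: "y \<in> points Mh \<Longrightarrow> p y \<in> points M"
  using p_continuous by (auto simp: continuous_map_def)

lemma sheet_homeomorphic:
  assumes "i \<in> \<I>"
  shows "homeomorphic_map (sheet_top i) (subtopology (mtop Mh) (sheets i)) (\<psi> i)"
proof -
  have d: "diffeomorphism (discrete_prod_manifold (open_submanifold M (patch B i)) {1..n})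
        (open_submanifold Mh (sheets i)) (\<psi> i)"
    using bspec[OF covering_conds(3) assms] by blast
  have X: "mtop (discrete_prod_manifold (open_submanifold M (patch B i)) {1..n}) = sheet_top i"
    "mtop (open_submanifold Mh (sheets i)) = subtopology (mtop Mh) (sheets i)"
    by (simp_all add: discrete_prod_manifold_def open_submanifold_def)
  let ?g = "inv_into (topspace (sheet_top i)) (\<psi> i)"
  have bij: "bij_betw (\<psi> i) (topspace (sheet_top i)) (topspace (subtopology (mtop Mh) (sheets i)))"
    and cont: "continuous_map (sheet_top i) (subtopology (mtop Mh) (sheets i)) (\<psi> i)"
      "continuous_map (subtopology (mtop Mh) (sheets i)) (sheet_top i) ?g"
    using d unfolding diffeomorphism_def smooth_map_def X by blast+
  have "homeomorphic_maps (sheet_top i) (subtopology (mtop Mh) (sheets i)) (\<psi> i) ?g"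
    unfolding homeomorphic_maps_def
    using cont bij_betw_inv_into_left[OF bij] bij_betw_inv_into_right[OF bij] by blast
  then show ?thesis by (rule homeomorphic_maps_imp_map)
qed

lemma sheet_bij: "i \<in> \<I> \<Longrightarrow> bij_betw (\<psi> i) (patch B i \<times> {1..n}) (sheets i)"
  using sheet_homeomorphic[of i] topspace_sheet_top[of i]
  by (auto simp: homeomorphic_eq_everything_map bij_betw_def)

lemma p_psi: "i \<in> \<I> \<Longrightarrow> x \<in> patch B i \<Longrightarrow> k \<in> {1..n} \<Longrightarrow> p (\<psi> i (x, k)) = x"
  using bspec[OF covering_conds(3), of i] by auto

lemma psi_in:
  assumes "i \<in> \<I>" "x \<in> patch B i" "k \<in> {1..n}"
  shows "\<psi> i (x, k) \<in> points Mh"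
  using bij_betw_imp_surj_on[OF sheet_bij[OF assms(1)]] assms(2,3) by blast

lemma sheet_at:
  assumes "y \<in> points Mh" "i \<in> \<I>" "p y \<in> patch B i"
  obtains k where "k \<in> {1..n}" "y = \<psi> i (p y, k)"
proof -
  have "y \<in> \<psi> i ` (patch B i \<times> {1..n})"
    using bij_betw_imp_surj_on[OF sheet_bij[OF assms(2)]] assms by simp
  then obtain x k where xk: "x \<in> patch B i" "k \<in> {1..n}" "y = \<psi> i (x, k)" by auto
  have "p y = x" using p_psi[OF assms(2) xk(1,2)] xk(3) by simp
  with xk(3) have "y = \<psi> i (p y, k)" by simp
  with xk(2) show thesis by (rule that)
qed

lemma some_sheet_at:
  assumes "y \<in> points Mh"
  obtains i x k where "i \<in> \<I>" "x \<in> patch B i" "k \<in> {1..n}" "y = \<psi> i (x, k)"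
proof -
  obtain i where i: "i \<in> \<I>" "p y \<in> patch B i" using p_point[OF assms] by (rule patch_at)
  obtain k where "k \<in> {1..n}" "y = \<psi> i (p y, k)" using sheet_at[OF assms i] .
  with i that show thesis by blast
qed

lemma transition_eq_vec: "transition B i j x a = cvec i (\<phi> j (x, a))"
  by (simp add: transition_def cvec_def)

lemma transition_iso:
  assumes i: "i \<in> \<I>" "x \<in> patch B i" and j: "j \<in> \<I>" "x \<in> patch B j"
  shows "transition B i j x \<in> alg_iso A A"
proof -
  note hom = alg_homD(2-4)[OF alg_isoD(1)[OF bchart_iso[OF j]] carrier_A]
  have "transition B i j x \<in> alg_hom A A"
  proof (rule alg_homI)
    fix a b c
    note v = cvec_hom[OF i bchart_in[OF j]]
    show "transition B i j x (a \<oplus>\<^bsub>A\<^esub> b) = transition B i j x a \<oplus>\<^bsub>A\<^esub> transition B i j x b"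
      unfolding transition_eq_vec hom(2)[OF carrier_A] v(2)[OF bchart_in[OF j]] by (simp add: A(3))
    show "transition B i j x (a \<otimes>\<^bsub>A\<^esub> b) = transition B i j x a \<otimes>\<^bsub>A\<^esub> transition B i j x b"
      unfolding transition_eq_vec hom(3)[OF carrier_A] v(3)[OF bchart_in[OF j]] ..
    show "transition B i j x (c \<odot>\<^bsub>A\<^esub> a) = c \<odot>\<^bsub>A\<^esub> transition B i j x a"
      unfolding transition_eq_vec hom(1) v(1) ..
  qed (rule carrier_A)
  moreover have "bij_betw (transition B i j x) (carrier A) (carrier A)"
  proof (rule bij_betw_byWitness[where f' = "transition B j i x"])
    show "\<forall>a\<in>carrier A. transition B j i x (transition B i j x a) = a"
      "\<forall>a\<in>carrier A. transition B i j x (transition B j i x a) = a"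
      by (simp_all add: transition_eq_vec bchart_vec[OF i bchart_in[OF j]] bchart_vec[OF j bchart_in[OF i]]
          cvec_bchart[OF i] cvec_bchart[OF j])
  qed (simp_all add: A(2))
  ultimately show ?thesis by (simp add: alg_iso_def)
qed

text \<open>This makes the \<open>THE\<close> in \<open>Omega\<close> well defined: passing from
  chart \<open>j\<close> to chart \<open>i\<close> permutes the coordinates of the semisimple
  quotient by the same permutation that renumbers the sheets.\<close>

lemma coords_sheet_unique:
  assumes s: "s \<in> carrier \<Gamma>"
    and i: "i \<in> \<I>" "x \<in> patch B i" "k \<in> {1..n}"
    and j: "j \<in> \<I>" "x' \<in> patch B j" "k' \<in> {1..n}" and eq: "\<psi> i (x, k) = \<psi> j (x', k')"
  shows "coords (cvec i (s x)) k = coords (cvec j (s x')) k'"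
proof -
  have x': "x' = x" using p_psi[OF i] p_psi[OF j] eq by simp
  note xj = j(2)[unfolded x']
  have "inv_into (patch B i \<times> {1..n}) (\<psi> i) (\<psi> i (x, k)) = (x, k)"
    by (rule inv_into_f_f[OF bij_betw_imp_inj_on[OF sheet_bij[OF i(1)]]]) (use i in simp)
  moreover have "inv_into (patch B i \<times> {1..n}) (\<psi> i) (\<psi> j (x, k')) = (x, perm_transition B n \<theta> i j x k')"
    using covering_conds(4) i j xj by blast
  ultimately have k: "k = perm_transition B n \<theta> i j x k'" using eq x' by simp
  have g: "transition B i j x \<in> alg_iso A A" by (rule transition_iso[OF i(1,2) j(1) xj])
  have "transition B i j x (cvec j (s x)) = cvec i (s x)"
    using bchart_vec[OF j(1) xj section_fibre[OF s patch_point[OF i(1,2)]]] by (simp add: transition_eq_vec)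
  then show ?thesis
    using split.coords_permuted(2)[OF g carrier_A j(3), of "cvec j (s x)"] x'
    by (simp add: k perm_transition_def transition_ss_def)
qed

lemma Xi_apply:
  assumes s: "s \<in> carrier \<Gamma>" and i: "i \<in> \<I>" "x \<in> patch B i" "k \<in> {1..n}"
  shows "Xi B n \<theta> Mh \<psi> (\<psi> i (x, k)) s = coords (cvec i (s x)) k"
proof -
  have "(THE z. \<exists>j\<in>\<I>. \<exists>x'\<in>patch B j. \<exists>k'\<in>{1..n}.
      \<psi> i (x, k) = \<psi> j (x', k') \<and> z = local_rep B \<theta> j (section_ss B s) x' k') = coords (cvec i (s x)) k"
  proof (rule the_equality)
    show "\<exists>j\<in>\<I>. \<exists>x'\<in>patch B j. \<exists>k'\<in>{1..n}.
        \<psi> i (x, k) = \<psi> j (x', k') \<and> coords (cvec i (s x)) k = local_rep B \<theta> j (section_ss B s) x' k'"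
      using i local_rep_section_ss[OF s i(1,2)] by metis
  next
    fix z assume "\<exists>j\<in>\<I>. \<exists>x'\<in>patch B j. \<exists>k'\<in>{1..n}.
        \<psi> i (x, k) = \<psi> j (x', k') \<and> z = local_rep B \<theta> j (section_ss B s) x' k'"
    then obtain j x' k' where j: "j \<in> \<I>" "x' \<in> patch B j" "k' \<in> {1..n}"
      "\<psi> i (x, k) = \<psi> j (x', k')" "z = local_rep B \<theta> j (section_ss B s) x' k'" by blast
    show "z = coords (cvec i (s x)) k"
      using coords_sheet_unique[OF s i j(1-4)] j(5) local_rep_section_ss[OF s j(1,2)] by simp
  qed
  then show ?thesis
    using psi_in[OF i] section_ss_in[OF s] s by (simp add: Xi_def Omega_def)
qed

section \<open>The map \<open>Xi\<close> as a homeomorphism onto the spectrum\<close>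

abbreviation "spectrum \<equiv> spectrum_top \<Gamma>"
abbreviation "\<Xi> \<equiv> Xi B n \<theta> Mh \<psi>"

lemma topspace_spectrum: "topspace spectrum = characters \<Gamma>"
  by (auto simp: spectrum_top_def characters_def PiE_def)

lemma Xi_character:
  assumes "y \<in> points Mh"
  shows "\<Xi> y \<in> characters \<Gamma>"
proof -
  obtain i x k where y: "i \<in> \<I>" "x \<in> patch B i" "k \<in> {1..n}" "y = \<psi> i (x, k)"
    using some_sheet_at[OF assms] .
  note xP = patch_point[OF y(1,2)]
  note X = Xi_apply[OF _ y(1-3), folded y(4)]
  note c = split.coords_hom[OF carrier_A y(3)]
  have "\<Xi> y \<in> alg_hom \<Gamma> complex_alg"
  proof (rule alg_homI)
    fix s t a assume s: "s \<in> carrier \<Gamma>"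
    note v = cvec_hom[OF y(1,2) section_fibre[OF s xP]]
    show "\<Xi> y (a \<odot>\<^bsub>\<Gamma>\<^esub> s) = a \<odot>\<^bsub>complex_alg\<^esub> \<Xi> y s"
      by (simp add: X[OF section_smult_closed[OF s]] X[OF s] section_ops[OF xP] v(1) c(1))
    assume t: "t \<in> carrier \<Gamma>"
    note ft = section_fibre[OF t xP]
    show "\<Xi> y (s \<oplus>\<^bsub>\<Gamma>\<^esub> t) = \<Xi> y s \<oplus>\<^bsub>complex_alg\<^esub> \<Xi> y t"
      using c(2)[OF carrier_A]
      by (simp add: X[OF section_add_closed[OF s t]] X[OF s] X[OF t] section_ops[OF xP] v(2)[OF ft] A(3))
    show "\<Xi> y (s \<otimes>\<^bsub>\<Gamma>\<^esub> t) = \<Xi> y s \<otimes>\<^bsub>complex_alg\<^esub> \<Xi> y t"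
      using c(3)[OF carrier_A]
      by (simp add: X[OF section_mult_closed[OF s t]] X[OF s] X[OF t] section_ops[OF xP] v(3)[OF ft])
  qed simp
  moreover have "\<Xi> y \<one>\<^bsub>\<Gamma>\<^esub> = 1"
    by (simp add: X[OF section_one_closed] section_ops[OF xP] cvec_one[OF y(1,2)] split.coords_one[OF y(3)])
  ultimately show ?thesis
    unfolding characters_def
    by (intro CollectI conjI IntI bexI[of _ "\<one>\<^bsub>\<Gamma>\<^esub>"] section_one_closed)
       (simp_all add: Xi_def[of B n \<theta> Mh \<psi> y])
qed

text \<open>A single index is open in the discrete fibre, and the part of the covering over a patch
  is open because \<open>p\<close> is continuous.\<close>

lemma open_sheet_image:
  assumes i: "i \<in> \<I>" and V: "openM V" "V \<subseteq> patch B i" and k: "k \<in> {1..n}"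
  shows "openin (mtop Mh) (\<psi> i ` (V \<times> {k}))"
proof -
  have "openin (subtopology (mtop M) (patch B i)) V"
    using V openin_open_subtopology[OF patch(1)[OF i]] by simp
  then have "openin (sheet_top i) (V \<times> {k})"
    using k by (simp add: openin_prod_Times_iff)
  then have "openin (subtopology (mtop Mh) (sheets i)) (\<psi> i ` (V \<times> {k}))"
    using homeomorphic_imp_open_map[OF sheet_homeomorphic[OF i]] by (simp add: open_map_def)
  moreover have "openin (mtop Mh) (sheets i)"
    by (rule openin_continuous_map_preimage[OF p_continuous patch(1)[OF i]])
  ultimately show ?thesis using openin_open_subtopology by blast
qed

text \<open>The topology of the spectrum is pointwise convergence, so one section is treated at a
  time; near a given point its transform is a continuous coordinate function on one sheet.\<close>

lemma Xi_continuous: "continuous_map (mtop Mh) spectrum \<Xi>"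
proof -
  have "continuous_map (mtop Mh) euclidean (\<lambda>y. \<Xi> y s)" if s: "s \<in> carrier \<Gamma>" for s
    unfolding continuous_map_def
  proof (intro conjI allI impI)
    fix T :: "complex set" assume "openin euclidean T"
    show "openin (mtop Mh) {y \<in> points Mh. \<Xi> y s \<in> T}"
    proof (subst openin_subopen, rule ballI)
      fix y assume "y \<in> {y \<in> points Mh. \<Xi> y s \<in> T}"
      then have y: "y \<in> points Mh" "\<Xi> y s \<in> T" by auto
      obtain i x k where x: "i \<in> \<I>" "x \<in> patch B i" "k \<in> {1..n}" "y = \<psi> i (x, k)"
        using some_sheet_at[OF y(1)] .
      define V where "V = {x \<in> patch B i. coords (cvec i (s x)) k \<in> T}"
      have "openin (subtopology (mtop M) (patch B i))
          {x \<in> topspace (subtopology (mtop M) (patch B i)). coords (cvec i (s x)) k \<in> T}"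
        by (rule openin_continuous_map_preimage[OF M.smooth_fun_imp_continuous[OF patch(1)[OF x(1)]
              smooth_coords[OF s x(1,3)]] \<open>openin euclidean T\<close>])
      moreover have "{x \<in> topspace (subtopology (mtop M) (patch B i)). coords (cvec i (s x)) k \<in> T} = V"
        using patch(2)[OF x(1)] by (auto simp: V_def)
      ultimately have V: "openM V" "V \<subseteq> patch B i"
        using openin_open_subtopology[OF patch(1)[OF x(1)]] by auto
      have "\<psi> i ` (V \<times> {k}) \<subseteq> {y \<in> points Mh. \<Xi> y s \<in> T}"
        using psi_in[OF x(1) _ x(3)] Xi_apply[OF s x(1) _ x(3)] by (auto simp: V_def)
      moreover have "y \<in> \<psi> i ` (V \<times> {k})"
        using y(2) Xi_apply[OF s x(1-3)] x(2,4) by (simp add: V_def)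
      ultimately show "\<exists>S. openin (mtop Mh) S \<and> y \<in> S \<and> S \<subseteq> {y \<in> points Mh. \<Xi> y s \<in> T}"
        using open_sheet_image[OF x(1) V x(3)] by blast
    qed
  qed simp
  then have "continuous_map (mtop Mh) (product_topology (\<lambda>_. euclidean) (carrier \<Gamma>)) \<Xi>"
    by (auto simp: continuous_map_componentwise Xi_def)
  then show ?thesis
    unfolding spectrum_top_def continuous_map_in_subtopology using Xi_character by blast
qed

lemma separating_section:
  assumes W: "openin (mtop Mh) W" and y: "y \<in> W"
  obtains s where "s \<in> carrier \<Gamma>" "\<Xi> y s \<noteq> 0"
    "\<And>y'. y' \<in> points Mh \<Longrightarrow> y' \<notin> W \<Longrightarrow> \<Xi> y' s = 0"
proof -
  have yP: "y \<in> points Mh" using y openin_subset[OF W] by blast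
  obtain i x k where x: "i \<in> \<I>" "x \<in> patch B i" "k \<in> {1..n}" "y = \<psi> i (x, k)"
    using some_sheet_at[OF yP] .
  \<comment> \<open>The part of the sheet through \<open>y\<close> that lies in \<open>W\<close>,
    seen from the base; the bump will be supported in it.\<close>
  define V where "V = {x \<in> patch B i. \<psi> i (x, k) \<in> W}"
  have "continuous_map (subtopology (mtop M) (patch B i)) (sheet_top i) (\<lambda>x. (x, k))"
    using x(3) by (simp add: continuous_map_pairedI)
  moreover have "continuous_map (sheet_top i) (mtop Mh) (\<psi> i)"
    using homeomorphic_imp_continuous_map[OF sheet_homeomorphic[OF x(1)]]
    by (simp add: continuous_map_in_subtopology)
  ultimately have "continuous_map (subtopology (mtop M) (patch B i)) (mtop Mh) (\<psi> i \<circ> (\<lambda>x. (x, k)))"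
    by (rule continuous_map_compose)
  then have "openin (subtopology (mtop M) (patch B i))
      {x \<in> topspace (subtopology (mtop M) (patch B i)). (\<psi> i \<circ> (\<lambda>x. (x, k))) x \<in> W}"
    by (rule openin_continuous_map_preimage[OF _ W])
  moreover have "{x \<in> topspace (subtopology (mtop M) (patch B i)). (\<psi> i \<circ> (\<lambda>x. (x, k))) x \<in> W} = V"
    using patch(2)[OF x(1)] by (auto simp: V_def)
  ultimately have V: "openM V" "V \<subseteq> patch B i"
    using openin_open_subtopology[OF patch(1)[OF x(1)]] by auto
  have "x \<in> V" using x y by (simp add: V_def)
  obtain \<beta> :: "'m \<Rightarrow> real" and C where \<beta>: "smooth \<beta>" "closedin (mtop M) C" "C \<subseteq> V"
    "\<beta> x = 1" "\<And>x. x \<notin> C \<Longrightarrow> \<beta> x = 0"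
    using bump_in_patch[OF V(1) \<open>x \<in> V\<close>] by blast
  obtain a where a: "coords a = (\<lambda>j\<in>{1..n}. if j = k then 1 else 0)"
    using split.coords_surj[of "\<lambda>j\<in>{1..n}. if j = k then 1 else 0"] by auto
  define s where "s = glue i (\<lambda>x. \<beta> x *\<^sub>R a)"
  note oU = patch(1)[OF x(1)]
  have s: "s \<in> carrier \<Gamma>"
    unfolding s_def
  proof (rule glue_closed[OF x(1) _ \<beta>(2)])
    show "smooth_fun M (patch B i) (\<lambda>x. \<beta> x *\<^sub>R a)"
      by (rule M.smooth_fun_bilinear[OF bounded_bilinear_scaleR oU
            M.smooth_fun_subset[OF \<beta>(1) patch(2)[OF x(1)]] M.smooth_fun_const[OF oU]])
    show "C \<subseteq> patch B i" using \<beta>(3) V(2) by blast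
  qed (simp add: \<beta>(5))
  have s_val: "coords (cvec i (s x')) k' = \<beta> x' * (if k' = k then 1 else 0)" if "x' \<in> patch B i" "k' \<in> {1..n}" for x' k'
    using split.coords_hom(1)[OF carrier_A that(2), of "complex_of_real (\<beta> x')" a] a that(2)
    by (simp add: s_def glue_inside[OF x(1) that(1)] A(4))
  show thesis
  proof (rule that[OF s])
    show "\<Xi> y s \<noteq> 0" using Xi_apply[OF s x(1-3)] s_val[OF x(2,3)] \<beta>(4) x(4) by simp
    fix y' assume y': "y' \<in> points Mh" "y' \<notin> W"
    show "\<Xi> y' s = 0"
    \<comment> \<open>Outside \<open>W\<close> there are three reasons for the value 0: another
      sheet, where the idempotent has coordinate 0; the same sheet off \<open>V\<close>, where the
      bump is 0; a point not over the patch, where the glued section is 0.\<close>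
    proof (cases "p y' \<in> patch B i")
      case True
      obtain k' where k': "k' \<in> {1..n}" "y' = \<psi> i (p y', k')" using sheet_at[OF y'(1) x(1) True] .
      have "\<Xi> y' s = \<beta> (p y') * (if k' = k then 1 else 0)"
        using Xi_apply[OF s x(1) True k'(1)] s_val[OF True k'(1)] k'(2) by simp
      moreover have "\<beta> (p y') = 0" if "k' = k"
      proof -
        have "p y' \<notin> V" using y'(2) k'(2) that by (auto simp: V_def)
        then show ?thesis using \<beta>(3,5) by blast
      qed
      ultimately show ?thesis by auto
    next
      case False
      obtain j x' k' where j: "j \<in> \<I>" "x' \<in> patch B j" "k' \<in> {1..n}" "y' = \<psi> j (x', k')"
        using some_sheet_at[OF y'(1)] .
      have "p y' = x'" using p_psi[OF j(1-3)] j(4) by simp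
      then have "s x' = \<zero>\<^bsub>fibre_at B x'\<^esub>"
        using glue_outside[OF patch_point[OF j(1,2)]] False by (simp add: s_def)
      then show ?thesis
        using Xi_apply[OF s j(1-3)] j(4) cvec_zero[OF j(1,2)]
          linear_0[OF bounded_linear.linear[OF coords_linear[OF j(3)]]] by simp
    qed
  qed
qed

lemma Xi_inj: "inj_on \<Xi> (points Mh)"
proof (rule inj_onI, rule ccontr)
  fix y y' assume y: "y \<in> points Mh" "y' \<in> points Mh" "\<Xi> y = \<Xi> y'" "y \<noteq> y'"
  obtain W W' where "openin (mtop Mh) W" "openin (mtop Mh) W'" "y \<in> W" "y' \<in> W'" "disjnt W W'"
    using Mh.Hausdorff y unfolding Hausdorff_space_def by blast
  then have W: "openin (mtop Mh) W" "y \<in> W" "y' \<notin> W" by (auto simp: disjnt_iff)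
  obtain s where "s \<in> carrier \<Gamma>" "\<Xi> y s \<noteq> 0" "\<Xi> y' s = 0"
    using separating_section[OF W(1,2)] y(2) W(3) by metis
  with y(3) show False by simp
qed

lemma Xi_surj: "\<Xi> ` points Mh = characters \<Gamma>"
proof (intro equalityI subsetI)
  fix f assume f: "f \<in> characters \<Gamma>"
  then obtain s0 where s0: "s0 \<in> carrier \<Gamma>" "f s0 \<noteq> 0" by (auto simp: characters_def)
  interpret section_character B f s0
    by unfold_locales (use f s0 in \<open>simp_all add: characters_def\<close>)
  obtain m i \<eta> where m: "m \<in> points M" "i \<in> \<I>" "m \<in> patch B i" "\<eta> \<in> alg_hom A complex_alg"
    "\<And>s. s \<in> carrier \<Gamma> \<Longrightarrow> f s = \<eta> (cvec i (s m))"
    by (rule character_factors_through_fibre) blast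
  have "\<eta> (cvec i (s0 m)) \<noteq> 0" using m(5)[OF s0(1)] s0(2) by simp
  then obtain k where k: "k \<in> {1..n}" "\<And>a. a \<in> carrier A \<Longrightarrow> \<eta> a = coords a k"
    using split.character_eq_coord[OF m(4) carrier_A] by blast
  have "f = \<Xi> (\<psi> i (m, k))"
  proof (rule extensionalityI)
    show "f \<in> extensional (carrier \<Gamma>)" using f by (simp add: characters_def)
    show "\<Xi> (\<psi> i (m, k)) \<in> extensional (carrier \<Gamma>)" by (simp add: Xi_def)
    fix s assume s: "s \<in> carrier \<Gamma>"
    show "f s = \<Xi> (\<psi> i (m, k)) s"
      using m(5)[OF s] k(2)[OF carrier_A] Xi_apply[OF s m(2,3) k(1)] by simp
  qed
  then show "f \<in> \<Xi> ` points Mh" using psi_in[OF m(2,3) k(1)] by blast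
qed (use Xi_character in blast)

lemma Xi_homeomorphic: "homeomorphic_map (mtop Mh) spectrum \<Xi>"
proof (rule bijective_open_imp_homeomorphic_map[OF Xi_continuous])
  show "\<Xi> ` points Mh = topspace spectrum" by (simp only: Xi_surj topspace_spectrum)
  show "inj_on \<Xi> (points Mh)" by (rule Xi_inj)
  show "open_map (mtop Mh) spectrum \<Xi>"
    unfolding open_map_def
  proof (intro allI impI)
    fix W assume W: "openin (mtop Mh) W"
    show "openin spectrum (\<Xi> ` W)"
    proof (subst openin_subopen, rule ballI)
      fix f assume "f \<in> \<Xi> ` W"
      then obtain y where y: "y \<in> W" "f = \<Xi> y" by blast
      obtain s where s: "s \<in> carrier \<Gamma>" "\<Xi> y s \<noteq> 0"
        "\<And>y'. y' \<in> points Mh \<Longrightarrow> y' \<notin> W \<Longrightarrow> \<Xi> y' s = 0"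
        using separating_section[OF W y(1)] by blast
      \<comment> \<open>As \<open>Xi\<close> is onto, each member of this open set is some
        \<open>Xi y'\<close>, and \<open>y'\<close> lies in \<open>W\<close> because
        \<open>Xi y'\<close> vanishes at \<open>s\<close> for the other points.\<close>
      let ?N = "{g \<in> topspace spectrum. g s \<in> - {0}}"
      have "continuous_map spectrum euclidean (\<lambda>g. g s)"
        unfolding spectrum_top_def
        by (rule continuous_map_from_subtopology[OF continuous_map_product_projection[OF s(1)]])
      then have "openin spectrum ?N" by (rule openin_continuous_map_preimage) auto
      moreover have "f \<in> ?N"
        using s(2) y Xi_character[of y] openin_subset[OF W] by (auto simp: topspace_spectrum)
      moreover have "?N \<subseteq> \<Xi> ` W"
      proof
        fix g assume "g \<in> ?N"
        then have "g \<in> \<Xi> ` points Mh" "g s \<noteq> 0" by (simp_all add: topspace_spectrum Xi_surj)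
        then show "g \<in> \<Xi> ` W" using s(3) by blast
      qed
      ultimately show "\<exists>T. openin spectrum T \<and> f \<in> T \<and> T \<subseteq> \<Xi> ` W" by blast
    qed
  qed
qed

section \<open>The spectrum as a covering of the base\<close>

lemma spectrum_covering: "n_fold_covering n spectrum (mtop M) (p \<circ> inv_into (points Mh) \<Xi>)"
proof -
  let ?g = "inv_into (points Mh) \<Xi>"
  have g\<Xi>: "?g (\<Xi> y) = y" if "y \<in> points Mh" for y
    by (rule inv_into_f_f[OF Xi_inj that])
  \<comment> \<open>A continuous inverse is given by the homeomorphism; on the spectrum it agrees
    with the \<open>inv_into\<close> of the statement, so continuity can be transferred.\<close>
  obtain g' where g': "homeomorphic_maps (mtop Mh) spectrum \<Xi> g'"
    using Xi_homeomorphic homeomorphic_map_maps by blast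
  have "continuous_map spectrum (mtop Mh) ?g"
  proof (rule continuous_map_eq)
    show "continuous_map spectrum (mtop Mh) g'" using g' by (simp add: homeomorphic_maps_def)
    fix f assume "f \<in> topspace spectrum"
    then obtain y where "y \<in> points Mh" "f = \<Xi> y" by (auto simp: topspace_spectrum Xi_surj[symmetric])
    then show "g' f = ?g f" using g' g\<Xi> by (simp add: homeomorphic_maps_def)
  qed
  then have "continuous_map spectrum (mtop M) (p \<circ> ?g)"
    by (rule continuous_map_compose[OF _ p_continuous])
  moreover have "\<exists>U \<Psi>. openM U \<and> m \<in> U \<and>
      homeomorphic_map (prod_topology (subtopology (mtop M) U) (discrete_topology {1..n}))
        (subtopology spectrum {f \<in> topspace spectrum. (p \<circ> ?g) f \<in> U}) \<Psi> \<and>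
      (\<forall>u\<in>U. \<forall>k\<in>{1..n}. (p \<circ> ?g) (\<Psi> (u, k)) = u)" if m: "m \<in> points M" for m
  proof -
    obtain i where i: "i \<in> \<I>" "m \<in> patch B i" using m by (rule patch_at)
    have "\<Xi> ` (points Mh \<inter> sheets i) = topspace spectrum \<inter> {f \<in> topspace spectrum. (p \<circ> ?g) f \<in> patch B i}"
      using g\<Xi> by (auto simp: topspace_spectrum Xi_surj[symmetric])
    then have "homeomorphic_map (subtopology (mtop Mh) (sheets i))
        (subtopology spectrum {f \<in> topspace spectrum. (p \<circ> ?g) f \<in> patch B i}) \<Xi>"
      by (rule homeomorphic_map_subtopologies[OF Xi_homeomorphic])
    \<comment> \<open>The local trivialisations of the spectrum are those of the covering followed
      by \<open>Xi\<close>.\<close>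
    then have "homeomorphic_map (sheet_top i)
        (subtopology spectrum {f \<in> topspace spectrum. (p \<circ> ?g) f \<in> patch B i}) (\<Xi> \<circ> \<psi> i)"
      by (rule homeomorphic_map_compose[OF sheet_homeomorphic[OF i(1)]])
    moreover have "(p \<circ> ?g) ((\<Xi> \<circ> \<psi> i) (u, k)) = u" if "u \<in> patch B i" "k \<in> {1..n}" for u k
      using g\<Xi>[OF psi_in[OF i(1) that]] p_psi[OF i(1) that] by simp
    ultimately show ?thesis
      using patch(1)[OF i(1)] i(2) by (intro exI[of _ "patch B i"] exI[of _ "\<Xi> \<circ> \<psi> i"]) simp
  qed
  ultimately show ?thesis unfolding n_fold_covering_def by blast
qed

end

theorem theorem6p14:
  fixes B :: "('m, 'b::real_normed_vector, 'e, 'c::real_normed_vector,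
               'a::real_normed_vector, 'i) bundle_data"
    and n :: nat
    and \<theta> :: "'a set \<Rightarrow> nat \<Rightarrow> complex"
    and Mh :: "('h, 'b) manifold_data"
    and p :: "'h \<Rightarrow> 'm"
    and \<psi> :: "'i \<Rightarrow> 'm \<times> nat \<Rightarrow> 'h"
  assumes "fd_normed_algebra (typical_fibre B)"
    and "algebra_bundle B"
    and "has_dimension (fibre_ss B) n"
    and "\<theta> \<in> alg_iso (fibre_ss B) (power_alg n)"
    and "associated_covering B n \<theta> Mh p \<psi>"
  shows "homeomorphic_map (mtop Mh) (spectrum_top (section_alg B)) (Xi B n \<theta> Mh \<psi>) \<and>
         n_fold_covering n (spectrum_top (section_alg B)) (mtop (base_space B))
           (p \<circ> inv_into (points Mh) (Xi B n \<theta> Mh \<psi>))"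
proof -
  interpret split_algebra_bundle B n \<theta> Mh p \<psi>
    by unfold_locales (rule assms)+
  show ?thesis using Xi_homeomorphic spectrum_covering by blast
qed

end
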